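(* Let $A$ be an $N$-function or $A=\infty$. Assume that $\phi$ is slowly varying at infinity with $\lim_{s\to\infty}\phi(s)=\infty$. Suppose that $a:\mathbb{R}^d\to[0,\infty)$ is measurable, $$\int_{\mathbb{R}^d}(1\wedge|z|^2)\,a(z)J(z)\,dz<\infty,$$ and that there are $\rho_0,c_0\in(0,1)$ such that $a(z)\ge c_0$ for all $|z|<\rho_0$. Let $\mathcal{L}u(x)=\int_{\mathbb{R}^d}(u(x+z)-u(x))\,a(z)J(z)\,dz$. Then there exists a constant $\lambda_0>0$ such that for any $\lambda\ge\lambda_0$ and any $\alpha\in\mathbb{R}$, $$\lambda\|u\|_{B^{\psi,\alpha}_A}+\|u\|_{B^{\psi,1+\alpha}_A}\le C\,\|\lambda u-\mathcal{L}u\|_{B^{\psi,\alpha}_A},$$ provided that $u\in B^{\psi,1+\alpha}_A$. Here $C$ is a constant only depending on $d,\psi,\rho_0,c_0$ and $\alpha$.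
   Context: $S$ is a driftless subordinator with Lévy measure $\Pi$ on $(0,\infty)$, $\int_0^\infty(1\wedge t)\,\Pi(dt)<\infty$, and Laplace exponent $\phi(s)=-\log\mathbf{E}e^{-sS_1}=\int_0^\infty(1-e^{-st})\,\Pi(dt)$. $J(z)=\int_0^\infty(4\pi t)^{-d/2}e^{-|z|^2/(4t)}\,\Pi(dt)$ is the jump kernel of the subordinate Brownian motion $\sqrt2B_{S_t}$ ($B$ a $d$-dimensional Brownian motion independent of $S$), $\psi(r)=\phi(r^2)$ for $r>0$, and $\psi^{-1}$ is the inverse function of $\psi$. A measurable $f:(0,\infty)\to(0,\infty)$ is slowly varying at infinity if $\lim_{x\to\infty}f(bx)/f(x)=1$ for all $b>0$. $N$-function: $A(t)=\int_0^t\alpha_0(s)\,ds$ with $\alpha_0:[0,\infty)\to[0,\infty)$ nondecreasing, right continuous, $\alpha_0(0)=0$, $\alpha_0(t)>0$ for $t>0$, $\alpha_0(t)\to\infty$ as $t\to\infty$. Luxemburg norm: $\|f\|_A=\inf\{\kappa>0:\int_{\mathbb{R}^d}A(|f(x)|/\kappa)\,dx\le1\}$; for $A=\infty$, $\|\cdot\|_A$ is the $L^\infty$ norm. $\psi$-decomposition: fix a smooth, nonnegative, rotationally symmetric $\chi$ on $\mathbb{R}^d$ with $\chi(\xi)=1$ for $|\xi|\le3/4$ and $\chi(\xi)=0$ for $|\xi|\ge1$. For $j\ge0$ let $\chi_j(\xi)=\chi(\xi/\psi^{-1}(2^j))$, $\Pi^\psi_jf=\mathcal{F}^{-1}((\chi_{j+1}-\chi_j)\mathcal{F}f)$,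 and $\Pi^\psi_{-1}f=\mathcal{F}^{-1}(\chi_0\mathcal{F}f)$, $\mathcal F$ being the Fourier transform. For $s\in\mathbb{R}$, $B^{\psi,s}_A$ is the space of distributions $f$ with $\|f\|_{B^{\psi,s}_A}=\sup_{j\ge-1}2^{js}\|\Pi^\psi_jf\|_A<\infty$.
   Formalization: Since Lu need not converge when only (1∧|z|²)a(z)J(z) is integrable, Lu is read weakly as a principal value at z=0, and the estimate is for u with (1∧|z|)a(z)J(z) integrable or this principal value existing. *)

theory Defs
  imports "HOL-Analysis.Analysis" "HOL-Probability.Essential_Supremum"
begin

section \<open>Subordinators and subordinate Brownian motion\<close>

text \<open>The law of a driftless subordinator is determined by its Levy measure on the positive half line,
  which is represented by a Borel measure on the reals that does not charge the nonpositive ones.\<close>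

definition levy_measure :: "real measure \<Rightarrow> bool" where
  "levy_measure \<nu> \<longleftrightarrow> sets \<nu> = sets borel \<and> emeasure \<nu> {..0} = 0 \<and>
     (\<integral>\<^sup>+t. ennreal (min 1 t) \<partial>\<nu>) < \<infinity>"

definition laplace_exponent :: "real measure \<Rightarrow> real \<Rightarrow> real" where
  "laplace_exponent \<nu> s = (\<integral>t. (1 - exp (- (s * t))) \<partial>\<nu>)"

text \<open>For a measure as above and \<open>z \<noteq> 0\<close> the integrand is integrable; the value at \<open>z = 0\<close>
  is irrelevant, since the kernel is only used under integrals with respect to \<open>lborel\<close>.\<close>

definition jump_kernel :: "real measure \<Rightarrow> 'a::euclidean_space \<Rightarrow> real" where
  "jump_kernel \<nu> z =
     (\<integral>t. (4 * pi * t) powr (- (real DIM('a) / 2)) * exp (- ((norm z)\<^sup>2 / (4 * t))) \<partial>\<nu>)"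

definition psi :: "real measure \<Rightarrow> real \<Rightarrow> real" where
  "psi \<nu> r = laplace_exponent \<nu> (r\<^sup>2)"

definition psi_inv :: "real measure \<Rightarrow> real \<Rightarrow> real" where
  "psi_inv \<nu> = inv_into {0<..} (psi \<nu>)"

definition slowly_varying :: "(real \<Rightarrow> real) \<Rightarrow> bool" where
  "slowly_varying f \<longleftrightarrow> f \<in> borel_measurable (restrict_space borel {0<..}) \<and> (\<forall>x>0. 0 < f x) \<and>
     (\<forall>b>0. ((\<lambda>x. f (b * x) / f x) \<longlongrightarrow> 1) at_top)"


section \<open>N-functions and Luxemburg norms\<close>

definition is_N_function :: "(real \<Rightarrow> real) \<Rightarrow> bool" where
  "is_N_function A \<longleftrightarrow> (\<exists>\<alpha>\<^sub>0 :: real \<Rightarrow> real.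
     (\<forall>s\<ge>0. 0 \<le> \<alpha>\<^sub>0 s) \<and> mono_on {0..} \<alpha>\<^sub>0 \<and> (\<forall>s\<ge>0. continuous (at_right s) \<alpha>\<^sub>0) \<and>
     \<alpha>\<^sub>0 0 = 0 \<and> (\<forall>s>0. 0 < \<alpha>\<^sub>0 s) \<and> filterlim \<alpha>\<^sub>0 at_top at_top \<and>
     (\<forall>t\<ge>0. A t = integral {0..t} \<alpha>\<^sub>0))"

text \<open>\<open>Infty\<close> stands for \<open>A = \<infinity>\<close>.\<close>

datatype orlicz = NFun "real \<Rightarrow> real" | Infty

fun valid_orlicz :: "orlicz \<Rightarrow> bool" where
  "valid_orlicz (NFun A) = is_N_function A"
| "valid_orlicz Infty = True"

fun luxemburg_norm :: "orlicz \<Rightarrow> ('a::euclidean_space \<Rightarrow> complex) \<Rightarrow> ennreal" where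
  "luxemburg_norm (NFun A) f =
     Inf (ennreal ` {\<kappa>. 0 < \<kappa> \<and> (\<integral>\<^sup>+x. ennreal (A (norm (f x) / \<kappa>)) \<partial>lborel) \<le> 1})"
| "luxemburg_norm Infty f = esssup lborel (\<lambda>x. ennreal (norm (f x)))"


section \<open>Schwartz functions and tempered distributions\<close>

fun dir_derivs :: "'a::real_normed_vector list \<Rightarrow> ('a \<Rightarrow> 'b::real_normed_vector) \<Rightarrow> 'a \<Rightarrow> 'b" where
  "dir_derivs [] f = f"
| "dir_derivs (v # vs) f = (\<lambda>x. frechet_derivative (dir_derivs vs f) (at x) v)"

definition smooth :: "('a::real_normed_vector \<Rightarrow> 'b::real_normed_vector) \<Rightarrow> bool" where
  "smooth f \<longleftrightarrow> (\<forall>vs x. dir_derivs vs f differentiable at x)"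

definition schwartz :: "('a::euclidean_space \<Rightarrow> complex) set" where
  "schwartz = {\<phi>. smooth \<phi> \<and>
     (\<forall>vs k. set vs \<subseteq> Basis \<longrightarrow> bdd_above (range (\<lambda>x. (1 + norm x) ^ k * norm (dir_derivs vs \<phi> x))))}"

definition schwartz_seminorm :: "nat \<Rightarrow> ('a::euclidean_space \<Rightarrow> complex) \<Rightarrow> real" where
  "schwartz_seminorm N \<phi> = (SUP (vs, x) \<in> {vs. set vs \<subseteq> Basis \<and> length vs \<le> N} \<times> UNIV.
     (1 + norm x) ^ N * norm (dir_derivs vs \<phi> x))"

text \<open>Distributions are represented by functionals on all functions; only their values on
  \<^const>\<open>schwartz\<close> carry meaning. The seminorm bound is continuity on the Schwartz space.\<close>

type_synonym 'a distr = "('a \<Rightarrow> complex) \<Rightarrow> complex"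

definition tempered :: "'a::euclidean_space distr \<Rightarrow> bool" where
  "tempered u \<longleftrightarrow>
     (\<forall>\<phi>\<in>schwartz. \<forall>\<eta>\<in>schwartz. u (\<lambda>x. \<phi> x + \<eta> x) = u \<phi> + u \<eta>) \<and>
     (\<forall>\<phi>\<in>schwartz. \<forall>c. u (\<lambda>x. c * \<phi> x) = c * u \<phi>) \<and>
     (\<exists>N C. \<forall>\<phi>\<in>schwartz. norm (u \<phi>) \<le> C * schwartz_seminorm N \<phi>)"

definition represents :: "('a::euclidean_space \<Rightarrow> complex) \<Rightarrow> 'a distr \<Rightarrow> bool" where
  "represents g u \<longleftrightarrow> g \<in> borel_measurable lborel \<and>
     (\<forall>\<phi>\<in>schwartz. integrable lborel (\<lambda>x. g x * \<phi> x) \<and> u \<phi> = (\<integral>x. g x * \<phi> x \<partial>lborel))"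

text \<open>A representing function is unique almost everywhere, so the infimum is the Luxemburg norm
  of that function, and \<open>\<infinity>\<close> if the distribution is not given by a function.\<close>

definition luxemburg_norm_distr :: "orlicz \<Rightarrow> 'a::euclidean_space distr \<Rightarrow> ennreal" where
  "luxemburg_norm_distr A u = (INF g \<in> {g. represents g u}. luxemburg_norm A g)"

definition fourier :: "('a::euclidean_space \<Rightarrow> complex) \<Rightarrow> 'a \<Rightarrow> complex" where
  "fourier \<phi> \<xi> = (\<integral>x. cis (- (x \<bullet> \<xi>)) * \<phi> x \<partial>lborel)"

definition inv_fourier :: "('a::euclidean_space \<Rightarrow> complex) \<Rightarrow> 'a \<Rightarrow> complex" where
  "inv_fourier \<phi> x =
     complex_of_real ((2 * pi) powr (- real DIM('a))) * (\<integral>\<xi>. cis (x \<bullet> \<xi>) * \<phi> \<xi> \<partial>lborel)"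

definition fourier_distr :: "'a::euclidean_space distr \<Rightarrow> 'a distr" where
  "fourier_distr u = (\<lambda>\<phi>. u (fourier \<phi>))"

definition inv_fourier_distr :: "'a::euclidean_space distr \<Rightarrow> 'a distr" where
  "inv_fourier_distr u = (\<lambda>\<phi>. u (inv_fourier \<phi>))"

definition mult_distr :: "('a::euclidean_space \<Rightarrow> real) \<Rightarrow> 'a distr \<Rightarrow> 'a distr" where
  "mult_distr m u = (\<lambda>\<phi>. u (\<lambda>\<xi>. complex_of_real (m \<xi>) * \<phi> \<xi>))"


section \<open>The \<open>\<psi>\<close>-decomposition and Besov spaces\<close>

definition lp_cutoff :: "('a::euclidean_space \<Rightarrow> real) \<Rightarrow> bool" where
  "lp_cutoff \<theta> \<longleftrightarrow> smooth \<theta> \<and> (\<forall>\<xi>. 0 \<le> \<theta> \<xi>) \<and>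
     (\<forall>R. orthogonal_transformation R \<longrightarrow> (\<forall>\<xi>. \<theta> (R \<xi>) = \<theta> \<xi>)) \<and>
     (\<forall>\<xi>. norm \<xi> \<le> 3/4 \<longrightarrow> \<theta> \<xi> = 1) \<and> (\<forall>\<xi>. 1 \<le> norm \<xi> \<longrightarrow> \<theta> \<xi> = 0)"

definition cutoff_at :: "real measure \<Rightarrow> ('a::euclidean_space \<Rightarrow> real) \<Rightarrow> int \<Rightarrow> 'a \<Rightarrow> real" where
  "cutoff_at \<nu> \<theta> j \<xi> = \<theta> (\<xi> /\<^sub>R psi_inv \<nu> (2 powr real_of_int j))"

definition lp_symbol :: "real measure \<Rightarrow> ('a::euclidean_space \<Rightarrow> real) \<Rightarrow> int \<Rightarrow> 'a \<Rightarrow> real" where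
  "lp_symbol \<nu> \<theta> j \<xi> =
     (if j = -1 then cutoff_at \<nu> \<theta> 0 \<xi> else cutoff_at \<nu> \<theta> (j + 1) \<xi> - cutoff_at \<nu> \<theta> j \<xi>)"

definition lp_block ::
    "real measure \<Rightarrow> ('a::euclidean_space \<Rightarrow> real) \<Rightarrow> int \<Rightarrow> 'a distr \<Rightarrow> 'a distr" where
  "lp_block \<nu> \<theta> j u = inv_fourier_distr (mult_distr (lp_symbol \<nu> \<theta> j) (fourier_distr u))"

definition besov_norm ::
    "real measure \<Rightarrow> ('a::euclidean_space \<Rightarrow> real) \<Rightarrow> orlicz \<Rightarrow> real \<Rightarrow> 'a distr \<Rightarrow> ennreal" where
  "besov_norm \<nu> \<theta> A s u =
     (SUP j \<in> {-1..}. ennreal (2 powr (real_of_int j * s)) * luxemburg_norm_distr A (lp_block \<nu> \<theta> j u))"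

definition besov_space ::
    "real measure \<Rightarrow> ('a::euclidean_space \<Rightarrow> real) \<Rightarrow> orlicz \<Rightarrow> real \<Rightarrow> 'a distr set" where
  "besov_space \<nu> \<theta> A s = {u. tempered u \<and> besov_norm \<nu> \<theta> A s u < \<infinity>}"


section \<open>The nonlocal operator on distributions\<close>

text \<open>The integral of \<open>(u(\<cdot> + z) - u) a(z) J(z)\<close> is taken weakly: it is tested against \<open>\<phi>\<close>, and
  \<open>u(\<cdot> + z)\<close> acts on \<open>\<phi>\<close> as \<open>u\<close> acts on \<open>\<phi>(\<cdot> - z)\<close>.
  Integrability of \<open>(1 \<and> |z|\<^sup>2) a(z) J(z)\<close> controls it away from \<open>z = 0\<close>, but does not give
  absolute convergence at \<open>z = 0\<close>, where it is therefore a principal value. It is the Lebesgue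
  integral whenever the latter exists.\<close>

definition nonlocal_trunc ::
    "real measure \<Rightarrow> ('a::euclidean_space \<Rightarrow> real) \<Rightarrow> real \<Rightarrow> 'a distr \<Rightarrow> 'a distr" where
  "nonlocal_trunc \<nu> a \<epsilon> u = (\<lambda>\<phi>. \<integral>z. indicator {z. \<epsilon> < norm z} z *\<^sub>R
     ((u (\<lambda>x. \<phi> (x - z)) - u \<phi>) * complex_of_real (a z * jump_kernel \<nu> z)) \<partial>lborel)"

definition nonlocal_op ::
    "real measure \<Rightarrow> ('a::euclidean_space \<Rightarrow> real) \<Rightarrow> 'a distr \<Rightarrow> 'a distr" where
  "nonlocal_op \<nu> a u = (\<lambda>\<phi>. Lim (at_right 0) (\<lambda>\<epsilon>. nonlocal_trunc \<nu> a \<epsilon> u \<phi>))"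

text \<open>The first alternative is the standard condition for absolute convergence and does not
  involve \<open>u\<close>; otherwise the principal value has to exist.\<close>

definition nonlocal_op_defined ::
    "real measure \<Rightarrow> ('a::euclidean_space \<Rightarrow> real) \<Rightarrow> 'a distr \<Rightarrow> bool" where
  "nonlocal_op_defined \<nu> a u \<longleftrightarrow>
     (\<integral>\<^sup>+z. ennreal (min 1 (norm z) * (a z * jump_kernel \<nu> z)) \<partial>lborel) < \<infinity> \<or>
     (\<forall>\<phi>\<in>schwartz. \<exists>l. ((\<lambda>\<epsilon>. nonlocal_trunc \<nu> a \<epsilon> u \<phi>) \<longlongrightarrow> l) (at_right 0))"

end

theory Submission
  imports Defs "HOL-Probability.Probability"
begin

text \<open>The idea. Write \<open>f \<star> M\<close> for the function \<open>x \<mapsto> \<integral>f(x + y) M(y) dy\<close>. If the kernel \<open>K = a J\<close> were integrable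
with mass \<open>|K|\<close>, then \<open>L f = f \<star> K - |K| f\<close>, so \<open>(\<lambda> + |K|) f = (\<lambda> f - L f) + f \<star> K\<close>. Jensen's inequality
gives \<open>\<parallel>f \<star> M\<parallel> \<le> \<parallel>M\<parallel>\<^sub>1 \<parallel>f\<parallel>\<close> in every Luxemburg norm, and the triangle inequality yields
\<open>(\<lambda> + |K| - \<parallel>K - M\<parallel>\<^sub>1) \<parallel>f\<parallel> \<le> \<parallel>\<lambda> f - L f\<parallel>\<close> for each \<open>M\<close> with \<open>f \<star> M = 0\<close>. The choice
\<open>M = 0\<close> shows that \<open>L\<close> is dissipative. A good choice of \<open>M\<close> shows more if \<open>f\<close> has no low frequencies, and this
is applied to each block of \<open>u\<close>: translation invariance makes the blocks commute with \<open>L\<close>.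

The gain. A block \<open>f\<close> with index \<open>j \<ge> 0\<close> lives at frequencies above \<open>3 R / 4\<close>, where \<open>\<psi>(R) = 2\<^sup>j\<close>. The kernel \<open>k\<close> of a
low-pass filter at frequency \<open>R / 2\<close> has mass one and satisfies \<open>f \<star> k = 0\<close>. The jump kernel is the mixture of the heat
kernels \<open>p\<^sub>t\<close> with respect to \<open>\<nu>(dt)\<close>. Let \<open>P\<close> be \<open>c\<^sub>0\<close> times the part of this mixture with \<open>s < t \<le> \<tau>\<close>, where
\<open>s = B / R\<^sup>2\<close> for a large constant \<open>B\<close>, and let the correction be the convolution \<open>P * k\<close>. As \<open>P\<close> varies on the
scale \<open>sqrt s\<close>, which is much larger than \<open>1 / R\<close>, the convolution \<open>P * k\<close> is close to \<open>P\<close> in \<open>L\<^sup>1\<close>; as \<open>\<tau>\<close> is small,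
\<open>P\<close> hardly charges \<open>|z| \<ge> \<rho>\<^sub>0\<close>, and elsewhere \<open>P \<le> K\<close>. So the gain \<open>|K| - \<parallel>K - P * k\<parallel>\<^sub>1\<close> is at least half of
the mass \<open>c\<^sub>0 \<nu>(s, \<tau>]\<close> of \<open>P\<close> (\<open>block_coercive_estimate\<close>). Slow variation says that almost all of
\<open>\<phi>(R\<^sup>2) = \<integral>(1 - exp (- R\<^sup>2 t)) \<nu>(dt)\<close> comes from times \<open>t\<close> far beyond \<open>1 / R\<^sup>2\<close>, so that \<open>\<nu>(s, \<tau>] \<ge> 2\<^sup>j / 2\<close> for
large \<open>j\<close> (\<open>laplace_exponent_mass\<close>). For the remaining \<open>j\<close> the number \<open>2\<^sup>j\<close> is bounded, and dissipativity with
\<open>\<lambda> \<ge> 1\<close> suffices (\<open>uniform_block_estimate\<close>).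

The singularity. Since \<open>K\<close> is only integrable away from the origin, the argument is run for the truncation
\<open>L\<^sub>\<epsilon>\<close> to \<open>|z| > \<epsilon>\<close>, with \<open>(L - L\<^sub>\<epsilon>) f\<close> as an error. It tends to zero in norm and not just weakly
(\<open>principal_value_approximation\<close>), because \<open>f = f \<star> \<kappa>\<close> for a Schwartz function \<open>\<kappa>\<close>, so that the difference
quotients of \<open>f\<close> can be moved to \<open>\<kappa>\<close> and expanded to second order.

All of this takes place at the level of distributions, through \<open>dconv\<close>. Fourier analysis provides the identities
\<open>f \<star> \<kappa> = f\<close> and \<open>f \<star> k = 0\<close> and the mass of \<open>k\<close>; these rest on Fourier inversion for compactly supported
smooth functions (\<open>fourier_inversion\<close>).\<close>

section \<open>Smooth functions\<close>

text \<open>Directional derivatives of all orders stay in a class that is closed under directional derivatives. Every closure property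
of smoothness below is obtained by naming such a class.\<close>

lemma smooth_coinduct:
  assumes "f \<in> S"
    and "\<And>g x. g \<in> S \<Longrightarrow> g differentiable at x"
    and "\<And>g v. g \<in> S \<Longrightarrow> (\<lambda>x. frechet_derivative g (at x) v) \<in> S"
  shows "smooth f"
proof -
  have "dir_derivs vs f \<in> S" for vs
    by (induction vs) (use assms in auto)
  then show ?thesis
    using assms(2) by (auto simp: smooth_def)
qed

lemma smooth_differentiable: "smooth f \<Longrightarrow> f differentiable at x"
  unfolding smooth_def by (metis dir_derivs.simps(1))

lemma dir_derivs_append: "dir_derivs (vs @ ws) f = dir_derivs vs (dir_derivs ws f)"
  by (induction vs) auto

lemma smooth_dir_derivs: "smooth f \<Longrightarrow> smooth (dir_derivs vs f)"
  unfolding smooth_def by (metis dir_derivs_append)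

lemma smooth_frechet_derivative:
  assumes "smooth f"
  shows "smooth (\<lambda>x. frechet_derivative f (at x) v)"
  using smooth_dir_derivs[OF assms, of "[v]"] by simp

lemma smooth_has_derivative:
  "smooth f \<Longrightarrow> (f has_derivative frechet_derivative f (at x)) (at x)"
  using smooth_differentiable frechet_derivative_works by blast

lemma smooth_continuous_on: "smooth f \<Longrightarrow> continuous_on A f"
  by (meson differentiable_imp_continuous_within smooth_differentiable continuous_at_imp_continuous_on)

lemma smooth_borel_measurable:
  fixes f :: "'a::euclidean_space \<Rightarrow> 'b::real_normed_vector"
  shows "smooth f \<Longrightarrow> f \<in> borel_measurable borel"
  by (intro borel_measurable_continuous_onI smooth_continuous_on)

lemma frechet_derivativeI: "(f has_derivative D) (at x) \<Longrightarrow> frechet_derivative f (at x) v = D v"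
  by (metis frechet_derivative_at)

lemma smooth_frechet_derivative_sum_Basis:
  fixes f :: "'a::euclidean_space \<Rightarrow> 'b::real_normed_vector"
  assumes "smooth f"
  shows "frechet_derivative f (at x) v = (\<Sum>i\<in>Basis. (v \<bullet> i) *\<^sub>R frechet_derivative f (at x) i)"
proof -
  interpret linear "frechet_derivative f (at x)"
    using smooth_has_derivative[OF assms] has_derivative_linear by blast
  have "frechet_derivative f (at x) v = frechet_derivative f (at x) (\<Sum>i\<in>Basis. (v \<bullet> i) *\<^sub>R i)"
    by (simp add: euclidean_representation)
  then show ?thesis by (simp add: sum scale)
qed

lemma smooth_const_add_linear:
  fixes l :: "'a::real_normed_vector \<Rightarrow> 'b::real_normed_vector"
  assumes "bounded_linear l"
  shows "smooth (\<lambda>x. c + l x)"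
proof (rule smooth_coinduct[where S="{f. \<exists>c l. bounded_linear l \<and> f = (\<lambda>x. c + l x)}"])
  show "(\<lambda>x. c + l x) \<in> {f. \<exists>c l. bounded_linear l \<and> f = (\<lambda>x. c + l x)}"
    using assms by blast
next
  fix g :: "'a \<Rightarrow> 'b" and x v
  assume "g \<in> {f. \<exists>c l. bounded_linear l \<and> f = (\<lambda>x. c + l x)}"
  then obtain c l where l: "bounded_linear l" and g: "g = (\<lambda>x. c + l x)" by blast
  have d: "(g has_derivative l) (at x)" for x
    unfolding g by (auto intro!: derivative_eq_intros bounded_linear.has_derivative[OF l])
  show "g differentiable at x" using d differentiable_def by blast
  have "(\<lambda>x. frechet_derivative g (at x) v) = (\<lambda>x. l v + 0)"
    using frechet_derivativeI[OF d] by auto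
  then show "(\<lambda>x. frechet_derivative g (at x) v) \<in> {f. \<exists>c l. bounded_linear l \<and> f = (\<lambda>x. c + l x)}"
    using bounded_linear_zero by blast
qed

lemma has_derivative_affine_compose:
  fixes f :: "'a::real_normed_vector \<Rightarrow> 'b::real_normed_vector" and c :: real
  assumes "smooth f" and "bounded_linear L"
  shows "((\<lambda>x. L (f (c *\<^sub>R x + b))) has_derivative
    (\<lambda>v. L (frechet_derivative f (at (c *\<^sub>R x + b)) (c *\<^sub>R v)))) (at x)"
proof -
  have 1: "((\<lambda>x. c *\<^sub>R x + b) has_derivative (\<lambda>v. c *\<^sub>R v)) (at x)"
    by (auto intro!: derivative_eq_intros)
  have "((\<lambda>x. f (c *\<^sub>R x + b)) has_derivative
    (\<lambda>v. frechet_derivative f (at (c *\<^sub>R x + b)) (c *\<^sub>R v))) (at x)"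
    using has_derivative_compose[OF 1 smooth_has_derivative[OF assms(1)]] .
  from bounded_linear.has_derivative[OF assms(2) this] show ?thesis .
qed

text \<open>One lemma for dilations, translations and the change of target along a bounded linear map: together these maps form a class
that is closed under directional derivatives.\<close>

lemma smooth_affine_compose:
  fixes f :: "'a::real_normed_vector \<Rightarrow> 'b::real_normed_vector" and c :: real
    and L :: "'b \<Rightarrow> 'c::real_normed_vector"
  assumes "smooth f" and "bounded_linear L"
  shows "smooth (\<lambda>x. L (f (c *\<^sub>R x + b)))"
proof (rule smooth_coinduct[where S="{\<lambda>x. L (f (c *\<^sub>R x + b)) | f. smooth f}"])
  fix g :: "'a \<Rightarrow> 'c" and x v
  assume "g \<in> {\<lambda>x. L (f (c *\<^sub>R x + b)) | f. smooth f}"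
  then obtain f where f: "smooth f" and g: "g = (\<lambda>x. L (f (c *\<^sub>R x + b)))" by blast
  note d = has_derivative_affine_compose[OF f assms(2), of c b]
  show "g differentiable at x" using d differentiable_def g by blast
  have "(\<lambda>x. frechet_derivative g (at x) v) = (\<lambda>x. L (frechet_derivative f (at (c *\<^sub>R x + b)) (c *\<^sub>R v)))"
    unfolding g using frechet_derivativeI[OF d] by auto
  then show "(\<lambda>x. frechet_derivative g (at x) v) \<in> {\<lambda>x. L (f (c *\<^sub>R x + b)) | f. smooth f}"
    using smooth_frechet_derivative[OF f, of "c *\<^sub>R v"] by fast
qed (use assms in blast)

text \<open>By the Leibniz rule the derivative of a product is a sum of two products, so sums of products of smooth functions are the
smallest class suited to \<open>smooth_coinduct\<close>.\<close>

inductive_set product_sums :: "('a::real_normed_vector \<Rightarrow> 'b::real_normed_algebra) set" where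
  prod: "smooth f \<Longrightarrow> smooth g \<Longrightarrow> (\<lambda>x. f x * g x) \<in> product_sums"
| add: "f \<in> product_sums \<Longrightarrow> g \<in> product_sums \<Longrightarrow> (\<lambda>x. f x + g x) \<in> product_sums"

lemma product_sums_differentiable:
  "f \<in> product_sums \<Longrightarrow> f differentiable at x"
  by (induction rule: product_sums.induct)
    (use smooth_differentiable differentiable_mult differentiable_add in blast)+

lemma product_sums_derivative:
  "f \<in> product_sums \<Longrightarrow> (\<lambda>x. frechet_derivative f (at x) v) \<in> product_sums"
proof (induction rule: product_sums.induct)
  case (prod f g)
  have d: "((\<lambda>x. f x * g x) has_derivative
      (\<lambda>v. f x * frechet_derivative g (at x) v + frechet_derivative f (at x) v * g x)) (at x)" for x
    using has_derivative_mult[OF smooth_has_derivative[OF prod(1)] smooth_has_derivative[OF prod(2)]] .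
  have "(\<lambda>x. frechet_derivative (\<lambda>x. f x * g x) (at x) v) =
      (\<lambda>x. f x * frechet_derivative g (at x) v + frechet_derivative f (at x) v * g x)"
    using frechet_derivativeI[OF d] by auto
  then show ?case
    using prod by (auto intro!: product_sums.intros smooth_frechet_derivative)
next
  case (add f g)
  have d: "((\<lambda>x. f x + g x) has_derivative
      (\<lambda>v. frechet_derivative f (at x) v + frechet_derivative g (at x) v)) (at x)" for x
    using product_sums_differentiable[OF add(1)] product_sums_differentiable[OF add(2)]
    by (intro has_derivative_add) (auto simp: frechet_derivative_works)
  have "(\<lambda>x. frechet_derivative (\<lambda>x. f x + g x) (at x) v) =
      (\<lambda>x. frechet_derivative f (at x) v + frechet_derivative g (at x) v)"
    using frechet_derivativeI[OF d] by auto
  then show ?case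
    using add by (auto intro!: product_sums.intros)
qed

lemma smooth_mult:
  fixes f g :: "'a::real_normed_vector \<Rightarrow> 'b::real_normed_algebra"
  assumes "smooth f" "smooth g"
  shows "smooth (\<lambda>x. f x * g x)"
  by (rule smooth_coinduct[where S=product_sums])
    (use assms in \<open>auto intro: product_sums.prod product_sums_differentiable product_sums_derivative\<close>)

text \<open>Taylor's formula along the segment from \<open>y\<close> to \<open>y + z\<close>: the mean value inequality is applied twice. The factor
\<open>DIM('a)\<^sup>2\<close> counts the second partial derivatives.\<close>

lemma smooth_second_order_bound:
  fixes f :: "'a::euclidean_space \<Rightarrow> complex"
  assumes f: "smooth f"
    and B: "\<And>w i j. w \<in> {0..1} \<Longrightarrow> i \<in> Basis \<Longrightarrow> j \<in> Basis \<Longrightarrow> norm (dir_derivs [i, j] f (y + w *\<^sub>R z)) \<le> B"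
  shows "norm (f (y + z) - f y - frechet_derivative f (at y) z) \<le> real DIM('a) ^ 2 * B * (norm z)\<^sup>2"
proof -
  define g where "g = (\<lambda>x. frechet_derivative f (at x) z)"
  have g: "smooth g" unfolding g_def by (rule smooth_frechet_derivative[OF f])
  have B0: "B \<ge> 0"
    using B[of 0 "SOME i. i \<in> Basis" "SOME i. i \<in> Basis"] norm_ge_zero
    by (smt (verit) SOME_Basis atLeastAtMost_iff)
  have line: "((\<lambda>w. y + w *\<^sub>R z) has_derivative (\<lambda>h. h *\<^sub>R z)) (at w within A)" for w :: real and A
    by (auto intro!: derivative_eq_intros)
  \<comment> \<open>The second derivative along the segment, in terms of second partial derivatives.\<close>
  have gz: "norm (frechet_derivative g (at (y + w *\<^sub>R z)) z) \<le> real DIM('a) ^ 2 * B * (norm z)\<^sup>2" if w: "w \<in> {0..1}" for w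
  proof -
    let ?x = "y + w *\<^sub>R z"
    have geq: "g = (\<lambda>x. \<Sum>j\<in>Basis. (z \<bullet> j) *\<^sub>R dir_derivs [j] f x)"
      unfolding g_def using smooth_frechet_derivative_sum_Basis[OF f, of _ z] by (intro ext) simp
    have dj: "(dir_derivs [j] f has_derivative frechet_derivative (dir_derivs [j] f) (at ?x)) (at ?x)" for j
      by (rule smooth_has_derivative[OF smooth_dir_derivs[OF f]])
    have "(g has_derivative (\<lambda>v. \<Sum>j\<in>Basis. (z \<bullet> j) *\<^sub>R frechet_derivative (dir_derivs [j] f) (at ?x) v)) (at ?x)"
      unfolding geq by (rule has_derivative_sum has_derivative_scaleR_right dj)+
    then have "frechet_derivative g (at ?x) z = (\<Sum>j\<in>Basis. (z \<bullet> j) *\<^sub>R frechet_derivative (dir_derivs [j] f) (at ?x) z)"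
      by (rule frechet_derivativeI)
    also have "\<dots> = (\<Sum>j\<in>Basis. \<Sum>i\<in>Basis. ((z \<bullet> j) * (z \<bullet> i)) *\<^sub>R dir_derivs [i, j] f ?x)"
      by (subst smooth_frechet_derivative_sum_Basis[OF smooth_dir_derivs[OF f]])
        (simp add: scaleR_sum_right)
    also have "norm \<dots> \<le> (\<Sum>j\<in>(Basis::'a set). \<Sum>i\<in>(Basis::'a set). (norm z * norm z) * B)"
    proof (intro sum_norm_le)
      fix i j :: 'a assume ij: "i \<in> Basis" "j \<in> Basis"
      have "\<bar>z \<bullet> j\<bar> \<le> norm z" "\<bar>z \<bullet> i\<bar> \<le> norm z" using ij Basis_le_norm by blast+
      then show "norm (((z \<bullet> j) * (z \<bullet> i)) *\<^sub>R dir_derivs [i, j] f ?x) \<le> norm z * norm z * B"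
        using B[OF w ij] B0 unfolding norm_scaleR abs_mult
        by (intro mult_mono) auto
    qed
    also have "\<dots> = real DIM('a) ^ 2 * B * (norm z)\<^sup>2"
      by (simp add: power2_eq_square)
    finally show ?thesis .
  qed
  have g_line: "((\<lambda>w. g (y + w *\<^sub>R z)) has_derivative (\<lambda>h. h *\<^sub>R frechet_derivative g (at (y + w *\<^sub>R z)) z)) (at w within {0..1})" for w
  proof -
    have "linear (frechet_derivative g (at (y + w *\<^sub>R z)))"
      using smooth_has_derivative[OF g] has_derivative_linear by blast
    then have eq: "(\<lambda>h. frechet_derivative g (at (y + w *\<^sub>R z)) (h *\<^sub>R z)) = (\<lambda>h. h *\<^sub>R frechet_derivative g (at (y + w *\<^sub>R z)) z)"
      by (auto simp: linear_scale)
    show ?thesis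
      using has_derivative_compose[OF line[of w] smooth_has_derivative[OF g]] unfolding eq .
  qed
  have g_diff: "norm (g (y + w *\<^sub>R z) - g y) \<le> real DIM('a) ^ 2 * B * (norm z)\<^sup>2" if w: "w \<in> {0..1}" for w
  proof -
    have "norm (g (y + w *\<^sub>R z) - g (y + 0 *\<^sub>R z)) \<le> (real DIM('a) ^ 2 * B * (norm z)\<^sup>2) * norm (w - 0)"
    proof (rule differentiable_bound[where S="{0..1}", OF _ g_line])
      show "onorm (\<lambda>h. h *\<^sub>R frechet_derivative g (at (y + x *\<^sub>R z)) z) \<le> real DIM('a) ^ 2 * B * (norm z)\<^sup>2"
        if "x \<in> {0..1}" for x
        by (intro onorm_le) (use gz[OF that] in \<open>auto simp: mult.commute intro!: mult_left_mono\<close>)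
    qed (use w in auto)
    also have "\<dots> \<le> (real DIM('a) ^ 2 * B * (norm z)\<^sup>2) * 1"
      using w B0 by (intro mult_left_mono) auto
    finally show ?thesis by simp
  qed
  \<comment> \<open>The derivative of \<open>q\<close> is the increment of \<open>g\<close>, which has just been bounded.\<close>
  define q where "q = (\<lambda>w. f (y + w *\<^sub>R z) - w *\<^sub>R g y)"
  have q_line: "(q has_derivative (\<lambda>h. h *\<^sub>R (g (y + w *\<^sub>R z) - g y))) (at w within {0..1})" for w
  proof -
    have "linear (frechet_derivative f (at (y + w *\<^sub>R z)))"
      using smooth_has_derivative[OF f] has_derivative_linear by blast
    then have eq: "(\<lambda>h. frechet_derivative f (at (y + w *\<^sub>R z)) (h *\<^sub>R z)) = (\<lambda>h. h *\<^sub>R g (y + w *\<^sub>R z))"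
      by (auto simp: linear_scale g_def)
    have 1: "((\<lambda>w. f (y + w *\<^sub>R z)) has_derivative (\<lambda>h. h *\<^sub>R g (y + w *\<^sub>R z))) (at w within {0..1})"
      using has_derivative_compose[OF line[of w] smooth_has_derivative[OF f]] unfolding eq .
    show ?thesis unfolding q_def
      by (rule has_derivative_eq_rhs, rule has_derivative_diff[OF 1])
        (auto intro!: derivative_eq_intros simp: scaleR_diff_right)
  qed
  have "norm (q 1 - q 0) \<le> (real DIM('a) ^ 2 * B * (norm z)\<^sup>2) * norm (1 - 0 :: real)"
  proof (rule differentiable_bound[where S="{0..1}", OF _ q_line])
    show "onorm (\<lambda>h. h *\<^sub>R (g (y + x *\<^sub>R z) - g y)) \<le> real DIM('a) ^ 2 * B * (norm z)\<^sup>2"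
      if "x \<in> {0..1}" for x
      by (intro onorm_le) (use g_diff[OF that] in \<open>auto simp: mult.commute intro!: mult_left_mono\<close>)
  qed auto
  then show ?thesis by (simp add: q_def g_def algebra_simps)
qed

section \<open>Integration over Euclidean space and the heat kernel\<close>

text \<open>Tonelli's criterion for integrability on a product, in the form in which every application of Fubini's theorem below needs it.\<close>

lemma (in pair_sigma_finite) integrable_pairI_nn:
  fixes f :: "'a \<Rightarrow> 'b \<Rightarrow> 'c::{banach, second_countable_topology}"
  assumes "case_prod f \<in> borel_measurable (M1 \<Otimes>\<^sub>M M2)"
    and "(\<integral>\<^sup>+x. (\<integral>\<^sup>+y. norm (f x y) \<partial>M2) \<partial>M1) < \<infinity>"
  shows "integrable (M1 \<Otimes>\<^sub>M M2) (case_prod f)"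
proof -
  have "(\<integral>\<^sup>+p. norm (case_prod f p) \<partial>(M1 \<Otimes>\<^sub>M M2)) = (\<integral>\<^sup>+x. (\<integral>\<^sup>+y. norm (f x y) \<partial>M2) \<partial>M1)"
    using assms(1) by (subst M2.nn_integral_fst[symmetric]) auto
  then show ?thesis using assms by (simp add: integrable_iff_bounded)
qed

text \<open>If the function is not integrable, then the left-hand side is zero by convention.\<close>

lemma norm_integral_le_nn_integral:
  fixes f :: "'a \<Rightarrow> 'b::{banach, second_countable_topology}"
  shows "ennreal (norm (\<integral>x. f x \<partial>M)) \<le> (\<integral>\<^sup>+x. ennreal (norm (f x)) \<partial>M)"
  by (cases "integrable M f") (auto intro: integral_norm_bound_ennreal simp: not_integrable_integral_eq)

lemma cis_measurable [measurable]: "cis \<in> borel_measurable borel"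
  by (intro borel_measurable_continuous_onI continuous_on_cis continuous_on_id)

lemma nn_integral_lborel_affine:
  fixes f :: "'a::euclidean_space \<Rightarrow> ennreal" and t :: 'a
  assumes [measurable]: "f \<in> borel_measurable borel" and c: "c \<noteq> 0"
  shows "(\<integral>\<^sup>+x. f x \<partial>lborel) = ennreal (\<bar>c\<bar> ^ DIM('a)) * (\<integral>\<^sup>+x. f (t + c *\<^sub>R x) \<partial>lborel)"
  by (subst lborel_affine[OF c, of t]) (simp add: nn_integral_density nn_integral_distr nn_integral_cmult)

lemma lborel_integrable_affine:
  fixes f :: "'a::euclidean_space \<Rightarrow> 'b::{banach, second_countable_topology}" and t :: 'a
  assumes f: "integrable lborel f" and c: "c \<noteq> 0"
  shows "integrable lborel (\<lambda>x. f (t + c *\<^sub>R x))"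
proof -
  have [measurable]: "f \<in> borel_measurable borel"
    using borel_measurable_integrable[OF f] by simp
  have "(\<integral>\<^sup>+x. norm (f x) \<partial>lborel) = ennreal (\<bar>c\<bar> ^ DIM('a)) * (\<integral>\<^sup>+x. norm (f (t + c *\<^sub>R x)) \<partial>lborel)"
    by (rule nn_integral_lborel_affine) (use c in auto)
  then show ?thesis
    using f c unfolding integrable_iff_bounded by (auto simp: ennreal_mult_less_top)
qed

lemma lborel_integral_affine:
  fixes f :: "'a::euclidean_space \<Rightarrow> 'b::{banach, second_countable_topology}" and t :: 'a
  assumes c: "c \<noteq> 0"
  shows "(\<integral>x. f x \<partial>lborel) = \<bar>c\<bar> ^ DIM('a) *\<^sub>R (\<integral>x. f (t + c *\<^sub>R x) \<partial>lborel)"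
proof (cases "integrable lborel f")
  case True
  then have [measurable]: "f \<in> borel_measurable borel"
    using borel_measurable_integrable by fastforce
  show ?thesis
    by (subst lborel_affine[OF c, of t]) (simp add: integral_density integral_distr)
next
  case False
  have "\<not> integrable lborel (\<lambda>x. f (t + c *\<^sub>R x))"
  proof
    assume "integrable lborel (\<lambda>x. f (t + c *\<^sub>R x))"
    from lborel_integrable_affine[OF this, of "1/c" "- (1/c) *\<^sub>R t"]
    show False using False c by (simp add: algebra_simps)
  qed
  then show ?thesis using False by (simp add: not_integrable_integral_eq)
qed

lemma
  fixes f :: "'a::euclidean_space \<Rightarrow> 'b::{banach, second_countable_topology}"
  shows lborel_integral_shift: "(\<integral>x. f (x + y) \<partial>lborel) = (\<integral>x. f x \<partial>lborel)"
    and lborel_integral_minus_shift: "(\<integral>x. f (x - y) \<partial>lborel) = (\<integral>x. f x \<partial>lborel)"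
    and lborel_integral_reflect: "(\<integral>x. f (y - x) \<partial>lborel) = (\<integral>x. f x \<partial>lborel)"
  using lborel_integral_affine[of 1 f y] lborel_integral_affine[of 1 f "-y"]
    lborel_integral_affine[of "-1" f y]
  by (simp_all add: add.commute)

lemma
  fixes f :: "'a::euclidean_space \<Rightarrow> 'b::{banach, second_countable_topology}"
  assumes "integrable lborel f"
  shows lborel_integrable_shift: "integrable lborel (\<lambda>x. f (x + y))"
    and lborel_integrable_minus_shift: "integrable lborel (\<lambda>x. f (x - y))"
    and lborel_integrable_reflect: "integrable lborel (\<lambda>x. f (y - x))"
  using lborel_integrable_affine[OF assms, of 1 y] lborel_integrable_affine[OF assms, of 1 "-y"]
    lborel_integrable_affine[OF assms, of "-1" y]
  by (simp_all add: add.commute)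

lemma
  fixes f :: "'a::euclidean_space \<Rightarrow> ennreal"
  assumes "f \<in> borel_measurable borel"
  shows nn_integral_lborel_shift: "(\<integral>\<^sup>+x. f (x + y) \<partial>lborel) = (\<integral>\<^sup>+x. f x \<partial>lborel)"
    and nn_integral_lborel_minus_shift: "(\<integral>\<^sup>+x. f (x - y) \<partial>lborel) = (\<integral>\<^sup>+x. f x \<partial>lborel)"
  using nn_integral_lborel_affine[OF assms, of 1 y] nn_integral_lborel_affine[OF assms, of 1 "-y"]
  by (simp_all add: add.commute)

lemma
  fixes f :: "'a::euclidean_space \<Rightarrow> real \<Rightarrow> 'b::{real_normed_field, banach, second_countable_topology}"
  assumes f: "\<And>b. b \<in> Basis \<Longrightarrow> integrable lborel (f b)"
  shows lborel_integrable_prod: "integrable lborel (\<lambda>x. \<Prod>b\<in>Basis. f b (x \<bullet> b))"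
    and lborel_integral_prod: "(\<integral>x. (\<Prod>b\<in>Basis. f b (x \<bullet> b)) \<partial>lborel) = (\<Prod>b\<in>Basis. \<integral>x. f b x \<partial>lborel)"
proof -
  interpret P: product_sigma_finite "\<lambda>_::'a. lborel :: real measure" by standard
  have [measurable]: "f b \<in> borel_measurable borel" if "b \<in> Basis" for b
    using borel_measurable_integrable[OF f[OF that]] by simp
  have m: "(\<lambda>x. \<Prod>b\<in>Basis. f b (x \<bullet> b)) \<in> borel_measurable borel"
    by measurable
  have m': "(\<lambda>f. \<Sum>b\<in>Basis. f b *\<^sub>R b) \<in> Pi\<^sub>M Basis (\<lambda>b::'a. lborel) \<rightarrow>\<^sub>M (borel :: 'a measure)"
    by measurable
  have eq: "(\<Prod>b\<in>Basis. f b ((\<Sum>c\<in>Basis. x c *\<^sub>R c) \<bullet> b)) = (\<Prod>b\<in>Basis. f b (x b))" for x :: "'a \<Rightarrow> real"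
    by (intro prod.cong) auto
  show "integrable lborel (\<lambda>x. \<Prod>b\<in>Basis. f b (x \<bullet> b))"
    by (subst lborel_eq, subst integrable_distr_eq[OF m' m], unfold eq)
      (intro P.product_integrable_prod f; simp)
  show "(\<integral>x. (\<Prod>b\<in>Basis. f b (x \<bullet> b)) \<partial>lborel) = (\<Prod>b\<in>Basis. \<integral>x. f b x \<partial>lborel)"
    by (subst lborel_eq, subst integral_distr[OF m' m], unfold eq)
      (intro P.product_integral_prod f; simp)
qed

text \<open>The exponent \<open>2 DIM('a)\<close> allows a comparison with the product of the one-dimensional functions \<open>1 / (1 + x\<^sup>2)\<close>; this
makes \<open>decay\<close> a convenient integrable majorant of Schwartz functions.\<close>

definition decay :: "'a::euclidean_space \<Rightarrow> real" where
  "decay x = 1 / (1 + norm x) ^ (2 * DIM('a))"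

lemma decay_pos: "0 < decay x"
  by (simp add: decay_def add_pos_nonneg)

lemma decay_measurable [measurable]: "decay \<in> borel_measurable borel"
  unfolding decay_def[abs_def] by measurable

lemma decay_integrable: "integrable lborel (decay :: 'a::euclidean_space \<Rightarrow> real)"
proof -
  have "integrable lborel (\<lambda>x::real. inverse (1 + x\<^sup>2))"
    using integrable_inverse_1_plus_square by (simp add: set_integrable_def)
  then have *: "integrable lborel (\<lambda>x::'a. \<Prod>b\<in>Basis. inverse (1 + (x \<bullet> b)\<^sup>2))"
    by (intro lborel_integrable_prod[where f="\<lambda>b x. inverse (1 + x\<^sup>2)"])
  show ?thesis
  proof (rule Bochner_Integration.integrable_bound[OF *])
    show "AE x in lborel. norm (decay x) \<le> norm (\<Prod>b\<in>Basis. inverse (1 + ((x::'a) \<bullet> b)\<^sup>2))"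
    proof (rule AE_I2)
      fix x :: 'a
      have "(\<Prod>b\<in>(Basis::'a set). inverse ((1 + norm x)\<^sup>2)) \<le> (\<Prod>b\<in>Basis. inverse (1 + (x \<bullet> b)\<^sup>2))"
      proof (intro prod_mono conjI le_imp_inverse_le)
        fix b :: 'a assume "b \<in> Basis"
        then have "(x \<bullet> b)\<^sup>2 \<le> (norm x)\<^sup>2"
          using power_mono[OF Basis_le_norm[of b x], of 2] by simp
        then show "1 + (x \<bullet> b)\<^sup>2 \<le> (1 + norm x)\<^sup>2" by (simp add: power2_sum add_increasing2)
      qed (auto simp: add_pos_nonneg)
      then have "decay x \<le> (\<Prod>b\<in>Basis. inverse (1 + (x \<bullet> b)\<^sup>2))"
        by (simp add: decay_def inverse_eq_divide power_mult power_one_over)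
      then show "norm (decay x) \<le> norm (\<Prod>b\<in>Basis. inverse (1 + (x \<bullet> b)\<^sup>2))"
        using decay_pos[of x] by (simp add: less_imp_le)
    qed
  qed (simp add: decay_measurable)
qed

section \<open>The heat kernel\<close>

definition heat_kernel :: "real \<Rightarrow> 'a::euclidean_space \<Rightarrow> real" where
  "heat_kernel t z = (4 * pi * t) powr (- (real DIM('a) / 2)) * exp (- ((norm z)\<^sup>2 / (4 * t)))"

lemma heat_kernel_nonneg: "0 \<le> heat_kernel t z"
  by (simp add: heat_kernel_def)

lemma heat_kernel_measurable [measurable]:
  "(\<lambda>(t, z). heat_kernel t z) \<in> borel_measurable (borel \<Otimes>\<^sub>M borel)"
  "heat_kernel t \<in> borel_measurable borel"
  unfolding heat_kernel_def[abs_def] by measurable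

lemma
  shows integrable_cis_gaussian_1D: "integrable lborel (\<lambda>x. cis (x * s) * complex_of_real (exp (- (x\<^sup>2 / 2))))"
    and integral_cis_gaussian_1D: "(\<integral>x. cis (x * s) * complex_of_real (exp (- (x\<^sup>2 / 2))) \<partial>lborel) = complex_of_real (sqrt (2 * pi) * exp (- (s\<^sup>2 / 2)))"
proof -
  have eq: "cis (x * s) * complex_of_real (exp (- (x\<^sup>2 / 2))) = sqrt (2 * pi) *\<^sub>R (std_normal_density x *\<^sub>R iexp (s * x))" for x
    by (simp add: std_normal_density_def cis_conv_exp scaleR_conv_of_real mult_ac)
  have "integrable lborel (\<lambda>x. std_normal_density x *\<^sub>R iexp (s * x))"
    by (rule Bochner_Integration.integrable_bound[OF integrable_normal_density[of 1 0]])
      (auto simp: normal_density_nonneg)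
  then show "integrable lborel (\<lambda>x. cis (x * s) * complex_of_real (exp (- (x\<^sup>2 / 2))))"
    unfolding eq by (rule integrable_scaleR_right)
  have "(\<integral>x. std_normal_density x *\<^sub>R iexp (s * x) \<partial>lborel) = char std_normal_distribution s"
    unfolding char_def by (subst integral_density) (auto simp: normal_density_nonneg)
  then show "(\<integral>x. cis (x * s) * complex_of_real (exp (- (x\<^sup>2 / 2))) \<partial>lborel) = complex_of_real (sqrt (2 * pi) * exp (- (s\<^sup>2 / 2)))"
    unfolding eq by (simp add: char_std_normal_distribution scaleR_conv_of_real)
qed

lemma norm_squared_sum_Basis: "(norm (x::'a::euclidean_space))\<^sup>2 = (\<Sum>b\<in>Basis. (x \<bullet> b)\<^sup>2)"
  by (subst power2_norm_eq_inner, subst euclidean_inner) (simp add: power2_eq_square)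

lemma cis_sum: "finite A \<Longrightarrow> cis (\<Sum>a\<in>A. f a) = (\<Prod>a\<in>A. cis (f a))"
  by (induction rule: finite_induct) (auto simp: cis_mult[symmetric])

text \<open>The Gaussian factorises over the coordinates, which reduces its Fourier transform to the characteristic function of the
standard normal distribution.\<close>

lemma
  fixes \<xi> :: "'a::euclidean_space"
  shows integrable_cis_gaussian: "integrable lborel (\<lambda>x. cis (x \<bullet> \<xi>) * complex_of_real (exp (- ((norm x)\<^sup>2 / 2))))"
    and integral_cis_gaussian: "(\<integral>x. cis (x \<bullet> \<xi>) * complex_of_real (exp (- ((norm x)\<^sup>2 / 2))) \<partial>lborel)
      = complex_of_real ((2 * pi) powr (real DIM('a) / 2) * exp (- ((norm \<xi>)\<^sup>2 / 2)))"
proof -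
  have eq: "cis (x \<bullet> \<xi>) * complex_of_real (exp (- ((norm x)\<^sup>2 / 2))) =
    (\<Prod>b\<in>Basis. cis ((x \<bullet> b) * (\<xi> \<bullet> b)) * complex_of_real (exp (- ((x \<bullet> b)\<^sup>2 / 2))))" for x
  proof -
    have "exp (- ((norm x)\<^sup>2 / 2)) = (\<Prod>b\<in>Basis. exp (- ((x \<bullet> b)\<^sup>2 / 2)))"
      unfolding norm_squared_sum_Basis exp_sum[OF finite_Basis, symmetric]
      by (simp add: sum_divide_distrib sum_negf)
    moreover have "cis (x \<bullet> \<xi>) = (\<Prod>b\<in>Basis. cis ((x \<bullet> b) * (\<xi> \<bullet> b)))"
      by (subst euclidean_inner) (rule cis_sum[OF finite_Basis])
    ultimately show ?thesis by (simp add: prod.distrib)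
  qed
  have p: "sqrt (2 * pi) ^ n = (2 * pi) powr (real n / 2)" for n
    by (simp add: powr_half_sqrt[symmetric] powr_realpow[symmetric] powr_powr mult.commute)
  show "integrable lborel (\<lambda>x. cis (x \<bullet> \<xi>) * complex_of_real (exp (- ((norm x)\<^sup>2 / 2))))"
    unfolding eq by (intro lborel_integrable_prod[where f="\<lambda>b y. cis (y * (\<xi> \<bullet> b)) * complex_of_real (exp (- (y\<^sup>2 / 2)))"] integrable_cis_gaussian_1D)
  show "(\<integral>x. cis (x \<bullet> \<xi>) * complex_of_real (exp (- ((norm x)\<^sup>2 / 2))) \<partial>lborel)
      = complex_of_real ((2 * pi) powr (real DIM('a) / 2) * exp (- ((norm \<xi>)\<^sup>2 / 2)))"
  proof -
    have "(\<integral>x. cis (x \<bullet> \<xi>) * complex_of_real (exp (- ((norm x)\<^sup>2 / 2))) \<partial>lborel) =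
      (\<Prod>b\<in>(Basis::'a set). complex_of_real (sqrt (2 * pi) * exp (- ((\<xi> \<bullet> b)\<^sup>2 / 2))))"
      unfolding eq integral_cis_gaussian_1D[symmetric]
      by (rule lborel_integral_prod[where f="\<lambda>b y. cis (y * (\<xi> \<bullet> b)) * complex_of_real (exp (- (y\<^sup>2 / 2)))"])
        (rule integrable_cis_gaussian_1D)
    also have "\<dots> = complex_of_real (\<Prod>b\<in>(Basis::'a set). sqrt (2 * pi) * exp (- ((\<xi> \<bullet> b)\<^sup>2 / 2)))"
      by (simp only: of_real_prod)
    also have "(\<Prod>b\<in>(Basis::'a set). sqrt (2 * pi) * exp (- ((\<xi> \<bullet> b)\<^sup>2 / 2))) =
      (2 * pi) powr (real DIM('a) / 2) * exp (- ((norm \<xi>)\<^sup>2 / 2))"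
      unfolding prod.distrib prod_constant p norm_squared_sum_Basis exp_sum[OF finite_Basis, symmetric]
      by (simp add: sum_divide_distrib sum_negf)
    finally show ?thesis .
  qed
qed

lemma
  fixes \<xi> :: "'a::euclidean_space"
  assumes t: "0 < t"
  shows integrable_cis_heat_kernel: "integrable lborel (\<lambda>x. cis (x \<bullet> \<xi>) * complex_of_real (heat_kernel t x))"
    and integral_cis_heat_kernel: "(\<integral>x. cis (x \<bullet> \<xi>) * complex_of_real (heat_kernel t x) \<partial>lborel)
      = complex_of_real (exp (- (t * (norm \<xi>)\<^sup>2)))"
proof -
  define c where "c = 1 / sqrt (2 * t)"
  define k where "k = (4 * pi * t) powr (- (real DIM('a) / 2))"
  define h :: "'a \<Rightarrow> complex" where
    "h = (\<lambda>x. cis (x \<bullet> (sqrt (2 * t) *\<^sub>R \<xi>)) * complex_of_real (exp (- ((norm x)\<^sup>2 / 2))))"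
  have c: "c \<noteq> 0" "c > 0" using t by (auto simp: c_def)
  have "c\<^sup>2 = 1 / (2 * t)" using t by (simp add: c_def power_divide)
  then have "(norm (c *\<^sub>R x))\<^sup>2 / 2 = (norm x)\<^sup>2 / (4 * t)" for x :: 'a
    by (simp add: power_mult_distrib)
  moreover have "(c *\<^sub>R x) \<bullet> (sqrt (2 * t) *\<^sub>R \<xi>) = x \<bullet> \<xi>" for x
    using t by (simp add: c_def)
  ultimately have *: "cis (x \<bullet> \<xi>) * complex_of_real (heat_kernel t x) = complex_of_real k * h (0 + c *\<^sub>R x)" for x
    unfolding heat_kernel_def h_def k_def by (simp only: add_0 of_real_mult mult_ac)
  show "integrable lborel (\<lambda>x. cis (x \<bullet> \<xi>) * complex_of_real (heat_kernel t x))"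
    unfolding * using lborel_integrable_affine[of h c 0] integrable_cis_gaussian[of "sqrt (2 * t) *\<^sub>R \<xi>"] c
    by (intro integrable_mult_right) (simp add: h_def)
  have k: "k * (2 * pi) powr (real DIM('a) / 2) = c ^ DIM('a)"
  proof -
    let ?a = "real DIM('a) / 2"
    have "c ^ DIM('a) = (2 * t) powr (- ?a)"
      using t c by (simp add: powr_realpow[symmetric] c_def powr_half_sqrt[symmetric] powr_powr powr_minus_divide powr_divide mult.commute)
    moreover have "k = (2 * pi) powr (- ?a) * (2 * t) powr (- ?a)"
      using t by (simp add: k_def powr_mult[symmetric] mult_ac)
    moreover have "(2 * pi) powr (- ?a) * (2 * pi) powr ?a = 1"
      by (simp add: powr_add[symmetric])
    moreover have "p * q * r = q" if "p * r = 1" for p q r :: real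
      using that by algebra
    ultimately show ?thesis by (simp only:)
  qed
  have "(\<integral>x. h x \<partial>lborel) = c ^ DIM('a) *\<^sub>R (\<integral>x. h (0 + c *\<^sub>R x) \<partial>lborel)"
    using lborel_integral_affine[OF c(1), of h 0] c by simp
  moreover have "(\<integral>x. h x \<partial>lborel) = complex_of_real ((2 * pi) powr (real DIM('a) / 2) * exp (- (t * (norm \<xi>)\<^sup>2)))"
    unfolding h_def integral_cis_gaussian using t by (simp add: power_mult_distrib)
  ultimately have "complex_of_real (c ^ DIM('a)) * (\<integral>x. h (0 + c *\<^sub>R x) \<partial>lborel) = complex_of_real ((2 * pi) powr (real DIM('a) / 2) * exp (- (t * (norm \<xi>)\<^sup>2)))"
    by (simp add: scaleR_conv_of_real)
  then have "complex_of_real (c ^ DIM('a)) * (complex_of_real k * (\<integral>x. h (0 + c *\<^sub>R x) \<partial>lborel)) =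
      complex_of_real (k * (2 * pi) powr (real DIM('a) / 2)) * complex_of_real (exp (- (t * (norm \<xi>)\<^sup>2)))"
    by (simp only: of_real_mult mult.left_commute mult.assoc)
  then have "complex_of_real (c ^ DIM('a)) * (complex_of_real k * (\<integral>x. h (0 + c *\<^sub>R x) \<partial>lborel)) =
      complex_of_real (c ^ DIM('a)) * complex_of_real (exp (- (t * (norm \<xi>)\<^sup>2)))"
    unfolding k .
  then show "(\<integral>x. cis (x \<bullet> \<xi>) * complex_of_real (heat_kernel t x) \<partial>lborel)
      = complex_of_real (exp (- (t * (norm \<xi>)\<^sup>2)))"
    unfolding * using c by simp
qed

lemma
  assumes "0 < t"
  shows heat_kernel_integrable: "integrable lborel (heat_kernel t :: 'a::euclidean_space \<Rightarrow> real)"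
    and heat_kernel_integral: "(\<integral>x. heat_kernel t (x::'a) \<partial>lborel) = 1"
  using integrable_cis_heat_kernel[OF assms, of "0::'a"] integral_cis_heat_kernel[OF assms, of "0::'a"]
  by (auto simp: complex_of_real_integrable_eq)

lemma heat_kernel_nn_integral:
  assumes "0 < t"
  shows "(\<integral>\<^sup>+x. ennreal (heat_kernel t (x::'a::euclidean_space)) \<partial>lborel) = 1"
  using heat_kernel_integral[OF assms, where 'a='a]
  by (subst nn_integral_eq_integral[OF heat_kernel_integrable[OF assms]]) (simp_all add: heat_kernel_nonneg)

section \<open>Schwartz functions and the Fourier transform\<close>

text \<open>Smoothness is left out: rapid decay alone makes the Fourier transform smooth, and this class is closed under multiplication
by coordinates, which is what differentiation does on the other side.\<close>

definition rapidly_decaying :: "('a::euclidean_space \<Rightarrow> complex) \<Rightarrow> bool" where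
  "rapidly_decaying \<psi> \<longleftrightarrow> \<psi> \<in> borel_measurable borel \<and>
     (\<forall>k. integrable lborel (\<lambda>x. (1 + norm x) ^ k * norm (\<psi> x)))"

definition test_fun :: "('a::euclidean_space \<Rightarrow> complex) \<Rightarrow> bool" where
  "test_fun \<psi> \<longleftrightarrow> smooth \<psi> \<and> (\<exists>R. \<forall>x. R < norm x \<longrightarrow> \<psi> x = 0)"

lemma rapidly_decaying_mult:
  assumes \<psi>: "rapidly_decaying \<psi>" and [measurable]: "g \<in> borel_measurable borel"
    and g: "\<And>x. norm (g x) \<le> C * (1 + norm x) ^ m"
  shows "rapidly_decaying (\<lambda>x. g x * \<psi> x)"
  unfolding rapidly_decaying_def
proof (intro conjI allI)
  have [measurable]: "\<psi> \<in> borel_measurable borel" using \<psi> by (simp add: rapidly_decaying_def)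
  show "(\<lambda>x. g x * \<psi> x) \<in> borel_measurable borel" by measurable
  fix k
  have "integrable lborel (\<lambda>x. C * ((1 + norm x) ^ (k + m) * norm (\<psi> x)))"
    using \<psi> unfolding rapidly_decaying_def by (intro integrable_mult_right) blast
  then show "integrable lborel (\<lambda>x. (1 + norm x) ^ k * norm (g x * \<psi> x))"
  proof (rule Bochner_Integration.integrable_bound)
    show "AE x in lborel. norm ((1 + norm x) ^ k * norm (g x * \<psi> x)) \<le> norm (C * ((1 + norm x) ^ (k + m) * norm (\<psi> x)))"
    proof (rule AE_I2)
      fix x
      have "(1 + norm x) ^ k * norm (g x * \<psi> x) \<le> (1 + norm x) ^ k * ((C * (1 + norm x) ^ m) * norm (\<psi> x))"
        unfolding norm_mult by (intro mult_left_mono mult_right_mono g) auto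
      then show "norm ((1 + norm x) ^ k * norm (g x * \<psi> x)) \<le> norm (C * ((1 + norm x) ^ (k + m) * norm (\<psi> x)))"
        by (simp add: power_add mult_ac)
    qed
  qed simp
qed

lemma rapidly_decaying_measurable: "rapidly_decaying \<psi> \<Longrightarrow> \<psi> \<in> borel_measurable borel"
  by (simp add: rapidly_decaying_def)

lemma rapidly_decaying_integrable:
  assumes "rapidly_decaying \<psi>" shows "integrable lborel \<psi>"
proof -
  have "integrable lborel (\<lambda>x. (1 + norm x) ^ 0 * norm (\<psi> x))"
    using assms unfolding rapidly_decaying_def by blast
  then have *: "integrable lborel (\<lambda>x. norm (\<psi> x))" by simp
  have "\<psi> \<in> borel_measurable lborel" using assms by (simp add: rapidly_decaying_def)
  from integrable_norm_iff[OF this] * show ?thesis by blast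
qed

lemma integrable_cis_mult:
  fixes \<psi> :: "'a::euclidean_space \<Rightarrow> complex"
  assumes "integrable lborel \<psi>" and [measurable]: "s \<in> borel_measurable borel"
  shows "integrable lborel (\<lambda>x. cis (s x) * \<psi> x)"
proof -
  have [measurable]: "\<psi> \<in> borel_measurable borel" using borel_measurable_integrable[OF assms(1)] by simp
  show ?thesis
    by (rule Bochner_Integration.integrable_bound[OF assms(1)]) (auto simp: norm_mult cis_conv_exp)
qed

lemma norm_cis_minus_linear: "norm (cis t - 1 - \<i> * complex_of_real t) \<le> t\<^sup>2 / 2"
  using iexp_approx1[of t 1] by (simp add: cis_conv_exp power2_eq_square mult_ac diff_diff_eq)

lemma rapidly_decaying_mult_linear:
  assumes "rapidly_decaying \<psi>"
  shows "rapidly_decaying (\<lambda>x. - (\<i> * complex_of_real (x \<bullet> v)) * \<psi> x)"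
proof (rule rapidly_decaying_mult[OF assms, where C="norm v" and m=1])
  fix x
  have "\<bar>x \<bullet> v\<bar> \<le> norm x * norm v" by (rule Cauchy_Schwarz_ineq2)
  also have "\<dots> \<le> norm v * (1 + norm x) ^ 1" by (simp add: algebra_simps)
  finally show "norm (- (\<i> * complex_of_real (x \<bullet> v))) \<le> norm v * (1 + norm x) ^ 1"
    by (simp add: norm_mult)
qed measurable

text \<open>The quadratic error \<open>|exp(i t) - 1 - i t| \<le> t\<^sup>2 / 2\<close> under the integral gives differentiability directly, at the
price of a second moment.\<close>

lemma fourier_has_derivative:
  fixes \<psi> :: "'a::euclidean_space \<Rightarrow> complex"
  assumes \<psi>: "rapidly_decaying \<psi>"
  shows "(fourier \<psi> has_derivative (\<lambda>v. fourier (\<lambda>x. - (\<i> * complex_of_real (x \<bullet> v)) * \<psi> x) \<xi>)) (at \<xi>)"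
    (is "(_ has_derivative ?D) _")
proof -
  have int: "integrable lborel (\<lambda>x. cis (- (x \<bullet> \<xi>)) * \<psi> x)" if "rapidly_decaying \<psi>" for \<psi> and \<xi> :: 'a
    by (intro integrable_cis_mult rapidly_decaying_integrable that) measurable
  note int' = int[OF rapidly_decaying_mult_linear[OF \<psi>]]
  define K where "K = (\<integral>x. (1 + norm x) ^ 2 * norm (\<psi> x) \<partial>lborel)"
  have iK: "integrable lborel (\<lambda>x. (1 + norm x) ^ 2 * norm (\<psi> x))"
    using \<psi> unfolding rapidly_decaying_def by blast
  have lin: "linear ?D"
  proof
    fix v w :: 'a and r :: real
    show "?D (v + w) = ?D v + ?D w"
    proof -
      have "cis (- (x \<bullet> \<xi>)) * (- (\<i> * complex_of_real (x \<bullet> (v + w))) * \<psi> x) =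
        cis (- (x \<bullet> \<xi>)) * (- (\<i> * complex_of_real (x \<bullet> v)) * \<psi> x) +
        cis (- (x \<bullet> \<xi>)) * (- (\<i> * complex_of_real (x \<bullet> w)) * \<psi> x)" for x
        by (simp add: inner_add_right ring_distribs)
      then show ?thesis
        unfolding fourier_def by (simp only: Bochner_Integration.integral_add[OF int' int'])
    qed
    have "?D (r *\<^sub>R v) = (\<integral>x. r *\<^sub>R (cis (- (x \<bullet> \<xi>)) * (- (\<i> * complex_of_real (x \<bullet> v)) * \<psi> x)) \<partial>lborel)"
      unfolding fourier_def by (simp add: scaleR_conv_of_real mult_ac)
    then show "?D (r *\<^sub>R v) = r *\<^sub>R ?D v"
      unfolding fourier_def by simp
  qed
  have bound: "norm (fourier \<psi> (\<xi> + h) - fourier \<psi> \<xi> - ?D h) \<le> K * (norm h)\<^sup>2" for h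
  proof -
    have eq: "cis (- (x \<bullet> (\<xi> + h))) * \<psi> x - cis (- (x \<bullet> \<xi>)) * \<psi> x - cis (- (x \<bullet> \<xi>)) * (- (\<i> * complex_of_real (x \<bullet> h)) * \<psi> x)
        = cis (- (x \<bullet> \<xi>)) * (cis (- (x \<bullet> h)) - 1 - \<i> * complex_of_real (- (x \<bullet> h))) * \<psi> x" for x
    proof -
      have "cis (- (x \<bullet> (\<xi> + h))) = cis (- (x \<bullet> \<xi>)) * cis (- (x \<bullet> h))"
        by (simp add: cis_mult inner_add_right)
      then show ?thesis by (simp add: algebra_simps)
    qed
    have i1: "integrable lborel (\<lambda>x. cis (- (x \<bullet> (\<xi> + h))) * \<psi> x)"
      and i2: "integrable lborel (\<lambda>x. cis (- (x \<bullet> \<xi>)) * \<psi> x)"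
      and i3: "integrable lborel (\<lambda>x. cis (- (x \<bullet> \<xi>)) * (- (\<i> * complex_of_real (x \<bullet> h)) * \<psi> x))"
      by (rule int[OF \<psi>] int')+
    have "fourier \<psi> (\<xi> + h) - fourier \<psi> \<xi> - ?D h =
      (\<integral>x. cis (- (x \<bullet> (\<xi> + h))) * \<psi> x - cis (- (x \<bullet> \<xi>)) * \<psi> x - cis (- (x \<bullet> \<xi>)) * (- (\<i> * complex_of_real (x \<bullet> h)) * \<psi> x) \<partial>lborel)"
      unfolding fourier_def Bochner_Integration.integral_diff[OF Bochner_Integration.integrable_diff[OF i1 i2] i3]
        Bochner_Integration.integral_diff[OF i1 i2] ..
    also have "norm \<dots> \<le> (\<integral>x. (norm h)\<^sup>2 * ((1 + norm x) ^ 2 * norm (\<psi> x)) \<partial>lborel)"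
    proof (rule Bochner_Integration.integral_norm_bound_integral)
      fix x
      have "norm (cis (- (x \<bullet> h)) - 1 - \<i> * complex_of_real (- (x \<bullet> h))) \<le> (x \<bullet> h)\<^sup>2 / 2"
        using norm_cis_minus_linear[of "- (x \<bullet> h)"] by simp
      also have "\<dots> \<le> (x \<bullet> h)\<^sup>2" by simp
      also have "\<dots> \<le> (norm x * norm h)\<^sup>2"
        using power_mono[OF Cauchy_Schwarz_ineq2[of x h], of 2] by simp
      also have "\<dots> \<le> ((1 + norm x) * norm h)\<^sup>2"
        by (intro power_mono mult_right_mono) auto
      finally show "norm (cis (- (x \<bullet> (\<xi> + h))) * \<psi> x - cis (- (x \<bullet> \<xi>)) * \<psi> x - cis (- (x \<bullet> \<xi>)) * (- (\<i> * complex_of_real (x \<bullet> h)) * \<psi> x))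
          \<le> (norm h)\<^sup>2 * ((1 + norm x) ^ 2 * norm (\<psi> x))"
        unfolding eq unfolding norm_mult norm_cis mult_1 mult.assoc[symmetric]
        by (intro mult_right_mono) (simp_all add: power_mult_distrib mult.commute)
    qed (rule Bochner_Integration.integrable_diff i1 i2 i3 integrable_mult_right iK)+
    also have "\<dots> = K * (norm h)\<^sup>2" by (simp add: K_def)
    finally show ?thesis .
  qed
  show ?thesis
    unfolding has_derivative_at
  proof (intro conjI)
    show "bounded_linear ?D" using lin by (rule linear_conv_bounded_linear[THEN iffD1])
    show "(\<lambda>h. norm (fourier \<psi> (\<xi> + h) - fourier \<psi> \<xi> - ?D h) / norm h) \<midarrow>0\<rightarrow> 0"
    proof (rule tendsto_0_le[where K=1])
      show "((\<lambda>h. K * norm h) \<longlongrightarrow> 0) (at (0::'a))"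
        by (auto intro!: tendsto_eq_intros)
      show "\<forall>\<^sub>F h in at 0. norm (norm (fourier \<psi> (\<xi> + h) - fourier \<psi> \<xi> - ?D h) / norm h) \<le> norm (K * norm h) * 1"
        unfolding eventually_at_filter
      proof (intro always_eventually allI impI)
        fix h :: 'a assume "h \<noteq> 0"
        then have "norm (fourier \<psi> (\<xi> + h) - fourier \<psi> \<xi> - ?D h) / norm h \<le> K * norm h"
          using bound[of h] by (simp add: pos_divide_le_eq power2_eq_square mult.assoc)
        then show "norm (norm (fourier \<psi> (\<xi> + h) - fourier \<psi> \<xi> - ?D h) / norm h) \<le> norm (K * norm h) * 1"
          by simp
      qed
    qed
  qed
qed

lemma smooth_fourier:
  fixes \<psi> :: "'a::euclidean_space \<Rightarrow> complex"
  assumes "rapidly_decaying \<psi>"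
  shows "smooth (fourier \<psi>)"
proof (rule smooth_coinduct[where S="{fourier \<psi> | \<psi>. rapidly_decaying \<psi>}"])
  fix g :: "'a \<Rightarrow> complex" and x v
  assume "g \<in> {fourier \<psi> | \<psi>. rapidly_decaying \<psi>}"
  then obtain \<psi> where \<psi>: "rapidly_decaying \<psi>" and g: "g = fourier \<psi>" by blast
  note d = fourier_has_derivative[OF \<psi>]
  show "g differentiable at x" using d differentiable_def g by blast
  have "(\<lambda>x. frechet_derivative g (at x) v) = fourier (\<lambda>x. - (\<i> * complex_of_real (x \<bullet> v)) * \<psi> x)"
    unfolding g using frechet_derivativeI[OF d] by auto
  then show "(\<lambda>x. frechet_derivative g (at x) v) \<in> {fourier \<psi> | \<psi>. rapidly_decaying \<psi>}"
    using rapidly_decaying_mult_linear[OF \<psi>] by blast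
qed (use assms in blast)

lemma smooth_cmult: "smooth f \<Longrightarrow> smooth (\<lambda>x. c * f x :: complex)"
  using smooth_affine_compose[of f "\<lambda>w. c * w" 1 0] by (simp add: bounded_linear_mult_right)

lemma inv_fourier_eq:
  "inv_fourier \<phi> = (\<lambda>x. complex_of_real ((2 * pi) powr (- real DIM('a))) * fourier \<phi> (- x :: 'a::euclidean_space))"
  by (intro ext) (simp add: inv_fourier_def fourier_def inner_commute)

lemma smooth_inv_fourier:
  assumes "rapidly_decaying \<psi>"
  shows "smooth (inv_fourier \<psi>)"
  unfolding inv_fourier_eq
  using smooth_affine_compose[OF smooth_fourier[OF assms], of "\<lambda>w. w" "-1" 0]
  by (intro smooth_cmult) (simp add: bounded_linear_ident)

lemma test_fun_bounded:
  assumes "test_fun \<psi>"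
  obtains B where "\<And>x. norm (\<psi> x) \<le> B" "B \<ge> 0"
proof -
  obtain R where R: "\<And>x. R < norm x \<Longrightarrow> \<psi> x = 0" and s: "smooth \<psi>"
    using assms by (auto simp: test_fun_def)
  have "compact (\<psi> ` cball 0 R)"
    by (intro compact_continuous_image smooth_continuous_on s compact_cball)
  then obtain B where B: "\<And>x. x \<in> cball 0 R \<Longrightarrow> norm (\<psi> x) \<le> B"
    using compact_imp_bounded bounded_iff imageI by metis
  show thesis
  proof (rule that[of "max B 0"])
    show "norm (\<psi> x) \<le> max B 0" for x
      using B[of x] R[of x] by (cases "R < norm x") auto
  qed simp
qed

lemma test_fun_weighted_bounded:
  assumes "test_fun \<psi>"
  obtains B where "\<And>x. (1 + norm x) ^ k * norm (\<psi> x) \<le> B"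
proof -
  obtain R where R: "\<And>x. R < norm x \<Longrightarrow> \<psi> x = 0" using assms by (auto simp: test_fun_def)
  obtain B where B: "\<And>x. norm (\<psi> x) \<le> B" "B \<ge> 0" using test_fun_bounded[OF assms] by blast
  show thesis
  proof (rule that[of "(1 + \<bar>R\<bar>) ^ k * B"])
    fix x
    show "(1 + norm x) ^ k * norm (\<psi> x) \<le> (1 + \<bar>R\<bar>) ^ k * B"
    proof (cases "R < norm x")
      case True
      then show ?thesis using R B by simp
    next
      case False
      then show ?thesis using B by (intro mult_mono power_mono) auto
    qed
  qed
qed

lemma test_fun_frechet_derivative:
  assumes "test_fun \<psi>"
  shows "test_fun (\<lambda>x. frechet_derivative \<psi> (at x) v)"
proof -
  obtain R where R: "\<And>x. R < norm x \<Longrightarrow> \<psi> x = 0" and s: "smooth \<psi>"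
    using assms by (auto simp: test_fun_def)
  have "frechet_derivative \<psi> (at x) v = 0" if "R < norm x" for x
  proof -
    have "open {x::'a. R < norm x}" by (intro open_Collect_less continuous_intros)
    then have "((\<lambda>_. 0) has_derivative frechet_derivative \<psi> (at x)) (at x)"
      using has_derivative_transform_within_open[OF smooth_has_derivative[OF s], of "{x. R < norm x}" x] that R
      by auto
    from has_derivative_unique[OF this has_derivative_const] show ?thesis by simp
  qed
  then show ?thesis
    unfolding test_fun_def using smooth_frechet_derivative[OF s] by blast
qed

lemma test_fun_dir_derivs: "test_fun \<psi> \<Longrightarrow> test_fun (dir_derivs vs \<psi>)"
  by (induction vs) (auto intro: test_fun_frechet_derivative)

lemma test_fun_mult:
  assumes "smooth g" "test_fun \<psi>"
  shows "test_fun (\<lambda>x. g x * \<psi> x)"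
  using assms smooth_mult[of g \<psi>] unfolding test_fun_def by fastforce

lemma test_fun_mult_linear:
  assumes "test_fun \<psi>"
  shows "test_fun (\<lambda>x. - (\<i> * complex_of_real (x \<bullet> v)) * \<psi> x)"
proof (rule test_fun_mult[OF _ assms])
  have "bounded_linear (\<lambda>x. - (\<i> * complex_of_real (x \<bullet> v)))"
    by (intro bounded_linear_minus bounded_linear_const_mult bounded_linear_compose[OF bounded_linear_of_real] bounded_linear_inner_left)
  from smooth_const_add_linear[OF this, of 0]
  show "smooth (\<lambda>x. - (\<i> * complex_of_real (x \<bullet> v)))" by simp
qed

lemma test_fun_schwartz:
  assumes "test_fun \<psi>" shows "\<psi> \<in> schwartz"
  unfolding schwartz_def
proof (intro CollectI conjI allI impI)
  show "smooth \<psi>" using assms by (simp add: test_fun_def)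
  fix vs k
  obtain B where "\<And>x. (1 + norm x) ^ k * norm (dir_derivs vs \<psi> x) \<le> B"
    by (rule test_fun_weighted_bounded[OF test_fun_dir_derivs[OF assms, of vs], of k]) blast
  then show "bdd_above (range (\<lambda>x. (1 + norm x) ^ k * norm (dir_derivs vs \<psi> x)))"
    by (intro bdd_aboveI2)
qed

lemma schwartz_smooth: "\<phi> \<in> schwartz \<Longrightarrow> smooth \<phi>"
  by (simp add: schwartz_def)

lemma schwartz_weighted_bounded:
  assumes "\<phi> \<in> schwartz" "set vs \<subseteq> Basis"
  shows "\<exists>C. \<forall>x. (1 + norm x) ^ k * norm (dir_derivs vs \<phi> x) \<le> C"
proof -
  have "bdd_above (range (\<lambda>x. (1 + norm x) ^ k * norm (dir_derivs vs \<phi> x)))"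
    using assms by (simp add: schwartz_def)
  then show ?thesis by (simp add: bdd_above_def)
qed

lemma schwartz_dir_derivs_decay:
  fixes \<phi> :: "'a::euclidean_space \<Rightarrow> complex"
  assumes "\<phi> \<in> schwartz" "set vs \<subseteq> Basis"
  shows "\<exists>C\<ge>0. \<forall>x. (1 + norm x) ^ k * norm (dir_derivs vs \<phi> x) \<le> C * decay x"
proof -
  obtain C where C: "\<And>x. (1 + norm x) ^ (k + 2 * DIM('a)) * norm (dir_derivs vs \<phi> x) \<le> C"
    using schwartz_weighted_bounded[OF assms] by meson
  show ?thesis
  proof (intro exI[of _ C] conjI allI)
    show "C \<ge> 0" by (rule order_trans[OF _ C[of 0]]) simp
    show "(1 + norm x) ^ k * norm (dir_derivs vs \<phi> x) \<le> C * decay x" for x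
    proof -
      have "0 < (1 + norm x) ^ (2 * DIM('a))" by (simp add: add_pos_nonneg)
      then show ?thesis
        using C[of x] by (simp add: decay_def power_add pos_le_divide_eq mult_ac)
    qed
  qed
qed

lemma schwartz_derivative_decay:
  fixes \<phi> :: "'a::euclidean_space \<Rightarrow> complex"
  assumes \<phi>: "\<phi> \<in> schwartz"
  obtains C where "C \<ge> 0" "\<And>x v. norm (frechet_derivative \<phi> (at x) v) \<le> C * norm v * decay x"
proof -
  have "\<exists>C. C \<ge> 0 \<and> (\<forall>x. norm (dir_derivs [i] \<phi> x) \<le> C * decay x)" if "i \<in> Basis" for i
    using schwartz_dir_derivs_decay[OF \<phi>, of "[i]" 0] that by simp
  then obtain C where C: "\<And>i. i \<in> Basis \<Longrightarrow> C i \<ge> 0" "\<And>i x. i \<in> Basis \<Longrightarrow> norm (dir_derivs [i] \<phi> x) \<le> C i * decay x"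
    by metis
  show thesis
  proof (rule that[of "sum C Basis"])
    show "sum C Basis \<ge> 0" using C by (intro sum_nonneg) auto
    fix x v
    have "norm (frechet_derivative \<phi> (at x) v) = norm (\<Sum>i\<in>Basis. (v \<bullet> i) *\<^sub>R dir_derivs [i] \<phi> x)"
      by (subst smooth_frechet_derivative_sum_Basis[OF schwartz_smooth[OF \<phi>]]) simp
    also have "\<dots> \<le> (\<Sum>i\<in>Basis. norm v * (C i * decay x))"
    proof (intro sum_norm_le)
      fix i :: 'a assume i: "i \<in> Basis"
      show "norm ((v \<bullet> i) *\<^sub>R dir_derivs [i] \<phi> x) \<le> norm v * (C i * decay x)"
        unfolding norm_scaleR using Basis_le_norm[OF i, of v] C(2)[OF i, of x] by (intro mult_mono) auto
    qed
    also have "\<dots> = sum C Basis * norm v * decay x"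
      by (simp add: sum_distrib_left sum_distrib_right mult_ac)
    finally show "norm (frechet_derivative \<phi> (at x) v) \<le> sum C Basis * norm v * decay x" .
  qed
qed

lemma schwartz_rapidly_decaying:
  fixes \<phi> :: "'a::euclidean_space \<Rightarrow> complex"
  assumes "\<phi> \<in> schwartz" shows "rapidly_decaying \<phi>"
  unfolding rapidly_decaying_def
proof (intro conjI allI)
  show m: "\<phi> \<in> borel_measurable borel" by (rule smooth_borel_measurable[OF schwartz_smooth[OF assms]])
  note [measurable] = m
  fix k
  obtain C where C: "C \<ge> 0" "\<And>x. (1 + norm x) ^ k * norm (dir_derivs [] \<phi> x) \<le> C * decay x"
    using schwartz_dir_derivs_decay[OF assms, of "[]" k] by auto
  show "integrable lborel (\<lambda>x. (1 + norm x) ^ k * norm (\<phi> x))"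
    by (rule Bochner_Integration.integrable_bound[OF integrable_mult_right[OF decay_integrable, of C]])
      (use C in \<open>auto intro!: AE_I2 order_trans[OF _ abs_ge_self]\<close>)
qed

lemma schwartz_measurable: "\<phi> \<in> schwartz \<Longrightarrow> \<phi> \<in> borel_measurable borel"
  by (intro rapidly_decaying_measurable schwartz_rapidly_decaying)

lemma schwartz_integrable: "\<phi> \<in> schwartz \<Longrightarrow> integrable lborel \<phi>"
  by (intro rapidly_decaying_integrable schwartz_rapidly_decaying)

lemma schwartz_bounded:
  assumes "\<phi> \<in> schwartz"
  obtains B where "B \<ge> 0" "\<And>x. norm (\<phi> x) \<le> B"
proof -
  obtain B where B: "\<And>x. (1 + norm x) ^ 0 * norm (dir_derivs [] \<phi> x) \<le> B"
    using schwartz_weighted_bounded[OF assms, of "[]" 0] by auto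
  then show thesis using that[of "max B 0"] by (simp add: max.coboundedI1)
qed

lemma decay_shift: "norm z \<le> 1 \<Longrightarrow> decay (y + z :: 'a::euclidean_space) \<le> 4 ^ DIM('a) * decay y"
proof -
  assume z: "norm z \<le> 1"
  have "norm y \<le> norm (y + z) + norm z" using norm_triangle_ineq4[of "y + z" z] by simp
  then have "1 + norm y \<le> 2 * (1 + norm (y + z))" using z norm_ge_zero[of "y + z"] by argo
  then have "(1 + norm y) ^ (2 * DIM('a)) \<le> (2 * (1 + norm (y + z))) ^ (2 * DIM('a))"
    by (intro power_mono) auto
  also have "\<dots> = 4 ^ DIM('a) * (1 + norm (y + z)) ^ (2 * DIM('a))"
    by (subst power_mult_distrib) (simp add: power_mult)
  finally show ?thesis
    by (simp add: decay_def divide_simps add_pos_nonneg mult_ac)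
qed

text \<open>The second derivatives at the intermediate points \<open>y + w z\<close> decay like those at \<open>y\<close>, because \<open>|z| \<le> 1\<close> changes \<open>decay\<close>
by a bounded factor.\<close>

lemma schwartz_second_order:
  fixes \<phi> :: "'a::euclidean_space \<Rightarrow> complex"
  assumes \<phi>: "\<phi> \<in> schwartz"
  obtains C where "C \<ge> 0"
    "\<And>y z. norm z \<le> 1 \<Longrightarrow> norm (\<phi> (y + z) - \<phi> y - frechet_derivative \<phi> (at y) z) \<le> C * (norm z)\<^sup>2 * decay y"
proof -
  have "\<exists>C. C \<ge> 0 \<and> (\<forall>x. norm (dir_derivs [i, j] \<phi> x) \<le> C * decay x)" if "i \<in> Basis" "j \<in> Basis" for i j
    using schwartz_dir_derivs_decay[OF \<phi>, of "[i, j]" 0] that by simp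
  then obtain C where C: "\<And>i j. i \<in> Basis \<Longrightarrow> j \<in> Basis \<Longrightarrow> C i j \<ge> 0"
    "\<And>i j x. i \<in> Basis \<Longrightarrow> j \<in> Basis \<Longrightarrow> norm (dir_derivs [i, j] \<phi> x) \<le> C i j * decay x"
    by metis
  define D where "D = (\<Sum>i\<in>Basis. \<Sum>j\<in>Basis. C i j)"
  have D: "D \<ge> 0" unfolding D_def using C by (intro sum_nonneg) auto
  have CD: "C i j \<le> D" if "i \<in> Basis" "j \<in> Basis" for i j
  proof -
    have "C i j \<le> (\<Sum>j\<in>Basis. C i j)" using that C by (intro member_le_sum) auto
    also have "\<dots> \<le> D" unfolding D_def using that C
      by (intro member_le_sum[where f="\<lambda>i. \<Sum>j\<in>Basis. C i j"] sum_nonneg) (auto intro!: sum_nonneg)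
    finally show ?thesis .
  qed
  show thesis
  proof (rule that[of "real DIM('a) ^ 2 * (D * 4 ^ DIM('a))"])
    fix y z :: 'a assume z: "norm z \<le> 1"
    have "norm (\<phi> (y + z) - \<phi> y - frechet_derivative \<phi> (at y) z) \<le> real DIM('a) ^ 2 * (D * (4 ^ DIM('a) * decay y)) * (norm z)\<^sup>2"
    proof (rule smooth_second_order_bound[OF schwartz_smooth[OF \<phi>]])
      fix w :: real and i j :: 'a assume w: "w \<in> {0..1}" and ij: "i \<in> Basis" "j \<in> Basis"
      have "norm (w *\<^sub>R z) \<le> 1" using w z by (simp add: mult_le_one)
      then have "decay (y + w *\<^sub>R z) \<le> 4 ^ DIM('a) * decay y" by (rule decay_shift)
      then have "C i j * decay (y + w *\<^sub>R z) \<le> D * (4 ^ DIM('a) * decay y)"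
        using CD[OF ij] D by (intro mult_mono) (auto simp: decay_pos less_imp_le)
      then show "norm (dir_derivs [i, j] \<phi> (y + w *\<^sub>R z)) \<le> D * (4 ^ DIM('a) * decay y)"
        using C(2)[OF ij, of "y + w *\<^sub>R z"] by linarith
    qed
    then show "norm (\<phi> (y + z) - \<phi> y - frechet_derivative \<phi> (at y) z) \<le> real DIM('a) ^ 2 * (D * 4 ^ DIM('a)) * (norm z)\<^sup>2 * decay y"
      by (simp add: mult_ac)
  qed (use D in auto)
qed

section \<open>Fourier transforms of compactly supported smooth functions\<close>

lemma fourier_shift:
  fixes \<phi> :: "'a::euclidean_space \<Rightarrow> complex"
  shows "fourier (\<lambda>x. \<phi> (x + y)) \<xi> = cis (y \<bullet> \<xi>) * fourier \<phi> \<xi>"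
proof -
  have "fourier (\<lambda>x. \<phi> (x + y)) \<xi> = (\<integral>x. cis (y \<bullet> \<xi>) * (cis (- ((x + y) \<bullet> \<xi>)) * \<phi> (x + y)) \<partial>lborel)"
    unfolding fourier_def mult.assoc[symmetric] cis_mult by (simp add: inner_add_left)
  also have "\<dots> = cis (y \<bullet> \<xi>) * (\<integral>x. cis (- ((x + y) \<bullet> \<xi>)) * \<phi> (x + y) \<partial>lborel)"
    by (rule integral_mult_right_zero)
  also have "(\<integral>x. cis (- ((x + y) \<bullet> \<xi>)) * \<phi> (x + y) \<partial>lborel) = fourier \<phi> \<xi>"
    unfolding fourier_def by (rule lborel_integral_shift[of "\<lambda>x. cis (- (x \<bullet> \<xi>)) * \<phi> x" y])
  finally show ?thesis .
qed

lemma fourier_integrable_cis: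
  "integrable lborel \<phi> \<Longrightarrow> integrable lborel (\<lambda>x. cis (- (x \<bullet> \<xi>)) * \<phi> x)"
  for \<phi> :: "'a::euclidean_space \<Rightarrow> complex"
  by (rule integrable_cis_mult) measurable

lemma schwartz_derivative_integrable:
  fixes \<phi> :: "'a::euclidean_space \<Rightarrow> complex"
  assumes "\<phi> \<in> schwartz"
  shows "integrable lborel (\<lambda>x. frechet_derivative \<phi> (at x) v)"
proof -
  obtain C where C: "\<And>x v. norm (frechet_derivative \<phi> (at x) v) \<le> C * norm v * decay x"
    using schwartz_derivative_decay[OF assms] by metis
  have [measurable]: "(\<lambda>x. frechet_derivative \<phi> (at x) v) \<in> borel_measurable borel"
    by (rule smooth_borel_measurable[OF smooth_frechet_derivative[OF schwartz_smooth[OF assms]]])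
  show ?thesis
    by (rule Bochner_Integration.integrable_bound[OF integrable_mult_right[OF decay_integrable, of "C * norm v"]])
      (use C in \<open>auto intro!: AE_I2 order_trans[OF _ abs_ge_self]\<close>)
qed

text \<open>Instead of integration by parts: translation by \<open>h v\<close> multiplies the Fourier transform by \<open>cis (h (v \<bullet> \<xi>))\<close>. Both
sides are expanded to first order in \<open>h\<close> with quadratic errors, and the coefficients of \<open>h\<close> must agree.\<close>

lemma fourier_frechet_derivative:
  fixes \<phi> :: "'a::euclidean_space \<Rightarrow> complex"
  assumes \<phi>: "\<phi> \<in> schwartz"
  shows "fourier (\<lambda>x. frechet_derivative \<phi> (at x) v) \<xi> = \<i> * complex_of_real (v \<bullet> \<xi>) * fourier \<phi> \<xi>"
proof -
  define G where "G = fourier (\<lambda>x. frechet_derivative \<phi> (at x) v) \<xi>"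
  define s where "s = v \<bullet> \<xi>"
  define I where "I = (\<integral>x. decay (x::'a) \<partial>lborel)"
  obtain C where C: "C \<ge> 0"
    "\<And>y z. norm z \<le> 1 \<Longrightarrow> norm (\<phi> (y + z) - \<phi> y - frechet_derivative \<phi> (at y) z) \<le> C * (norm z)\<^sup>2 * decay y"
    using schwartz_second_order[OF \<phi>] by metis
  \<comment> \<open>The sum of the two quadratic errors: one from Taylor expansion of \<open>\<phi>\<close>, one from that of \<open>cis\<close>.\<close>
  define K where "K = C * (norm v)\<^sup>2 * I + s\<^sup>2 / 2 * norm (fourier \<phi> \<xi>)"
  have lin: "frechet_derivative \<phi> (at y) (h *\<^sub>R v) = complex_of_real h * frechet_derivative \<phi> (at y) v" for h y
    using linear_scale[OF has_derivative_linear[OF smooth_has_derivative[OF schwartz_smooth[OF \<phi>]]]]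
    by (simp add: scaleR_conv_of_real)
  have i1: "integrable lborel (\<lambda>x. cis (- (x \<bullet> \<xi>)) * \<phi> (x + h *\<^sub>R v))" for h
    by (intro fourier_integrable_cis lborel_integrable_shift schwartz_integrable \<phi>)
  have i2: "integrable lborel (\<lambda>x. cis (- (x \<bullet> \<xi>)) * \<phi> x)"
    by (intro fourier_integrable_cis schwartz_integrable \<phi>)
  have i3: "integrable lborel (\<lambda>x. complex_of_real h * (cis (- (x \<bullet> \<xi>)) * frechet_derivative \<phi> (at x) v))" for h
    by (intro integrable_mult_right fourier_integrable_cis schwartz_derivative_integrable \<phi>)
  have bound: "h * norm (\<i> * complex_of_real s * fourier \<phi> \<xi> - G) \<le> K * h\<^sup>2" if h: "h > 0" "h * norm v \<le> 1" for h
  proof -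
    have eq: "cis (h * s) * fourier \<phi> \<xi> - fourier \<phi> \<xi> - complex_of_real h * G =
      (\<integral>x. cis (- (x \<bullet> \<xi>)) * \<phi> (x + h *\<^sub>R v) - cis (- (x \<bullet> \<xi>)) * \<phi> x - complex_of_real h * (cis (- (x \<bullet> \<xi>)) * frechet_derivative \<phi> (at x) v) \<partial>lborel)"
      unfolding Bochner_Integration.integral_diff[OF Bochner_Integration.integrable_diff[OF i1 i2] i3]
        Bochner_Integration.integral_diff[OF i1 i2] integral_mult_right_zero G_def
      using fourier_shift[of \<phi> "h *\<^sub>R v" \<xi>] by (simp add: fourier_def s_def)
    have "norm (cis (h * s) * fourier \<phi> \<xi> - fourier \<phi> \<xi> - complex_of_real h * G) \<le> (\<integral>x. C * (h * norm v)\<^sup>2 * decay (x::'a) \<partial>lborel)"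
      unfolding eq
    proof (rule Bochner_Integration.integral_norm_bound_integral)
      fix x :: 'a
      have "cis (- (x \<bullet> \<xi>)) * \<phi> (x + h *\<^sub>R v) - cis (- (x \<bullet> \<xi>)) * \<phi> x - complex_of_real h * (cis (- (x \<bullet> \<xi>)) * frechet_derivative \<phi> (at x) v)
        = cis (- (x \<bullet> \<xi>)) * (\<phi> (x + h *\<^sub>R v) - \<phi> x - frechet_derivative \<phi> (at x) (h *\<^sub>R v))"
        by (simp add: lin algebra_simps)
      then have "norm (cis (- (x \<bullet> \<xi>)) * \<phi> (x + h *\<^sub>R v) - cis (- (x \<bullet> \<xi>)) * \<phi> x - complex_of_real h * (cis (- (x \<bullet> \<xi>)) * frechet_derivative \<phi> (at x) v))
        = norm (\<phi> (x + h *\<^sub>R v) - \<phi> x - frechet_derivative \<phi> (at x) (h *\<^sub>R v))"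
        by (simp add: norm_mult)
      also have "\<dots> \<le> C * (norm (h *\<^sub>R v))\<^sup>2 * decay x"
        using h by (intro C(2)) simp
      finally show "norm (cis (- (x \<bullet> \<xi>)) * \<phi> (x + h *\<^sub>R v) - cis (- (x \<bullet> \<xi>)) * \<phi> x - complex_of_real h * (cis (- (x \<bullet> \<xi>)) * frechet_derivative \<phi> (at x) v))
        \<le> C * (h * norm v)\<^sup>2 * decay x"
        using h by simp
    qed (rule Bochner_Integration.integrable_diff i1 i2 i3 integrable_mult_right decay_integrable)+
    then have A: "norm (cis (h * s) * fourier \<phi> \<xi> - fourier \<phi> \<xi> - complex_of_real h * G) \<le> C * (norm v)\<^sup>2 * I * h\<^sup>2"
      by (simp add: I_def power_mult_distrib mult_ac)
    have B: "norm ((cis (h * s) - 1 - \<i> * complex_of_real (h * s)) * fourier \<phi> \<xi>) \<le> ((h * s)\<^sup>2 / 2) * norm (fourier \<phi> \<xi>)"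
      unfolding norm_mult[of _ "fourier \<phi> \<xi>"] by (intro mult_right_mono norm_cis_minus_linear) auto
    have "complex_of_real h * (\<i> * complex_of_real s * fourier \<phi> \<xi> - G) =
      (cis (h * s) * fourier \<phi> \<xi> - fourier \<phi> \<xi> - complex_of_real h * G) - (cis (h * s) - 1 - \<i> * complex_of_real (h * s)) * fourier \<phi> \<xi>"
      by (simp add: algebra_simps)
    then have "norm (complex_of_real h * (\<i> * complex_of_real s * fourier \<phi> \<xi> - G)) \<le> C * (norm v)\<^sup>2 * I * h\<^sup>2 + ((h * s)\<^sup>2 / 2) * norm (fourier \<phi> \<xi>)"
      using norm_triangle_le_diff[OF add_mono[OF A B]] by simp
    also have "\<dots> = K * h\<^sup>2"
      by (simp add: K_def power_mult_distrib algebra_simps)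
    finally show ?thesis
      using h unfolding norm_mult by simp
  qed
  have "norm (\<i> * complex_of_real s * fourier \<phi> \<xi> - G) \<le> 0"
  proof (rule tendsto_lowerbound)
    show "((\<lambda>h. K * h) \<longlongrightarrow> 0) (at_right 0)" by (auto intro!: tendsto_eq_intros)
    have "\<forall>\<^sub>F h in at_right 0. h < 1 / (1 + norm v)"
      by (rule eventually_at_right_less[THEN eventually_mono, of 0] eventually_at_rightI[of 0 "1 / (1 + norm v)"]; simp add: add_pos_nonneg)
    then show "\<forall>\<^sub>F h in at_right 0. norm (\<i> * complex_of_real s * fourier \<phi> \<xi> - G) \<le> K * h"
      using eventually_at_right_less[of 0]
    proof eventually_elim
      case (elim h)
      have p: "0 < 1 + norm v" by (simp add: add_pos_nonneg)
      then have "h * (1 + norm v) < 1" using elim by (simp add: pos_less_divide_eq)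
      then have "h * norm v \<le> 1" using elim by (simp add: algebra_simps)
      then have "h * norm (\<i> * complex_of_real s * fourier \<phi> \<xi> - G) \<le> h * (K * h)"
        using bound[of h] elim by (simp add: power2_eq_square mult_ac)
      then show ?case using elim by simp
    qed
  qed simp
  then show ?thesis by (simp add: s_def G_def)
qed

text \<open>Induction on the weight: one factor \<open>1 + |\<xi>| \<le> 1 + \<Sum>|\<xi>\<^sub>i|\<close> is traded for first derivatives of \<open>\<psi>\<close>.\<close>

lemma fourier_test_fun_bounded:
  fixes \<psi> :: "'a::euclidean_space \<Rightarrow> complex"
  assumes "test_fun \<psi>"
  shows "\<exists>B. \<forall>\<xi>. (1 + norm \<xi>) ^ k * norm (fourier \<psi> \<xi>) \<le> B"
  using assms
proof (induction k arbitrary: \<psi>)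
  case 0
  have "norm (fourier \<psi> \<xi>) \<le> (\<integral>x. norm (\<psi> x) \<partial>lborel)" for \<xi>
    unfolding fourier_def by (rule order_trans[OF integral_norm_bound]) (simp add: norm_mult)
  then show ?case by auto
next
  case (Suc k)
  obtain B0 where B0: "\<And>\<xi>. (1 + norm \<xi>) ^ k * norm (fourier \<psi> \<xi>) \<le> B0"
    using Suc.IH[OF Suc.prems] by blast
  have "\<exists>B. \<forall>\<xi>. (1 + norm \<xi>) ^ k * norm (fourier (\<lambda>x. frechet_derivative \<psi> (at x) v) \<xi>) \<le> B" for v
    by (rule Suc.IH[OF test_fun_frechet_derivative[OF Suc.prems]])
  then obtain B where B: "\<And>v \<xi>. (1 + norm \<xi>) ^ k * norm (fourier (\<lambda>x. frechet_derivative \<psi> (at x) v) \<xi>) \<le> B v"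
    by metis
  have "(1 + norm \<xi>) ^ Suc k * norm (fourier \<psi> \<xi>) \<le> B0 + (\<Sum>v\<in>Basis. B v)" for \<xi>
  proof -
    have "(1 + norm \<xi>) ^ Suc k * norm (fourier \<psi> \<xi>) = (1 + norm \<xi>) * ((1 + norm \<xi>) ^ k * norm (fourier \<psi> \<xi>))"
      by simp
    also have "\<dots> \<le> (1 + (\<Sum>v\<in>Basis. \<bar>\<xi> \<bullet> v\<bar>)) * ((1 + norm \<xi>) ^ k * norm (fourier \<psi> \<xi>))"
      using norm_le_l1[of \<xi>] by (intro mult_right_mono) auto
    also have "\<dots> = (1 + norm \<xi>) ^ k * norm (fourier \<psi> \<xi>) +
        (\<Sum>v\<in>Basis. (1 + norm \<xi>) ^ k * (\<bar>\<xi> \<bullet> v\<bar> * norm (fourier \<psi> \<xi>)))"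
      by (simp add: distrib_right distrib_left sum_distrib_right sum_distrib_left mult.left_commute)
    also have "\<dots> = (1 + norm \<xi>) ^ k * norm (fourier \<psi> \<xi>) +
        (\<Sum>v\<in>Basis. (1 + norm \<xi>) ^ k * norm (fourier (\<lambda>x. frechet_derivative \<psi> (at x) v) \<xi>))"
      by (simp add: fourier_frechet_derivative[OF test_fun_schwartz[OF Suc.prems]] norm_mult inner_commute)
    also have "\<dots> \<le> B0 + (\<Sum>v\<in>Basis. B v)"
      by (intro add_mono sum_mono B0 B)
    finally show ?thesis .
  qed
  then show ?case by blast
qed

lemma test_fun_rapidly_decaying: "test_fun \<psi> \<Longrightarrow> rapidly_decaying \<psi>"
  by (intro schwartz_rapidly_decaying test_fun_schwartz)

text \<open>Derivatives of the Fourier transform are Fourier transforms of \<open>\<psi>\<close> times polynomials, which are again smooth with compact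
support, so a bound without derivatives is enough.\<close>

lemma fourier_test_fun_schwartz:
  fixes \<psi> :: "'a::euclidean_space \<Rightarrow> complex"
  assumes "test_fun \<psi>"
  shows "fourier \<psi> \<in> schwartz"
  unfolding schwartz_def
proof (intro CollectI conjI allI impI)
  show "smooth (fourier \<psi>)" by (intro smooth_fourier test_fun_rapidly_decaying assms)
  fix vs :: "'a list" and k
  have "\<exists>\<psi>'. test_fun \<psi>' \<and> dir_derivs vs (fourier \<psi>) = fourier \<psi>'"
  proof (induction vs)
    case Nil
    then show ?case using assms by auto
  next
    case (Cons v vs)
    then obtain \<psi>' where \<psi>': "test_fun \<psi>'" "dir_derivs vs (fourier \<psi>) = fourier \<psi>'" by blast
    have "dir_derivs (v # vs) (fourier \<psi>) = fourier (\<lambda>x. - (\<i> * complex_of_real (x \<bullet> v)) * \<psi>' x)"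
      using frechet_derivativeI[OF fourier_has_derivative[OF test_fun_rapidly_decaying[OF \<psi>'(1)]]] \<psi>'(2)
      by auto
    then show ?case using test_fun_mult_linear[OF \<psi>'(1)] by blast
  qed
  then obtain \<psi>' where \<psi>': "test_fun \<psi>'" "dir_derivs vs (fourier \<psi>) = fourier \<psi>'" by blast
  obtain B where "\<And>\<xi>. (1 + norm \<xi>) ^ k * norm (fourier \<psi>' \<xi>) \<le> B"
    using fourier_test_fun_bounded[OF \<psi>'(1)] by meson
  then show "bdd_above (range (\<lambda>x. (1 + norm x) ^ k * norm (dir_derivs vs (fourier \<psi>) x)))"
    unfolding \<psi>'(2) by (intro bdd_aboveI2)
qed

lemma
  fixes w :: "'a::euclidean_space"
  assumes t: "0 < t"
  shows integrable_cis_exp_norm_squared: "integrable lborel (\<lambda>\<xi>. cis (w \<bullet> \<xi>) * complex_of_real (exp (- (t * (norm \<xi>)\<^sup>2))))"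
    and integral_cis_exp_norm_squared: "(\<integral>\<xi>. cis (w \<bullet> \<xi>) * complex_of_real (exp (- (t * (norm \<xi>)\<^sup>2))) \<partial>lborel) =
      complex_of_real ((2 * pi) ^ DIM('a) * heat_kernel t w)"
proof -
  define s where "s = 1 / (4 * t)"
  let ?a = "real DIM('a) / 2"
  have s: "s > 0" using t by (simp add: s_def)
  have "exp (- (t * (norm \<xi>)\<^sup>2)) = (4 * pi * s) powr ?a * heat_kernel s \<xi>" for \<xi> :: 'a
  proof -
    have "(4 * pi * s) powr ?a * (4 * pi * s) powr (- ?a) = 1"
      using s by (simp add: powr_add[symmetric])
    moreover have "(norm \<xi>)\<^sup>2 / (4 * s) = t * (norm \<xi>)\<^sup>2" using t by (simp add: s_def)
    ultimately show ?thesis unfolding heat_kernel_def mult.assoc[symmetric] by simp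
  qed
  then have eq: "cis (w \<bullet> \<xi>) * complex_of_real (exp (- (t * (norm \<xi>)\<^sup>2))) =
      complex_of_real ((4 * pi * s) powr ?a) * (cis (\<xi> \<bullet> w) * complex_of_real (heat_kernel s \<xi>))" for \<xi>
    by (simp add: inner_commute)
  show "integrable lborel (\<lambda>\<xi>. cis (w \<bullet> \<xi>) * complex_of_real (exp (- (t * (norm \<xi>)\<^sup>2))))"
    unfolding eq by (intro integrable_mult_right integrable_cis_heat_kernel s)
  have "(4 * pi * s) powr ?a * exp (- (s * (norm w)\<^sup>2)) = (2 * pi) ^ DIM('a) * heat_kernel t w"
  proof -
    have "(2 * pi) ^ DIM('a) = (2 * pi) powr (2 * ?a)"
      by (simp add: powr_realpow)
    also have "\<dots> = ((2 * pi) powr 2) powr ?a" by (rule powr_powr[symmetric])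
    also have "(2 * pi) powr 2 = (2 * pi)\<^sup>2" by simp
    finally have "(2 * pi) ^ DIM('a) = ((2 * pi)\<^sup>2) powr ?a" .
    moreover have "(4 * pi * t) powr (- ?a) = (1 / (4 * pi * t)) powr ?a"
      using t by (simp add: powr_minus powr_divide inverse_eq_divide)
    moreover have "((2 * pi)\<^sup>2) powr ?a * (1 / (4 * pi * t)) powr ?a = ((2 * pi)\<^sup>2 * (1 / (4 * pi * t))) powr ?a"
      using t by (intro powr_mult[symmetric])
    moreover have "(2 * pi)\<^sup>2 * (1 / (4 * pi * t)) = 4 * pi * s"
      using t by (simp add: s_def power2_eq_square)
    moreover have "s * (norm w)\<^sup>2 = (norm w)\<^sup>2 / (4 * t)" by (simp add: s_def)
    ultimately show ?thesis unfolding heat_kernel_def mult.assoc[symmetric] by simp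
  qed
  then show "(\<integral>\<xi>. cis (w \<bullet> \<xi>) * complex_of_real (exp (- (t * (norm \<xi>)\<^sup>2))) \<partial>lborel) =
      complex_of_real ((2 * pi) ^ DIM('a) * heat_kernel t w)"
    unfolding eq integral_mult_right_zero integral_cis_heat_kernel[OF s] of_real_mult[symmetric] by simp
qed

lemma heat_kernel_scale:
  fixes v :: "'a::euclidean_space"
  assumes "0 < t"
  shows "sqrt t ^ DIM('a) * heat_kernel t (sqrt t *\<^sub>R v) = heat_kernel 1 v"
proof -
  let ?a = "real DIM('a) / 2"
  have "sqrt t ^ DIM('a) = t powr ?a"
    using assms by (simp add: powr_half_sqrt[symmetric] powr_realpow[symmetric] powr_powr mult.commute)
  moreover have "(4 * pi * t) powr (- ?a) = (4 * pi) powr (- ?a) * t powr (- ?a)"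
    using assms by (intro powr_mult) 
  moreover have "t powr ?a * t powr (- ?a) = 1" using assms by (simp add: powr_add[symmetric])
  moreover have "(norm (sqrt t *\<^sub>R v))\<^sup>2 / (4 * t) = (norm v)\<^sup>2 / 4"
    using assms by (simp add: power_mult_distrib)
  moreover have "p * ((c * q) * e) = c * e" if "p * q = 1" for p q c e :: real
    using that by algebra
  ultimately show ?thesis unfolding heat_kernel_def by (simp only: mult_1_right)
qed

text \<open>After rescaling, the heat kernel at time one is a fixed density, and \<open>\<psi>\<close> is evaluated at points that converge to \<open>x\<close>.\<close>

lemma heat_kernel_approximate_identity:
  fixes \<psi> :: "'a::euclidean_space \<Rightarrow> complex"
  assumes c: "continuous_on UNIV \<psi>" and B: "\<And>x. norm (\<psi> x) \<le> B"
    and t: "\<And>n. 0 < t n" "t \<longlonglongrightarrow> 0"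
  shows "(\<lambda>n. \<integral>y. \<psi> y * complex_of_real (heat_kernel (t n) (x - y)) \<partial>lborel) \<longlonglongrightarrow> \<psi> x"
proof -
  have m [measurable]: "\<psi> \<in> borel_measurable borel" using c by (rule borel_measurable_continuous_onI)
  have eq: "(\<integral>y. \<psi> y * complex_of_real (heat_kernel (t n) (x - y)) \<partial>lborel) =
    (\<integral>v. complex_of_real (heat_kernel 1 v) * \<psi> (x - sqrt (t n) *\<^sub>R v) \<partial>lborel)" for n
  proof -
    have "(\<integral>y. \<psi> y * complex_of_real (heat_kernel (t n) (x - y)) \<partial>lborel) =
      \<bar>- sqrt (t n)\<bar> ^ DIM('a) *\<^sub>R (\<integral>v. \<psi> (x + (- sqrt (t n)) *\<^sub>R v) * complex_of_real (heat_kernel (t n) (x - (x + (- sqrt (t n)) *\<^sub>R v))) \<partial>lborel)"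
      using t(1)[of n] by (intro lborel_integral_affine) simp
    also have "\<dots> = (\<integral>v. complex_of_real (sqrt (t n) ^ DIM('a)) * (\<psi> (x - sqrt (t n) *\<^sub>R v) * complex_of_real (heat_kernel (t n) (sqrt (t n) *\<^sub>R v))) \<partial>lborel)"
      unfolding integral_mult_right_zero using t(1)[of n] by (simp add: scaleR_conv_of_real)
    also have "\<dots> = (\<integral>v. complex_of_real (heat_kernel 1 v) * \<psi> (x - sqrt (t n) *\<^sub>R v) \<partial>lborel)"
      unfolding heat_kernel_scale[OF t(1)[of n], symmetric] of_real_mult by (simp only: mult_ac)
    finally show ?thesis .
  qed
  have "(\<lambda>n. \<integral>v. complex_of_real (heat_kernel 1 v) * \<psi> (x - sqrt (t n) *\<^sub>R v) \<partial>lborel) \<longlonglongrightarrow>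
    (\<integral>v. complex_of_real (heat_kernel 1 (v::'a)) * \<psi> x \<partial>lborel)"
  proof (rule integral_dominated_convergence[where w="\<lambda>v::'a. heat_kernel 1 v * B"])
    show "integrable lborel (\<lambda>v::'a. heat_kernel 1 v * B)"
      by (intro integrable_mult_left heat_kernel_integrable) simp
    show "AE v in lborel. (\<lambda>n. complex_of_real (heat_kernel 1 v) * \<psi> (x - sqrt (t n) *\<^sub>R v)) \<longlonglongrightarrow> complex_of_real (heat_kernel 1 v) * \<psi> x"
    proof (intro AE_I2 tendsto_mult_left)
      fix v
      have "(\<lambda>n. x - sqrt (t n) *\<^sub>R v) \<longlonglongrightarrow> x - sqrt 0 *\<^sub>R v"
        by (intro tendsto_intros t)
      then have "(\<lambda>n. x - sqrt (t n) *\<^sub>R v) \<longlonglongrightarrow> x" by simp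
      then show "(\<lambda>n. \<psi> (x - sqrt (t n) *\<^sub>R v)) \<longlonglongrightarrow> \<psi> x"
        using c by (intro continuous_on_tendsto_compose[where f=\<psi> and s=UNIV]) auto
    qed
    show "AE v in lborel. norm (complex_of_real (heat_kernel 1 v) * \<psi> (x - sqrt (t n) *\<^sub>R v)) \<le> heat_kernel 1 v * B" for n
      by (auto simp: norm_mult heat_kernel_nonneg intro!: mult_left_mono B)
  qed measurable
  also have "(\<integral>v. complex_of_real (heat_kernel 1 (v::'a)) * \<psi> x \<partial>lborel) = \<psi> x"
    by (simp add: heat_kernel_integral)
  finally show ?thesis unfolding eq .
qed

text \<open>The classical proof: a Gaussian factor that tends to one makes Fubini's theorem applicable, and the inner integral is then a
heat kernel that acts on \<open>\<psi>\<close> as an approximate identity.\<close>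

lemma fourier_inversion:
  fixes \<psi> :: "'a::euclidean_space \<Rightarrow> complex"
  assumes \<psi>: "test_fun \<psi>"
  shows "inv_fourier (fourier \<psi>) = \<psi>"
proof
  fix x :: 'a
  define t where "t = (\<lambda>n. 1 / real (Suc n))"
  have t: "0 < t n" for n by (simp add: t_def)
  have t0: "t \<longlonglongrightarrow> 0" unfolding t_def using LIMSEQ_inverse_real_of_nat by (simp add: inverse_eq_divide)
  have i\<psi>: "integrable lborel \<psi>" by (intro rapidly_decaying_integrable test_fun_rapidly_decaying \<psi>)
  have [measurable]: "\<psi> \<in> borel_measurable borel" by (intro rapidly_decaying_measurable test_fun_rapidly_decaying \<psi>)
  have iF: "integrable lborel (fourier \<psi>)" by (intro schwartz_integrable fourier_test_fun_schwartz \<psi>)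
  have [measurable]: "fourier \<psi> \<in> borel_measurable borel" by (intro schwartz_measurable fourier_test_fun_schwartz \<psi>)
  have lim1: "(\<lambda>n. \<integral>\<xi>. complex_of_real (exp (- (t n * (norm \<xi>)\<^sup>2))) * (cis (x \<bullet> \<xi>) * fourier \<psi> \<xi>) \<partial>lborel)
      \<longlonglongrightarrow> (\<integral>\<xi>. complex_of_real (exp (- (0 * (norm \<xi>)\<^sup>2))) * (cis (x \<bullet> \<xi>) * fourier \<psi> \<xi>) \<partial>lborel)"
  proof (rule integral_dominated_convergence[where w="\<lambda>\<xi>::'a. norm (fourier \<psi> \<xi>)"])
    show "integrable lborel (\<lambda>\<xi>. norm (fourier \<psi> \<xi>))" using iF by (rule integrable_norm)
    show "AE \<xi> in lborel. (\<lambda>n. complex_of_real (exp (- (t n * (norm \<xi>)\<^sup>2))) * (cis (x \<bullet> \<xi>) * fourier \<psi> \<xi>))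
        \<longlonglongrightarrow> complex_of_real (exp (- (0 * (norm \<xi>)\<^sup>2))) * (cis (x \<bullet> \<xi>) * fourier \<psi> \<xi>)"
      by (intro AE_I2 tendsto_intros t0)
    show "AE \<xi> in lborel. norm (complex_of_real (exp (- (t n * (norm \<xi>)\<^sup>2))) * (cis (x \<bullet> \<xi>) * fourier \<psi> \<xi>)) \<le> norm (fourier \<psi> \<xi>)" for n
    proof (rule AE_I2)
      fix \<xi> :: 'a
      have "exp (- (t n * (norm \<xi>)\<^sup>2)) * norm (fourier \<psi> \<xi>) \<le> 1 * norm (fourier \<psi> \<xi>)"
        using t[of n] by (intro mult_right_mono) auto
      then show "norm (complex_of_real (exp (- (t n * (norm \<xi>)\<^sup>2))) * (cis (x \<bullet> \<xi>) * fourier \<psi> \<xi>)) \<le> norm (fourier \<psi> \<xi>)"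
        by (simp add: norm_mult)
    qed
  qed measurable
  have swap: "(\<integral>\<xi>. complex_of_real (exp (- (t n * (norm \<xi>)\<^sup>2))) * (cis (x \<bullet> \<xi>) * fourier \<psi> \<xi>) \<partial>lborel) =
    complex_of_real ((2 * pi) ^ DIM('a)) * (\<integral>y. \<psi> y * complex_of_real (heat_kernel (t n) (x - y)) \<partial>lborel)" for n
  proof -
    let ?e = "\<lambda>\<xi>::'a. complex_of_real (exp (- (t n * (norm \<xi>)\<^sup>2)))"
    have ie: "integrable lborel ?e"
      using integrable_cis_exp_norm_squared[OF t[of n], of "0::'a"] by simp
    have "(\<integral>\<xi>. ?e \<xi> * (cis (x \<bullet> \<xi>) * fourier \<psi> \<xi>) \<partial>lborel) =
      (\<integral>\<xi>. (\<integral>y. ?e \<xi> * (cis (x \<bullet> \<xi>) * (cis (- (y \<bullet> \<xi>)) * \<psi> y)) \<partial>lborel) \<partial>lborel)"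
      unfolding fourier_def by (simp only: integral_mult_right_zero)
    also have "\<dots> = (\<integral>y. (\<integral>\<xi>. ?e \<xi> * (cis (x \<bullet> \<xi>) * (cis (- (y \<bullet> \<xi>)) * \<psi> y)) \<partial>lborel) \<partial>lborel)"
    proof (rule lborel_pair.Fubini_integral[symmetric])
      have "integrable (lborel \<Otimes>\<^sub>M lborel) (\<lambda>(\<xi>, y). ?e \<xi> * \<psi> y)"
      proof (rule lborel_pair.integrable_pairI_nn)
        have "(\<integral>\<^sup>+\<xi>. (\<integral>\<^sup>+y. norm (?e \<xi> * \<psi> y) \<partial>lborel) \<partial>lborel) = (\<integral>\<^sup>+\<xi>. norm (?e \<xi>) \<partial>lborel) * (\<integral>\<^sup>+y. norm (\<psi> y) \<partial>lborel)"
          unfolding norm_mult by (simp add: ennreal_mult nn_integral_cmult nn_integral_multc)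
        also have "\<dots> < \<infinity>"
          using i\<psi> ie unfolding integrable_iff_bounded by (simp add: ennreal_mult_less_top)
        finally show "(\<integral>\<^sup>+\<xi>. (\<integral>\<^sup>+y. norm (?e \<xi> * \<psi> y) \<partial>lborel) \<partial>lborel) < \<infinity>" .
      qed measurable
      then show "integrable (lborel \<Otimes>\<^sub>M lborel) (\<lambda>(\<xi>, y). ?e \<xi> * (cis (x \<bullet> \<xi>) * (cis (- (y \<bullet> \<xi>)) * \<psi> y)))"
        by (rule Bochner_Integration.integrable_bound) (auto simp: norm_mult)
    qed
    also have "\<dots> = (\<integral>y. \<psi> y * (\<integral>\<xi>. cis ((x - y) \<bullet> \<xi>) * ?e \<xi> \<partial>lborel) \<partial>lborel)"
    proof -
      have "?e \<xi> * (cis (x \<bullet> \<xi>) * (cis (- (y \<bullet> \<xi>)) * \<psi> y)) = \<psi> y * (cis ((x - y) \<bullet> \<xi>) * ?e \<xi>)" for y \<xi>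
      proof -
        have "cis ((x - y) \<bullet> \<xi>) = cis (x \<bullet> \<xi>) * cis (- (y \<bullet> \<xi>))" by (simp add: cis_mult inner_diff_left)
        then show ?thesis by (simp only: mult_ac)
      qed
      then show ?thesis by (simp only: integral_mult_right_zero)
    qed
    also have "\<dots> = (\<integral>y. complex_of_real ((2 * pi) ^ DIM('a)) * (\<psi> y * complex_of_real (heat_kernel (t n) (x - y))) \<partial>lborel)"
      unfolding integral_cis_exp_norm_squared[OF t] by (simp only: of_real_mult mult_ac)
    finally show ?thesis by (simp only: integral_mult_right_zero)
  qed
  obtain B where B: "\<And>x. norm (\<psi> x) \<le> B" using test_fun_bounded[OF \<psi>] by metis
  have s: "continuous_on UNIV \<psi>" using \<psi> by (intro smooth_continuous_on) (simp add: test_fun_def)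
  have "(\<lambda>n. complex_of_real ((2 * pi) ^ DIM('a)) * (\<integral>y. \<psi> y * complex_of_real (heat_kernel (t n) (x - y)) \<partial>lborel))
      \<longlonglongrightarrow> complex_of_real ((2 * pi) ^ DIM('a)) * \<psi> x"
    by (rule tendsto_mult_left[OF heat_kernel_approximate_identity[OF s B t t0]])
  then have "(\<integral>\<xi>. complex_of_real (exp (- (0 * (norm \<xi>)\<^sup>2))) * (cis (x \<bullet> \<xi>) * fourier \<psi> \<xi>) \<partial>lborel) = complex_of_real ((2 * pi) ^ DIM('a)) * \<psi> x"
    using LIMSEQ_unique[OF lim1[unfolded swap]] by blast
  then have "inv_fourier (fourier \<psi>) x = complex_of_real ((2 * pi) powr (- real DIM('a)) * (2 * pi) ^ DIM('a)) * \<psi> x"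
    by (simp add: inv_fourier_def)
  also have "(2 * pi) powr (- real DIM('a)) * (2 * pi) ^ DIM('a) = 1"
    by (subst powr_realpow[symmetric], simp, subst powr_add[symmetric]) simp
  finally show "inv_fourier (fourier \<psi>) x = \<psi> x" by simp
qed

section \<open>Fourier multipliers as convolutions\<close>

definition multiplier :: "('a::euclidean_space \<Rightarrow> complex) \<Rightarrow> ('a \<Rightarrow> complex) \<Rightarrow> 'a \<Rightarrow> complex" where
  "multiplier m \<phi> = fourier (\<lambda>\<xi>. m \<xi> * inv_fourier \<phi> \<xi>)"

definition multiplier_kernel :: "('a::euclidean_space \<Rightarrow> complex) \<Rightarrow> 'a \<Rightarrow> complex" where
  "multiplier_kernel m y = complex_of_real ((2 * pi) powr (- real DIM('a))) * fourier m y"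

lemma multiplier_eq_convolution:
  fixes m \<phi> :: "'a::euclidean_space \<Rightarrow> complex"
  assumes m: "integrable lborel m" and \<phi>: "integrable lborel \<phi>"
  shows "multiplier m \<phi> x = (\<integral>y. \<phi> (x - y) * multiplier_kernel m y \<partial>lborel)"
proof -
  define c where "c = complex_of_real ((2 * pi) powr (- real DIM('a)))"
  have [measurable]: "m \<in> borel_measurable borel" "\<phi> \<in> borel_measurable borel"
    using borel_measurable_integrable[OF m] borel_measurable_integrable[OF \<phi>] by simp_all
  have "multiplier m \<phi> x = (\<integral>\<xi>. (\<integral>y. cis (- (\<xi> \<bullet> x)) * (m \<xi> * (c * (cis (\<xi> \<bullet> y) * \<phi> y))) \<partial>lborel) \<partial>lborel)"
    unfolding multiplier_def fourier_def inv_fourier_def c_def by (simp only: integral_mult_right_zero)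
  also have "\<dots> = (\<integral>y. (\<integral>\<xi>. cis (- (\<xi> \<bullet> x)) * (m \<xi> * (c * (cis (\<xi> \<bullet> y) * \<phi> y))) \<partial>lborel) \<partial>lborel)"
  proof (rule lborel_pair.Fubini_integral[symmetric])
    have "integrable (lborel \<Otimes>\<^sub>M lborel) (\<lambda>(\<xi>, y). c * (m \<xi> * \<phi> y))"
    proof (rule lborel_pair.integrable_pairI_nn)
      have "(\<integral>\<^sup>+\<xi>. (\<integral>\<^sup>+y. norm (c * (m \<xi> * \<phi> y)) \<partial>lborel) \<partial>lborel) =
          ennreal (norm c) * ((\<integral>\<^sup>+\<xi>. norm (m \<xi>) \<partial>lborel) * (\<integral>\<^sup>+y. norm (\<phi> y) \<partial>lborel))"
        unfolding norm_mult by (simp add: ennreal_mult nn_integral_cmult nn_integral_multc)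
      also have "\<dots> < \<infinity>"
        using m \<phi> unfolding integrable_iff_bounded by (simp add: ennreal_mult_less_top)
      finally show "(\<integral>\<^sup>+\<xi>. (\<integral>\<^sup>+y. norm (c * (m \<xi> * \<phi> y)) \<partial>lborel) \<partial>lborel) < \<infinity>" .
    qed measurable
    then show "integrable (lborel \<Otimes>\<^sub>M lborel) (\<lambda>(\<xi>, y). cis (- (\<xi> \<bullet> x)) * (m \<xi> * (c * (cis (\<xi> \<bullet> y) * \<phi> y))))"
      by (rule Bochner_Integration.integrable_bound) (auto simp: norm_mult)
  qed
  also have "\<dots> = (\<integral>y. \<phi> y * multiplier_kernel m (x - y) \<partial>lborel)"
  proof -
    have "cis (- (\<xi> \<bullet> x)) * (m \<xi> * (c * (cis (\<xi> \<bullet> y) * \<phi> y))) = \<phi> y * (c * (cis (- (\<xi> \<bullet> (x - y))) * m \<xi>))" for y \<xi>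
    proof -
      have "cis (- (\<xi> \<bullet> (x - y))) = cis (- (\<xi> \<bullet> x)) * cis (\<xi> \<bullet> y)"
        by (simp add: cis_mult inner_diff_right)
      then show ?thesis by (simp only: mult_ac)
    qed
    then show ?thesis
      unfolding multiplier_kernel_def fourier_def c_def[symmetric] by (simp only: integral_mult_right_zero)
  qed
  also have "\<dots> = (\<integral>y. \<phi> (x - y) * multiplier_kernel m y \<partial>lborel)"
    using lborel_integral_reflect[of "\<lambda>y. \<phi> y * multiplier_kernel m (x - y)" x] by simp
  finally show ?thesis .
qed

text \<open>Translation appears as a modulation between the two transforms; the identity is a change of variables in integrals that need
not converge.\<close>

lemma multiplier_translate:
  fixes m \<phi> :: "'a::euclidean_space \<Rightarrow> complex"
  shows "multiplier m (\<lambda>x. \<phi> (x - z)) = (\<lambda>x. multiplier m \<phi> (x - z))"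
proof
  fix x
  have "inv_fourier (\<lambda>x. \<phi> (x - z)) \<xi> = cis (z \<bullet> \<xi>) * inv_fourier \<phi> \<xi>" for \<xi>
    unfolding inv_fourier_eq using fourier_shift[of \<phi> "- z" "- \<xi>"] by simp
  moreover have "cis (- (\<xi> \<bullet> x)) * (m \<xi> * (cis (z \<bullet> \<xi>) * w)) = cis (- (\<xi> \<bullet> (x - z))) * (m \<xi> * w)" for \<xi> w
  proof -
    have "cis (- (\<xi> \<bullet> (x - z))) = cis (- (\<xi> \<bullet> x)) * cis (z \<bullet> \<xi>)"
      by (simp add: cis_mult inner_diff_right inner_commute)
    then show ?thesis by (simp only: mult_ac)
  qed
  ultimately show "multiplier m (\<lambda>x. \<phi> (x - z)) x = multiplier m \<phi> (x - z)"
    unfolding multiplier_def fourier_def by (simp only:)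
qed

lemma multiplier_test_fun:
  assumes "test_fun m" "\<phi> \<in> schwartz"
  shows "test_fun (\<lambda>\<xi>. m \<xi> * inv_fourier \<phi> \<xi>)"
  using test_fun_mult[OF smooth_inv_fourier[OF schwartz_rapidly_decaying[OF assms(2)]] assms(1)]
  by (simp add: mult.commute)

lemma multiplier_schwartz: "test_fun m \<Longrightarrow> \<phi> \<in> schwartz \<Longrightarrow> multiplier m \<phi> \<in> schwartz"
  unfolding multiplier_def by (intro fourier_test_fun_schwartz multiplier_test_fun)

text \<open>Symbols multiply because \<open>m\<close> times the inverse transform is smooth with compact support, so that Fourier inversion applies
to it.\<close>

lemma multiplier_multiplier:
  assumes "test_fun m" "\<phi> \<in> schwartz"
  shows "multiplier m' (multiplier m \<phi>) = multiplier (\<lambda>\<xi>. m' \<xi> * m \<xi>) \<phi>"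
  unfolding multiplier_def fourier_inversion[OF multiplier_test_fun[OF assms]] by (simp add: mult.assoc)

lemma test_fun_cmult: "test_fun \<psi> \<Longrightarrow> test_fun (\<lambda>x. c * \<psi> x)"
  by (auto simp: test_fun_def intro: smooth_cmult)

lemma multiplier_kernel_schwartz:
  assumes "test_fun (m :: 'a::euclidean_space \<Rightarrow> complex)"
  shows "multiplier_kernel m \<in> schwartz"
proof -
  have "multiplier_kernel m = fourier (\<lambda>\<xi>. complex_of_real ((2 * pi) powr (- real DIM('a))) * m \<xi>)"
    unfolding multiplier_kernel_def fourier_def
    by (intro ext) (simp only: integral_mult_right_zero[symmetric] mult.left_commute)
  then show ?thesis by (simp only: fourier_test_fun_schwartz test_fun_cmult assms)
qed

lemma multiplier_kernel_integral:
  assumes "test_fun (m :: 'a::euclidean_space \<Rightarrow> complex)"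
  shows "(\<integral>y. multiplier_kernel m y \<partial>lborel) = m 0"
  using fun_cong[OF fourier_inversion[OF assms], of 0]
  by (simp add: multiplier_kernel_def inv_fourier_def)

lemma multiplier_kernel_scale:
  assumes "0 < r"
  shows "multiplier_kernel (\<lambda>\<xi>. m (\<xi> /\<^sub>R r)) (y::'a::euclidean_space) = complex_of_real (r ^ DIM('a)) * multiplier_kernel m (r *\<^sub>R y)"
proof -
  have "fourier (\<lambda>\<xi>. m (\<xi> /\<^sub>R r)) y = \<bar>r\<bar> ^ DIM('a) *\<^sub>R (\<integral>\<xi>. cis (- ((0 + r *\<^sub>R \<xi>) \<bullet> y)) * m ((0 + r *\<^sub>R \<xi>) /\<^sub>R r) \<partial>lborel)"
    unfolding fourier_def using assms by (intro lborel_integral_affine) simp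
  also have "(\<integral>\<xi>. cis (- ((0 + r *\<^sub>R \<xi>) \<bullet> y)) * m ((0 + r *\<^sub>R \<xi>) /\<^sub>R r) \<partial>lborel) = fourier m (r *\<^sub>R y)"
    unfolding fourier_def using assms by simp
  finally show ?thesis
    using assms by (simp add: multiplier_kernel_def scaleR_conv_of_real)
qed

lemma schwartz_first_moment:
  fixes \<phi> :: "'a::euclidean_space \<Rightarrow> complex"
  assumes "\<phi> \<in> schwartz"
  shows "integrable lborel (\<lambda>y. norm y * norm (\<phi> y))"
proof -
  have *: "integrable lborel (\<lambda>y. (1 + norm y) ^ 1 * norm (\<phi> y))"
    using schwartz_rapidly_decaying[OF assms] unfolding rapidly_decaying_def by blast
  have [measurable]: "\<phi> \<in> borel_measurable borel" by (rule schwartz_measurable[OF assms])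
  show ?thesis
    by (rule Bochner_Integration.integrable_bound[OF *]) (auto intro!: AE_I2 mult_right_mono)
qed

lemma dir_derivs_translate:
  assumes "smooth \<phi>"
  shows "dir_derivs vs (\<lambda>x. \<phi> (x - z)) = (\<lambda>x. dir_derivs vs \<phi> (x - z))"
proof (induction vs)
  case (Cons v vs)
  have "((\<lambda>x. dir_derivs vs \<phi> (x - z)) has_derivative frechet_derivative (dir_derivs vs \<phi>) (at (x - z))) (at x)" for x
    using has_derivative_affine_compose[OF smooth_dir_derivs[OF assms], of "\<lambda>w. w" vs 1 "- z" x]
    by (simp add: bounded_linear_ident)
  then show ?case
    using frechet_derivativeI by (fastforce simp: Cons)
qed simp

text \<open>The weight at \<open>x\<close> is at most the weight at \<open>z\<close> times the weight at \<open>x - z\<close>.\<close>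

lemma schwartz_translate:
  fixes \<phi> :: "'a::euclidean_space \<Rightarrow> complex"
  assumes \<phi>: "\<phi> \<in> schwartz"
  shows "(\<lambda>x. \<phi> (x - z)) \<in> schwartz"
  unfolding schwartz_def
proof (intro CollectI conjI allI impI)
  show "smooth (\<lambda>x. \<phi> (x - z))"
    using smooth_affine_compose[OF schwartz_smooth[OF \<phi>], of "\<lambda>w. w" 1 "- z"]
    by (simp add: bounded_linear_ident)
  fix vs :: "'a list" and k assume vs: "set vs \<subseteq> Basis"
  obtain C where C: "\<And>x. (1 + norm x) ^ k * norm (dir_derivs vs \<phi> x) \<le> C"
    using schwartz_weighted_bounded[OF \<phi> vs] by meson
  show "bdd_above (range (\<lambda>x. (1 + norm x) ^ k * norm (dir_derivs vs (\<lambda>x. \<phi> (x - z)) x)))"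
  proof (intro bdd_aboveI2)
    fix x
    have "norm x \<le> norm (x - z) + norm z" using norm_triangle_ineq[of "x - z" z] by simp
    moreover have "(1 + norm z) * (1 + norm (x - z)) = 1 + norm (x - z) + norm z + norm z * norm (x - z)"
      by (simp add: algebra_simps)
    moreover have "0 \<le> norm z * norm (x - z)" by simp
    ultimately have "1 + norm x \<le> (1 + norm z) * (1 + norm (x - z))" by linarith
    then have "(1 + norm x) ^ k \<le> (1 + norm z) ^ k * (1 + norm (x - z)) ^ k"
      unfolding power_mult_distrib[symmetric] by (intro power_mono) auto
    then have "(1 + norm x) ^ k * norm (dir_derivs vs (\<lambda>x. \<phi> (x - z)) x) \<le>
      ((1 + norm z) ^ k * (1 + norm (x - z)) ^ k) * norm (dir_derivs vs \<phi> (x - z))"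
      unfolding dir_derivs_translate[OF schwartz_smooth[OF \<phi>]] by (intro mult_right_mono) auto
    also have "\<dots> \<le> (1 + norm z) ^ k * C"
      unfolding mult.assoc by (intro mult_left_mono C) auto
    finally show "(1 + norm x) ^ k * norm (dir_derivs vs (\<lambda>x. \<phi> (x - z)) x) \<le> (1 + norm z) ^ k * C" .
  qed
qed

lemma smooth_const: "smooth (\<lambda>_. c)"
  using smooth_const_add_linear[OF bounded_linear_zero, of c] by simp

lemma smooth_diff:
  fixes f g :: "'a::real_normed_vector \<Rightarrow> 'b::real_normed_algebra_1"
  assumes "smooth f" "smooth g"
  shows "smooth (\<lambda>x. f x - g x)"
proof (rule smooth_coinduct[where S=product_sums])
  have "(\<lambda>x. f x * 1 + g x * (- 1)) \<in> product_sums"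
    by (intro product_sums.intros assms smooth_const)
  then show "(\<lambda>x. f x - g x) \<in> product_sums" by simp
qed (auto intro: product_sums_differentiable product_sums_derivative)

lemma test_fun_diff:
  assumes "test_fun f" "test_fun g"
  shows "test_fun (\<lambda>x. f x - g x)"
proof -
  obtain R S where "\<And>x. R < norm x \<Longrightarrow> f x = 0" "\<And>x. S < norm x \<Longrightarrow> g x = 0"
    using assms by (auto simp: test_fun_def)
  then have "f x - g x = 0" if "max R S < norm x" for x using that by simp
  then show ?thesis
    using assms smooth_diff[of f g] unfolding test_fun_def by blast
qed

lemma lp_cutoff_test_fun:
  fixes \<theta> :: "'a::euclidean_space \<Rightarrow> real"
  assumes \<theta>: "lp_cutoff \<theta>" and r: "0 < r"
  shows "test_fun (\<lambda>\<xi>. complex_of_real (\<theta> (\<xi> /\<^sub>R r)))"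
  unfolding test_fun_def
proof (intro conjI exI allI impI)
  show "smooth (\<lambda>\<xi>. complex_of_real (\<theta> (\<xi> /\<^sub>R r)))"
    using smooth_affine_compose[of \<theta> complex_of_real "inverse r" 0] \<theta>
    by (simp add: lp_cutoff_def bounded_linear_of_real)
  fix \<xi> :: 'a assume "r < norm \<xi>"
  then have "1 \<le> norm (\<xi> /\<^sub>R r)" using r by (simp add: divide_simps)
  then show "complex_of_real (\<theta> (\<xi> /\<^sub>R r)) = 0" using \<theta> by (simp add: lp_cutoff_def)
qed

section \<open>Luxemburg norms and convolution of distributions\<close>

text \<open>The condition that the Luxemburg norm is at most \<open>\<kappa>\<close>, up to the boundary case. Working with this condition lets
N-functions and \<open>A = \<infinity>\<close> share all statements from here on.\<close>

fun modular_ball :: "orlicz \<Rightarrow> real \<Rightarrow> ('a::euclidean_space \<Rightarrow> complex) \<Rightarrow> bool" where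
  "modular_ball (NFun A) \<kappa> f \<longleftrightarrow> (\<integral>\<^sup>+x. ennreal (A (norm (f x) / \<kappa>)) \<partial>lborel) \<le> 1"
| "modular_ball Infty \<kappa> f \<longleftrightarrow> (AE x in lborel. norm (f x) \<le> \<kappa>)"

text \<open>The tangent line inequality carries all further uses of N-functions: monotonicity, Jensen's inequality and a linear lower
bound follow from it.\<close>

lemma N_function_subgradient:
  assumes "is_N_function A"
  obtains \<alpha> where "\<And>s. 0 \<le> s \<Longrightarrow> 0 \<le> \<alpha> s" "\<And>s. 0 < s \<Longrightarrow> 0 < \<alpha> s"
    "\<And>s t. 0 \<le> s \<Longrightarrow> 0 \<le> t \<Longrightarrow> A s + \<alpha> s * (t - s) \<le> A t" "A 0 = 0"
proof -
  obtain \<alpha> :: "real \<Rightarrow> real" where nn: "\<And>s. 0 \<le> s \<Longrightarrow> 0 \<le> \<alpha> s" and mono: "mono_on {0..} \<alpha>"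
    and pos: "\<And>s. 0 < s \<Longrightarrow> 0 < \<alpha> s" and A: "\<And>t. 0 \<le> t \<Longrightarrow> A t = integral {0..t} \<alpha>"
    using assms unfolding is_N_function_def by blast
  have int: "\<alpha> integrable_on {s..t}" if "0 \<le> s" for s t
    using mono that by (intro integrable_on_mono_on) (auto simp: mono_on_def)
  have split: "A t = A s + integral {s..t} \<alpha>" if "0 \<le> s" "s \<le> t" for s t
    using Henstock_Kurzweil_Integration.integral_combine[OF that int[OF order_refl]] that A by simp
  have "A s + \<alpha> s * (t - s) \<le> A t" if s: "0 \<le> s" and t: "0 \<le> t" for s t
  proof (cases "s \<le> t")
    case True
    have "integral {s..t} (\<lambda>_. \<alpha> s) \<le> integral {s..t} \<alpha>"
      using s mono by (intro integral_le int) (auto simp: mono_on_def)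
    then show ?thesis using split[OF s True] True by (simp add: mult.commute)
  next
    case False
    have "integral {t..s} \<alpha> \<le> integral {t..s} (\<lambda>_. \<alpha> s)"
      using t mono by (intro integral_le int) (auto simp: mono_on_def)
    then show ?thesis using split[OF t, of s] False by (simp add: algebra_simps)
  qed
  moreover have "A 0 = 0" using A[of 0] by simp
  ultimately show thesis using that nn pos by blast
qed

lemma N_function_mono:
  assumes "is_N_function A" "0 \<le> s" "s \<le> t"
  shows "A s \<le> A t"
proof -
  obtain \<alpha> where "\<And>s. 0 \<le> s \<Longrightarrow> 0 \<le> \<alpha> s" and "\<And>s t. 0 \<le> s \<Longrightarrow> 0 \<le> t \<Longrightarrow> A s + \<alpha> s * (t - s) \<le> A t"
    using N_function_subgradient[OF assms(1)] by metis
  then have "A s + \<alpha> s * (t - s) \<le> A t" "0 \<le> \<alpha> s * (t - s)" using assms by auto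
  then show ?thesis by linarith
qed

lemma N_function_zero: "is_N_function A \<Longrightarrow> A 0 = 0"
  using N_function_subgradient by metis

lemma N_function_nonneg: "is_N_function A \<Longrightarrow> 0 \<le> s \<Longrightarrow> 0 \<le> A s"
  using N_function_mono[of A 0 s] N_function_zero[of A] by simp

lemma N_function_measurable:
  assumes A: "is_N_function A" and [measurable]: "f \<in> borel_measurable M" and f: "\<And>x. 0 \<le> f x"
  shows "(\<lambda>x. A (f x)) \<in> borel_measurable M"
proof -
  have "mono (\<lambda>t. A (max 0 t))"
    by (intro monoI N_function_mono[OF A]) auto
  then have [measurable]: "(\<lambda>t. A (max 0 t)) \<in> borel_measurable borel" by (rule borel_measurable_mono)
  have "(\<lambda>x. A (max 0 (f x))) \<in> borel_measurable M" by measurable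
  then show ?thesis using f by (simp add: max_absorb2)
qed

lemma modular_ball_mono:
  assumes "valid_orlicz A" "modular_ball A \<kappa> f" "0 < \<kappa>" "\<kappa> \<le> \<kappa>'"
  shows "modular_ball A \<kappa>' f"
proof (cases A)
  case (NFun B)
  have "(\<integral>\<^sup>+x. ennreal (B (norm (f x) / \<kappa>')) \<partial>lborel) \<le> (\<integral>\<^sup>+x. ennreal (B (norm (f x) / \<kappa>)) \<partial>lborel)"
    using assms NFun by (intro nn_integral_mono ennreal_leI N_function_mono[of B]) (auto intro!: divide_left_mono)
  then show ?thesis using assms NFun by simp
qed (use assms in auto)

lemma luxemburg_norm_le:
  assumes "modular_ball A \<kappa> f" "0 < \<kappa>" "f \<in> borel_measurable borel"
  shows "luxemburg_norm A f \<le> ennreal \<kappa>"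
proof (cases A)
  case (NFun B)
  then show ?thesis using assms by (auto intro!: Inf_lower)
next
  case Infty
  have [measurable]: "f \<in> borel_measurable borel" by fact
  show ?thesis using assms Infty by (auto intro!: esssup_I ennreal_leI elim!: eventually_mono)
qed

lemma luxemburg_norm_less:
  assumes A: "valid_orlicz A" and less: "luxemburg_norm A f < ennreal \<kappa>" and [measurable]: "f \<in> borel_measurable borel"
  shows "0 < \<kappa> \<and> modular_ball A \<kappa> f"
proof
  show \<kappa>: "0 < \<kappa>" using less by (metis ennreal_neg not_le not_less_zero)
  show "modular_ball A \<kappa> f"
  proof (cases A)
    case (NFun B)
    then obtain \<kappa>' where "0 < \<kappa>'" "modular_ball A \<kappa>' f" "ennreal \<kappa>' < ennreal \<kappa>"
      using less by (auto simp: Inf_less_iff)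
    then show ?thesis using modular_ball_mono[OF A, of \<kappa>' f \<kappa>] by (simp add: ennreal_less_iff)
  next
    case Infty
    have "AE x in lborel. ennreal (norm (f x)) \<le> esssup lborel (\<lambda>x. ennreal (norm (f x)))"
      by (rule esssup_AE)
    then have "AE x in lborel. norm (f x) \<le> \<kappa>"
    proof eventually_elim
      case (elim x)
      then have "ennreal (norm (f x)) < ennreal \<kappa>" using less Infty by (auto intro: le_less_trans)
      then show ?case by (simp add: ennreal_less_iff)
    qed
    then show ?thesis using Infty by simp
  qed
qed

text \<open>Convexity with weights \<open>\<kappa> / (\<kappa> + \<mu>)\<close> and \<open>\<mu> / (\<kappa> + \<mu>)\<close>, expressed by the tangent line at the weighted mean \<open>s\<close>.\<close>

lemma modular_ball_add:
  assumes A: "valid_orlicz A" and f: "modular_ball A \<kappa> f" "0 < \<kappa>" and g: "modular_ball A \<mu> g" "0 < \<mu>"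
    and [measurable]: "f \<in> borel_measurable borel" "g \<in> borel_measurable borel"
  shows "modular_ball A (\<kappa> + \<mu>) (\<lambda>x. f x + g x)"
proof (cases A)
  case (NFun B)
  then have B: "is_N_function B" using A by simp
  obtain \<alpha> where \<alpha>: "\<And>s. 0 \<le> s \<Longrightarrow> 0 \<le> \<alpha> s" "\<And>s t. 0 \<le> s \<Longrightarrow> 0 \<le> t \<Longrightarrow> B s + \<alpha> s * (t - s) \<le> B t"
    using N_function_subgradient[OF B] by metis
  have m1: "(\<lambda>x. B (norm (f x) / \<kappa>)) \<in> borel_measurable borel"
    using f by (intro N_function_measurable[OF B]) auto
  have m2: "(\<lambda>x. B (norm (g x) / \<mu>)) \<in> borel_measurable borel"
    using g by (intro N_function_measurable[OF B]) auto
  note [measurable] = m1 m2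
  have "B (norm (f x + g x) / (\<kappa> + \<mu>)) \<le> \<kappa> / (\<kappa> + \<mu>) * B (norm (f x) / \<kappa>) + \<mu> / (\<kappa> + \<mu>) * B (norm (g x) / \<mu>)" for x
  proof -
    define a where "a = norm (f x) / \<kappa>"
    define b where "b = norm (g x) / \<mu>"
    define s where "s = (norm (f x) + norm (g x)) / (\<kappa> + \<mu>)"
    have nn: "0 \<le> a" "0 \<le> b" "0 \<le> s" using f g by (auto simp: a_def b_def s_def)
    have "B (norm (f x + g x) / (\<kappa> + \<mu>)) \<le> B s"
      unfolding s_def using f g norm_triangle_ineq[of "f x" "g x"]
      by (intro N_function_mono[OF B]) (auto intro!: divide_right_mono)
    also have "\<dots> = \<kappa> / (\<kappa> + \<mu>) * (B s + \<alpha> s * (a - s)) + \<mu> / (\<kappa> + \<mu>) * (B s + \<alpha> s * (b - s))"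
    proof -
      have "\<kappa> * (a - s) + \<mu> * (b - s) = 0"
      proof -
        have "\<kappa> * a = norm (f x)" "\<mu> * b = norm (g x)" using f g by (auto simp: a_def b_def)
        moreover have "(\<kappa> + \<mu>) * s = norm (f x) + norm (g x)" using f g by (simp add: s_def)
        ultimately show ?thesis by (simp add: algebra_simps)
      qed
      then have "(\<kappa> * (a - s) + \<mu> * (b - s)) / (\<kappa> + \<mu>) = 0" by simp
      then have "\<kappa> / (\<kappa> + \<mu>) * (a - s) + \<mu> / (\<kappa> + \<mu>) * (b - s) = 0"
        by (simp add: add_divide_distrib)
      moreover have "\<kappa> / (\<kappa> + \<mu>) + \<mu> / (\<kappa> + \<mu>) = 1"
        using f g by (simp add: add_divide_distrib[symmetric])
      ultimately show ?thesis by algebra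
    qed
    also have "\<dots> \<le> \<kappa> / (\<kappa> + \<mu>) * B a + \<mu> / (\<kappa> + \<mu>) * B b"
      using f g nn by (intro add_mono mult_left_mono \<alpha>) auto
    finally show ?thesis by (simp add: a_def b_def)
  qed
  then have "(\<integral>\<^sup>+x. ennreal (B (norm (f x + g x) / (\<kappa> + \<mu>))) \<partial>lborel) \<le>
      (\<integral>\<^sup>+x. ennreal (\<kappa> / (\<kappa> + \<mu>)) * ennreal (B (norm (f x) / \<kappa>)) + ennreal (\<mu> / (\<kappa> + \<mu>)) * ennreal (B (norm (g x) / \<mu>)) \<partial>lborel)"
    using f g by (intro nn_integral_mono)
      (auto simp: ennreal_mult'[symmetric] ennreal_plus[symmetric] N_function_nonneg[OF B] simp del: ennreal_plus intro!: ennreal_leI)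
  also have "\<dots> = ennreal (\<kappa> / (\<kappa> + \<mu>)) * (\<integral>\<^sup>+x. ennreal (B (norm (f x) / \<kappa>)) \<partial>lborel) + ennreal (\<mu> / (\<kappa> + \<mu>)) * (\<integral>\<^sup>+x. ennreal (B (norm (g x) / \<mu>)) \<partial>lborel)"
    by (simp add: nn_integral_add nn_integral_cmult)
  also have "\<dots> \<le> ennreal (\<kappa> / (\<kappa> + \<mu>)) * 1 + ennreal (\<mu> / (\<kappa> + \<mu>)) * 1"
    using f g NFun by (intro add_mono mult_left_mono) auto
  also have "\<dots> = ennreal (\<kappa> / (\<kappa> + \<mu>) + \<mu> / (\<kappa> + \<mu>))" using f g by (simp add: ennreal_plus[symmetric] del: ennreal_plus)
  also have "\<kappa> / (\<kappa> + \<mu>) + \<mu> / (\<kappa> + \<mu>) = 1" using f g by (simp add: add_divide_distrib[symmetric])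
  finally show ?thesis using NFun by simp
next
  case Infty
  have "AE x in lborel. norm (f x) \<le> \<kappa>" "AE x in lborel. norm (g x) \<le> \<mu>" using f g Infty by auto
  then have "AE x in lborel. norm (f x + g x) \<le> \<kappa> + \<mu>"
  proof eventually_elim
    case (elim x)
    then show ?case using norm_triangle_ineq[of "f x" "g x"] by linarith
  qed
  then show ?thesis using Infty by simp
qed

lemma modular_ball_cmult:
  assumes "c \<noteq> 0" "modular_ball A \<kappa> f"
  shows "modular_ball A (norm c * \<kappa>) (\<lambda>x. c * f x)"
  using assms by (cases A) (auto simp: norm_mult)

lemma AE_lborel_shift:
  fixes x :: "'a::euclidean_space"
  assumes "AE y in lborel. P y"
  shows "AE y in lborel. P (x + y)"
proof -
  have m: "(+) x \<in> lborel \<rightarrow>\<^sub>M borel" by simp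
  have "AE y in distr lborel borel ((+) x). P y"
    using assms by (subst lborel_distr_plus)
  then show ?thesis using AE_distrD[OF m] by auto
qed

text \<open>Jensen's inequality for the probability density \<open>|M| / m\<close>, followed by integration in \<open>x\<close>, where translation
invariance makes the inner integral independent of \<open>y\<close>. If the integral at \<open>x\<close> diverges, its value is zero by convention
and there is nothing to prove.\<close>

lemma modular_ball_convolution:
  fixes g :: "'a::euclidean_space \<Rightarrow> complex"
  assumes A: "valid_orlicz A" and g: "modular_ball A \<kappa> g" "0 < \<kappa>" and M: "integrable lborel M"
    and \<kappa>': "\<kappa> * (\<integral>y. norm (M y) \<partial>lborel) \<le> \<kappa>'" "0 < \<kappa>'"
    and gm [measurable]: "g \<in> borel_measurable borel"
  shows "modular_ball A \<kappa>' (\<lambda>x. \<integral>y. g (x + y) * M y \<partial>lborel)"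
proof -
  have [measurable]: "M \<in> borel_measurable borel" using borel_measurable_integrable[OF M] by simp
  define m where "m = (\<integral>y. norm (M y) \<partial>lborel)"
  have m0: "0 \<le> m" by (simp add: m_def)
  have em: "(\<integral>\<^sup>+y. ennreal (norm (M y)) \<partial>lborel) = ennreal m"
    unfolding m_def using M by (intro nn_integral_eq_integral integrable_norm) auto
  let ?G = "\<lambda>x. \<integral>y. g (x + y) * M y \<partial>lborel"
  show ?thesis
  proof (cases A)
    case (NFun B)
    then have B: "is_N_function B" using A by simp
    have mB [measurable]: "(\<lambda>x. B (norm (g x) / \<kappa>)) \<in> borel_measurable borel"
      using g by (intro N_function_measurable[OF B]) auto
    show ?thesis
    proof (cases "m = 0")
      case True
      then have "AE y in lborel. norm (M y) = 0"
        using integral_nonneg_eq_0_iff_AE[OF integrable_norm[OF M]] by (simp add: m_def)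
      then have "?G x = 0" for x
        by (intro integral_eq_zero_AE) (auto elim!: eventually_mono)
      then show ?thesis using NFun N_function_zero[OF B] by simp
    next
      case False
      then have m: "0 < m" using m0 by simp
      obtain \<alpha> where \<alpha>: "\<And>s. 0 \<le> s \<Longrightarrow> 0 \<le> \<alpha> s" "\<And>s t. 0 \<le> s \<Longrightarrow> 0 \<le> t \<Longrightarrow> B s + \<alpha> s * (t - s) \<le> B t"
        using N_function_subgradient[OF B] by metis
      have jensen: "ennreal m * ennreal (B (norm (?G x) / \<kappa>')) \<le> (\<integral>\<^sup>+y. ennreal (B (norm (g (x + y)) / \<kappa>) * norm (M y)) \<partial>lborel)" for x
      proof (cases "integrable lborel (\<lambda>y. g (x + y) * M y)")
        case False
        then show ?thesis by (simp add: not_integrable_integral_eq N_function_zero[OF B])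
      next
        case True
        define t where "t = norm (?G x) / \<kappa>'"
        define I where "I = (\<integral>y. norm (g (x + y) * M y) \<partial>lborel)"
        have t0: "0 \<le> t" using \<kappa>' by (simp add: t_def)
        \<comment> \<open>The tangent line of \<open>B\<close> at \<open>t\<close>, evaluated at \<open>|g(x + y)| / \<kappa>\<close>, times the density.\<close>
        define r where "r = (\<lambda>y. B t * norm (M y) + \<alpha> t * (norm (g (x + y) * M y) / \<kappa> - t * norm (M y)))"
        have ir: "integrable lborel r"
          unfolding r_def using M True
          by (intro Bochner_Integration.integrable_add Bochner_Integration.integrable_diff integrable_mult_right integrable_divide_zero integrable_norm) auto
        have "t * m \<le> norm (?G x) / \<kappa>"
        proof -
          have "norm (?G x) * (\<kappa> * m) \<le> norm (?G x) * \<kappa>'" using \<kappa>' by (intro mult_left_mono) (auto simp: m_def)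
          then show ?thesis using g \<kappa>' by (simp add: t_def field_simps)
        qed
        also have "\<dots> \<le> I / \<kappa>" unfolding I_def using g by (intro divide_right_mono integral_norm_bound) auto
        finally have "0 \<le> \<alpha> t * (I / \<kappa> - t * m)" using \<alpha>(1)[OF t0] by simp
        moreover have "(\<integral>y. r y \<partial>lborel) = B t * m + \<alpha> t * (I / \<kappa> - t * m)"
          unfolding r_def I_def m_def using M True
          by (simp add: integrable_norm)
        ultimately have "B t * m \<le> (\<integral>y. r y \<partial>lborel)" by simp
        also have "\<dots> \<le> (\<integral>y. max 0 (r y) \<partial>lborel)"
          using ir by (intro integral_mono integrable_max) auto
        finally have "ennreal (m * B t) \<le> ennreal (\<integral>y. max 0 (r y) \<partial>lborel)" by (intro ennreal_leI) (simp add: mult.commute)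
        also have "\<dots> = (\<integral>\<^sup>+y. ennreal (max 0 (r y)) \<partial>lborel)"
          using ir by (intro nn_integral_eq_integral[symmetric] integrable_max) auto
        also have "\<dots> \<le> (\<integral>\<^sup>+y. ennreal (B (norm (g (x + y)) / \<kappa>) * norm (M y)) \<partial>lborel)"
        proof (intro nn_integral_mono ennreal_leI)
          fix y
          have "(B t + \<alpha> t * (norm (g (x + y)) / \<kappa> - t)) * norm (M y) \<le> B (norm (g (x + y)) / \<kappa>) * norm (M y)"
            using \<alpha>(2)[OF t0, of "norm (g (x + y)) / \<kappa>"] g by (intro mult_right_mono) auto
          moreover have "r y = (B t + \<alpha> t * (norm (g (x + y)) / \<kappa> - t)) * norm (M y)"
            by (simp add: r_def norm_mult algebra_simps)
          moreover have "0 \<le> B (norm (g (x + y)) / \<kappa>) * norm (M y)"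
            using g by (intro mult_nonneg_nonneg N_function_nonneg[OF B]) auto
          ultimately show "max 0 (r y) \<le> B (norm (g (x + y)) / \<kappa>) * norm (M y)" by simp
        qed
        finally show ?thesis using m0 by (simp add: t_def ennreal_mult')
      qed
      have mG: "?G \<in> borel_measurable borel" by measurable
      have [measurable]: "(\<lambda>x. B (norm (?G x) / \<kappa>')) \<in> borel_measurable borel"
        using \<kappa>' mG by (intro N_function_measurable[OF B]) auto
      have "ennreal m * (\<integral>\<^sup>+x. ennreal (B (norm (?G x) / \<kappa>')) \<partial>lborel) = (\<integral>\<^sup>+x. ennreal m * ennreal (B (norm (?G x) / \<kappa>')) \<partial>lborel)"
        by (intro nn_integral_cmult[symmetric]) simp
      also have "\<dots> \<le> (\<integral>\<^sup>+x. (\<integral>\<^sup>+y. ennreal (B (norm (g (x + y)) / \<kappa>) * norm (M y)) \<partial>lborel) \<partial>lborel)"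
        by (intro nn_integral_mono jensen)
      also have "\<dots> = (\<integral>\<^sup>+y. (\<integral>\<^sup>+x. ennreal (B (norm (g (x + y)) / \<kappa>) * norm (M y)) \<partial>lborel) \<partial>lborel)"
        by (rule lborel_pair.Fubini') measurable
      also have "\<dots> = (\<integral>\<^sup>+y. ennreal (norm (M y)) * (\<integral>\<^sup>+x. ennreal (B (norm (g x) / \<kappa>)) \<partial>lborel) \<partial>lborel)"
      proof (intro nn_integral_cong)
        fix y
        have "(\<integral>\<^sup>+x. ennreal (B (norm (g (x + y)) / \<kappa>) * norm (M y)) \<partial>lborel) = (\<integral>\<^sup>+x. ennreal (norm (M y)) * ennreal (B (norm (g (x + y)) / \<kappa>)) \<partial>lborel)"
          using g by (intro nn_integral_cong) (simp add: ennreal_mult'[symmetric] mult.commute)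
        also have "\<dots> = ennreal (norm (M y)) * (\<integral>\<^sup>+x. ennreal (B (norm (g (x + y)) / \<kappa>)) \<partial>lborel)"
          by (intro nn_integral_cmult) simp
        also have "(\<integral>\<^sup>+x. ennreal (B (norm (g (x + y)) / \<kappa>)) \<partial>lborel) = (\<integral>\<^sup>+x. ennreal (B (norm (g x) / \<kappa>)) \<partial>lborel)"
          by (rule nn_integral_lborel_shift[of "\<lambda>x. ennreal (B (norm (g x) / \<kappa>))"]) simp
        finally show "(\<integral>\<^sup>+x. ennreal (B (norm (g (x + y)) / \<kappa>) * norm (M y)) \<partial>lborel) = ennreal (norm (M y)) * (\<integral>\<^sup>+x. ennreal (B (norm (g x) / \<kappa>)) \<partial>lborel)" .
      qed
      also have "\<dots> \<le> (\<integral>\<^sup>+y. ennreal (norm (M y)) * 1 \<partial>lborel)"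
        using g NFun by (intro nn_integral_mono mult_left_mono) auto
      also have "\<dots> = ennreal m" using em by simp
      finally have "ennreal m * (\<integral>\<^sup>+x. ennreal (B (norm (?G x) / \<kappa>')) \<partial>lborel) \<le> ennreal m * 1" by simp
      then have "(\<integral>\<^sup>+x. ennreal (B (norm (?G x) / \<kappa>')) \<partial>lborel) \<le> 1"
        using m by (subst (asm) ennreal_mult_le_mult_iff) auto
      then show ?thesis using NFun by simp
    qed
  next
    case Infty
    have "norm (?G x) \<le> \<kappa>'" for x
    proof -
      have "AE y in lborel. norm (g (x + y)) \<le> \<kappa>"
        using AE_lborel_shift[of "\<lambda>y. norm (g y) \<le> \<kappa>" x] g Infty by simp
      then have *: "AE y in lborel. norm (g (x + y) * M y) \<le> \<kappa> * norm (M y)"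
        by eventually_elim (simp add: norm_mult mult_right_mono)
      have "norm (?G x) \<le> (\<integral>y. norm (g (x + y) * M y) \<partial>lborel)" by (rule integral_norm_bound)
      also have "\<dots> \<le> (\<integral>y. \<kappa> * norm (M y) \<partial>lborel)"
        using * M g by (intro integral_mono_AE' integrable_mult_right integrable_norm) auto
      also have "\<dots> = \<kappa> * m" by (simp add: m_def)
      finally show ?thesis using \<kappa>' by (simp add: m_def)
    qed
    then show ?thesis using Infty by simp
  qed
qed

text \<open>An N-function dominates a multiple of \<open>t - 1\<close>, so that \<open>g\<close> is the sum of a bounded and an integrable function, and \<open>\<phi>\<close>
is both integrable and bounded. The bound is uniform in \<open>y\<close>, unlike the bounds that the definition of a tempered distribution
provides.\<close>

lemma modular_ball_tested_bound:
  fixes g \<phi> :: "'a::euclidean_space \<Rightarrow> complex"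
  assumes A: "valid_orlicz A" and g: "modular_ball A \<kappa> g" "0 < \<kappa>"
    and gm [measurable]: "g \<in> borel_measurable borel"
    and \<phi>: "integrable lborel \<phi>" "\<And>x. norm (\<phi> x) \<le> B"
  shows "\<exists>C. \<forall>y. (\<integral>\<^sup>+x. ennreal (norm (g (x + y)) * norm (\<phi> x)) \<partial>lborel) \<le> ennreal C"
proof (cases A)
  case (NFun D)
  then have D: "is_N_function D" using A by simp
  obtain \<alpha> where \<alpha>: "\<And>s. 0 < s \<Longrightarrow> 0 < \<alpha> s" "\<And>s t. 0 \<le> s \<Longrightarrow> 0 \<le> t \<Longrightarrow> D s + \<alpha> s * (t - s) \<le> D t"
    using N_function_subgradient[OF D] by metis
  have mD [measurable]: "(\<lambda>x. D (norm (g x) / \<kappa>)) \<in> borel_measurable borel"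
    using g by (intro N_function_measurable[OF D]) auto
  have [measurable]: "\<phi> \<in> borel_measurable borel" using borel_measurable_integrable[OF \<phi>(1)] by simp
  have B0: "0 \<le> B" using order_trans[OF norm_ge_zero \<phi>(2)] .
  have bound: "norm (g x) \<le> \<kappa> * (1 + D (norm (g x) / \<kappa>) / \<alpha> 1)" for x
  proof -
    have "0 + \<alpha> 1 * (norm (g x) / \<kappa> - 1) \<le> D 1 + \<alpha> 1 * (norm (g x) / \<kappa> - 1)"
      using N_function_nonneg[OF D, of 1] by simp
    also have "\<dots> \<le> D (norm (g x) / \<kappa>)" using g by (intro \<alpha>(2)) auto
    finally have "\<alpha> 1 * (norm (g x) / \<kappa> - 1) \<le> D (norm (g x) / \<kappa>)" by simp
    then have "norm (g x) / \<kappa> - 1 \<le> D (norm (g x) / \<kappa>) / \<alpha> 1"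
      using \<alpha>(1)[of 1] by (simp add: pos_le_divide_eq mult.commute)
    then have "norm (g x) / \<kappa> \<le> 1 + D (norm (g x) / \<kappa>) / \<alpha> 1" by linarith
    then show ?thesis using g by (simp add: pos_divide_le_eq mult.commute)
  qed
  define L where "L = (\<integral>x. norm (\<phi> x) \<partial>lborel)"
  have L: "(\<integral>\<^sup>+x. ennreal (norm (\<phi> x)) \<partial>lborel) = ennreal L" "0 \<le> L"
    unfolding L_def using \<phi> by (intro nn_integral_eq_integral integrable_norm) auto
  have "(\<integral>\<^sup>+x. ennreal (norm (g (x + y)) * norm (\<phi> x)) \<partial>lborel) \<le> ennreal (\<kappa> * L + \<kappa> * B / \<alpha> 1)" for y
  proof -
    have "(\<integral>\<^sup>+x. ennreal (norm (g (x + y)) * norm (\<phi> x)) \<partial>lborel) \<le>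
        (\<integral>\<^sup>+x. ennreal \<kappa> * ennreal (norm (\<phi> x)) + ennreal (\<kappa> * B / \<alpha> 1) * ennreal (D (norm (g (x + y)) / \<kappa>)) \<partial>lborel)"
    proof (intro nn_integral_mono)
      fix x
      define d where "d = D (norm (g (x + y)) / \<kappa>)"
      have d: "0 \<le> d" unfolding d_def using g by (intro N_function_nonneg[OF D]) simp
      have "norm (g (x + y)) * norm (\<phi> x) \<le> (\<kappa> * (1 + d / \<alpha> 1)) * norm (\<phi> x)"
        unfolding d_def by (intro mult_right_mono bound) auto
      also have "\<dots> = \<kappa> * norm (\<phi> x) + (\<kappa> * d / \<alpha> 1) * norm (\<phi> x)" by (simp add: algebra_simps)
      also have "\<dots> \<le> \<kappa> * norm (\<phi> x) + (\<kappa> * d / \<alpha> 1) * B"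
        using \<phi>(2)[of x] d g \<alpha>(1)[of 1] by (intro add_left_mono mult_left_mono) auto
      finally have "norm (g (x + y)) * norm (\<phi> x) \<le> \<kappa> * norm (\<phi> x) + (\<kappa> * B / \<alpha> 1) * d" by (simp add: mult_ac)
      then show "ennreal (norm (g (x + y)) * norm (\<phi> x)) \<le> ennreal \<kappa> * ennreal (norm (\<phi> x)) + ennreal (\<kappa> * B / \<alpha> 1) * ennreal (D (norm (g (x + y)) / \<kappa>))"
        unfolding d_def[symmetric] using d g B0 \<alpha>(1)[of 1]
        by (simp add: ennreal_mult'[symmetric] ennreal_plus[symmetric] del: ennreal_plus)
    qed
    also have "\<dots> = ennreal \<kappa> * ennreal L + ennreal (\<kappa> * B / \<alpha> 1) * (\<integral>\<^sup>+x. ennreal (D (norm (g (x + y)) / \<kappa>)) \<partial>lborel)"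
      by (simp add: nn_integral_add nn_integral_cmult L)
    also have "(\<integral>\<^sup>+x. ennreal (D (norm (g (x + y)) / \<kappa>)) \<partial>lborel) = (\<integral>\<^sup>+x. ennreal (D (norm (g x) / \<kappa>)) \<partial>lborel)"
      by (rule nn_integral_lborel_shift[of "\<lambda>x. ennreal (D (norm (g x) / \<kappa>))"]) simp
    also have "ennreal \<kappa> * ennreal L + ennreal (\<kappa> * B / \<alpha> 1) * \<dots> \<le> ennreal \<kappa> * ennreal L + ennreal (\<kappa> * B / \<alpha> 1) * 1"
      using g NFun by (intro add_left_mono mult_left_mono) auto
    also have "\<dots> = ennreal (\<kappa> * L + \<kappa> * B / \<alpha> 1)"
      using g L B0 \<alpha>(1)[of 1] by (simp add: ennreal_mult'[symmetric] ennreal_plus[symmetric] del: ennreal_plus)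
    finally show ?thesis .
  qed
  then show ?thesis by blast
next
  case Infty
  have [measurable]: "\<phi> \<in> borel_measurable borel" using borel_measurable_integrable[OF \<phi>(1)] by simp
  have "(\<integral>\<^sup>+x. ennreal (norm (g (x + y)) * norm (\<phi> x)) \<partial>lborel) \<le> ennreal (\<kappa> * (\<integral>x. norm (\<phi> x) \<partial>lborel))" for y
  proof -
    have "AE x in lborel. norm (g (y + x)) \<le> \<kappa>"
      using AE_lborel_shift[of "\<lambda>y. norm (g y) \<le> \<kappa>" y] g Infty by simp
    then have "AE x in lborel. ennreal (norm (g (x + y)) * norm (\<phi> x)) \<le> ennreal (\<kappa> * norm (\<phi> x))"
      by eventually_elim (auto intro!: ennreal_leI mult_right_mono simp: add.commute)
    then have "(\<integral>\<^sup>+x. ennreal (norm (g (x + y)) * norm (\<phi> x)) \<partial>lborel) \<le> (\<integral>\<^sup>+x. ennreal (\<kappa> * norm (\<phi> x)) \<partial>lborel)"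
      by (rule nn_integral_mono_AE)
    also have "\<dots> = ennreal (\<integral>x. \<kappa> * norm (\<phi> x) \<partial>lborel)"
      using \<phi> g by (intro nn_integral_eq_integral integrable_mult_right integrable_norm) auto
    finally show ?thesis by simp
  qed
  then show ?thesis by blast
qed

section \<open>Convolution of a distribution with a kernel\<close>

text \<open>If \<open>f\<close> is given by a function \<open>g\<close>, then \<open>dconv f M\<close> is given by \<open>x \<mapsto> \<integral>g(x + y) M(y) dy\<close>. The definition by duality
makes sense on the level of functionals and commutes with translations by construction.\<close>

definition dconv :: "'a::euclidean_space distr \<Rightarrow> ('a \<Rightarrow> complex) \<Rightarrow> 'a distr" where
  "dconv f M = (\<lambda>\<phi>. \<integral>y. f (\<lambda>x. \<phi> (x - y)) * M y \<partial>lborel)"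

text \<open>The condition under which \<open>dconv f M\<close> is an absolutely convergent integral for each integrable \<open>M\<close>.\<close>

definition bounded_orbits :: "'a::euclidean_space distr \<Rightarrow> bool" where
  "bounded_orbits f \<longleftrightarrow> (\<forall>\<phi>\<in>schwartz. (\<lambda>y. f (\<lambda>x. \<phi> (x - y))) \<in> borel_measurable borel \<and>
     (\<exists>C. \<forall>y. norm (f (\<lambda>x. \<phi> (x - y))) \<le> C))"

lemma luxemburg_norm_distr_cong:
  assumes "\<And>\<phi>. \<phi> \<in> schwartz \<Longrightarrow> f \<phi> = h \<phi>"
  shows "luxemburg_norm_distr A f = luxemburg_norm_distr A h"
proof -
  have "represents g f \<longleftrightarrow> represents g h" for g
    using assms unfolding represents_def by auto
  then show ?thesis by (simp add: luxemburg_norm_distr_def)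
qed

lemma luxemburg_norm_distr_lessE:
  assumes A: "valid_orlicz A" and "luxemburg_norm_distr A f < ennreal \<kappa>"
  obtains g where "represents g f" "modular_ball A \<kappa> g" "0 < \<kappa>" "g \<in> borel_measurable borel"
proof -
  obtain g where g: "represents g f" "luxemburg_norm A g < ennreal \<kappa>"
    using assms(2) by (auto simp: luxemburg_norm_distr_def INF_less_iff)
  have m: "g \<in> borel_measurable borel" using g by (simp add: represents_def)
  show thesis using that g m luxemburg_norm_less[OF A g(2) m] by blast
qed

lemma luxemburg_norm_distr_le:
  assumes "represents g f" "modular_ball A \<kappa> g" "0 < \<kappa>"
  shows "luxemburg_norm_distr A f \<le> ennreal \<kappa>"
proof -
  have "g \<in> borel_measurable borel" using assms by (simp add: represents_def)
  then have "luxemburg_norm A g \<le> ennreal \<kappa>" using luxemburg_norm_le assms by blast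
  then show ?thesis
    unfolding luxemburg_norm_distr_def using assms(1) by (intro INF_lower2) auto
qed

lemma luxemburg_norm_distr_finiteE:
  assumes A: "valid_orlicz A" and "luxemburg_norm_distr A f < \<infinity>"
  obtains g \<kappa> where "represents g f" "modular_ball A \<kappa> g" "0 < \<kappa>" "g \<in> borel_measurable borel"
proof -
  obtain r where "0 \<le> r" "luxemburg_norm_distr A f = ennreal r"
    using assms(2) by (cases "luxemburg_norm_distr A f") auto
  then have "luxemburg_norm_distr A f < ennreal (r + 1)" by (simp add: ennreal_less_iff)
  then show thesis using luxemburg_norm_distr_lessE[OF A] that by metis
qed

lemma represents_orbit:
  fixes g :: "'a::euclidean_space \<Rightarrow> complex"
  assumes "represents g f" "\<phi> \<in> schwartz"
  shows "f (\<lambda>x. \<phi> (x - y)) = (\<integral>x. g (x + y) * \<phi> x \<partial>lborel)"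
proof -
  have "f (\<lambda>x. \<phi> (x - y)) = (\<integral>x. g x * \<phi> (x - y) \<partial>lborel)"
    using assms schwartz_translate[OF assms(2)] by (simp add: represents_def)
  also have "\<dots> = (\<integral>x. g (x + y) * \<phi> x \<partial>lborel)"
    using lborel_integral_shift[of "\<lambda>x. g x * \<phi> (x - y)" y] by simp
  finally show ?thesis .
qed

lemma represents_tested_bound:
  fixes g :: "'a::euclidean_space \<Rightarrow> complex"
  assumes "valid_orlicz A" "modular_ball A \<kappa> g" "0 < \<kappa>" "g \<in> borel_measurable borel" "\<phi> \<in> schwartz"
  obtains C where "0 \<le> C" "\<And>y. (\<integral>\<^sup>+x. ennreal (norm (g (x + y)) * norm (\<phi> x)) \<partial>lborel) \<le> ennreal C"
proof -
  obtain B where "\<And>x. norm (\<phi> x) \<le> B" using schwartz_bounded[OF assms(5)] by metis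
  then obtain C where "\<And>y. (\<integral>\<^sup>+x. ennreal (norm (g (x + y)) * norm (\<phi> x)) \<partial>lborel) \<le> ennreal C"
    using modular_ball_tested_bound[OF assms(1-4) schwartz_integrable[OF assms(5)]] by metis
  then have "\<And>y. (\<integral>\<^sup>+x. ennreal (norm (g (x + y)) * norm (\<phi> x)) \<partial>lborel) \<le> ennreal (max C 0)"
    by (metis ennreal_leI max.cobounded1 order_trans)
  then show thesis using that[of "max C 0"] by simp
qed

lemma finite_norm_bounded_orbits:
  fixes f :: "'a::euclidean_space distr"
  assumes A: "valid_orlicz A" and "luxemburg_norm_distr A f < \<infinity>"
  shows "bounded_orbits f"
  unfolding bounded_orbits_def
proof (intro ballI conjI)
  fix \<phi> :: "'a \<Rightarrow> complex" assume \<phi>: "\<phi> \<in> schwartz"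
  obtain g \<kappa> where g: "represents g f" "modular_ball A \<kappa> g" "0 < \<kappa>" and [measurable]: "g \<in> borel_measurable borel"
    using luxemburg_norm_distr_finiteE[OF assms] by metis
  have [measurable]: "\<phi> \<in> borel_measurable borel" by (rule schwartz_measurable[OF \<phi>])
  show "(\<lambda>y. f (\<lambda>x. \<phi> (x - y))) \<in> borel_measurable borel"
    unfolding represents_orbit[OF g(1) \<phi>] by measurable
  obtain C where C: "0 \<le> C" "\<And>y. (\<integral>\<^sup>+x. ennreal (norm (g (x + y)) * norm (\<phi> x)) \<partial>lborel) \<le> ennreal C"
    using represents_tested_bound[OF A g(2,3) _ \<phi>] by (metis \<open>g \<in> borel_measurable borel\<close>)
  have "norm (\<integral>x. g (x + y) * \<phi> x \<partial>lborel) \<le> C" for y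
  proof -
    have "ennreal (norm (\<integral>x. g (x + y) * \<phi> x \<partial>lborel)) \<le> (\<integral>\<^sup>+x. ennreal (norm (g (x + y) * \<phi> x)) \<partial>lborel)"
      by (cases "integrable lborel (\<lambda>x. g (x + y) * \<phi> x)")
        (auto intro: integral_norm_bound_ennreal simp: not_integrable_integral_eq)
    also have "\<dots> \<le> ennreal C" using C(2)[of y] by (simp add: norm_mult)
    finally show ?thesis using C by (simp add: ennreal_le_iff)
  qed
  then show "\<exists>C. \<forall>y. norm (f (\<lambda>x. \<phi> (x - y))) \<le> C"
    unfolding represents_orbit[OF g(1) \<phi>] by blast
qed

lemma represents_dconv:
  fixes f :: "'a::euclidean_space distr"
  assumes A: "valid_orlicz A" and g: "represents g f" "modular_ball A \<kappa> g" "0 < \<kappa>" and M: "integrable lborel M"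
  shows "represents (\<lambda>x. \<integral>y. g (x + y) * M y \<partial>lborel) (dconv f M)"
  unfolding represents_def
proof (intro conjI ballI)
  have gm [measurable]: "g \<in> borel_measurable borel" using g by (simp add: represents_def)
  have [measurable]: "M \<in> borel_measurable borel" using borel_measurable_integrable[OF M] by simp
  show "(\<lambda>x. \<integral>y. g (x + y) * M y \<partial>lborel) \<in> borel_measurable lborel" by measurable
  fix \<phi> :: "'a \<Rightarrow> complex" assume \<phi>: "\<phi> \<in> schwartz"
  have [measurable]: "\<phi> \<in> borel_measurable borel" by (rule schwartz_measurable[OF \<phi>])
  obtain C where C: "0 \<le> C" "\<And>y. (\<integral>\<^sup>+x. ennreal (norm (g (x + y)) * norm (\<phi> x)) \<partial>lborel) \<le> ennreal C"
    using represents_tested_bound[OF A g(2,3) gm \<phi>] by metis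
  have pair: "integrable (lborel \<Otimes>\<^sub>M lborel) (\<lambda>(y, x). g (x + y) * M y * \<phi> x)"
  proof (rule lborel_pair.integrable_pairI_nn)
    have "(\<integral>\<^sup>+y. (\<integral>\<^sup>+x. norm (g (x + y) * M y * \<phi> x) \<partial>lborel) \<partial>lborel) =
      (\<integral>\<^sup>+y. ennreal (norm (M y)) * (\<integral>\<^sup>+x. ennreal (norm (g (x + y)) * norm (\<phi> x)) \<partial>lborel) \<partial>lborel)"
      by (subst nn_integral_cmult[symmetric]) (auto simp: norm_mult ennreal_mult[symmetric] mult_ac)
    also have "\<dots> \<le> (\<integral>\<^sup>+y. ennreal (norm (M y)) * ennreal C \<partial>lborel)"
      by (intro nn_integral_mono mult_left_mono C) auto
    also have "\<dots> = (\<integral>\<^sup>+y. ennreal (norm (M y)) \<partial>lborel) * ennreal C"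
      by (intro nn_integral_multc) auto
    also have "\<dots> < \<infinity>" using M unfolding integrable_iff_bounded by (simp add: ennreal_mult_less_top)
    finally show "(\<integral>\<^sup>+y. (\<integral>\<^sup>+x. norm (g (x + y) * M y * \<phi> x) \<partial>lborel) \<partial>lborel) < \<infinity>" .
  qed measurable
  have eq: "(\<integral>y. g (x + y) * M y * \<phi> x \<partial>lborel) = (\<integral>y. g (x + y) * M y \<partial>lborel) * \<phi> x" for x
    by (rule integral_mult_left_zero)
  show "integrable lborel (\<lambda>x. (\<integral>y. g (x + y) * M y \<partial>lborel) * \<phi> x)"
    using lborel_pair.integrable_snd[OF pair] unfolding eq .
  have "dconv f M \<phi> = (\<integral>y. (\<integral>x. g (x + y) * M y * \<phi> x \<partial>lborel) \<partial>lborel)"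
    unfolding dconv_def represents_orbit[OF g(1) \<phi>] integral_mult_left_zero[symmetric] by (simp only: mult_ac)
  also have "\<dots> = (\<integral>x. (\<integral>y. g (x + y) * M y * \<phi> x \<partial>lborel) \<partial>lborel)"
    by (rule lborel_pair.Fubini_integral[symmetric, OF pair])
  finally show "dconv f M \<phi> = (\<integral>x. (\<integral>y. g (x + y) * M y \<partial>lborel) * \<phi> x \<partial>lborel)" unfolding eq .
qed

text \<open>Young's inequality with \<open>L\<^sup>1\<close>. The infimum in the norm is not assumed to be attained, hence the room \<open>e\<close>.\<close>

lemma luxemburg_norm_distr_dconv:
  fixes f :: "'a::euclidean_space distr"
  assumes A: "valid_orlicz A" and fin: "luxemburg_norm_distr A f < \<infinity>" and M: "integrable lborel M"
  shows "luxemburg_norm_distr A (dconv f M) \<le> ennreal (\<integral>y. norm (M y) \<partial>lborel) * luxemburg_norm_distr A f"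
proof (rule ennreal_le_epsilon)
  fix e :: real assume e: "0 < e"
  define m where "m = (\<integral>y. norm (M y) \<partial>lborel)"
  have m: "0 \<le> m" by (simp add: m_def)
  obtain n where n: "0 \<le> n" "luxemburg_norm_distr A f = ennreal n"
    using fin by (cases "luxemburg_norm_distr A f") auto
  define e' where "e' = e / (m + 1)"
  have e': "0 < e'" using e m by (simp add: e'_def)
  have "luxemburg_norm_distr A f < ennreal (n + e')" using n e' by (simp add: ennreal_less_iff)
  then obtain g where g: "represents g f" "modular_ball A (n + e') g" "0 < n + e'" "g \<in> borel_measurable borel"
    using luxemburg_norm_distr_lessE[OF A] by metis
  have pos: "0 < (n + e') * m + e'" using n e' m by (simp add: add_nonneg_pos)
  have "modular_ball A ((n + e') * m + e') (\<lambda>x. \<integral>y. g (x + y) * M y \<partial>lborel)"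
    using e' pos by (intro modular_ball_convolution[OF A g(2,3) M _ _ g(4)]) (auto simp: m_def)
  then have "luxemburg_norm_distr A (dconv f M) \<le> ennreal ((n + e') * m + e')"
    using luxemburg_norm_distr_le[OF represents_dconv[OF A g(1-3) M]] pos by blast
  also have "(n + e') * m + e' = m * n + e' * (m + 1)" by (simp add: algebra_simps)
  also have "e' * (m + 1) = e" using m by (simp add: e'_def)
  finally show "luxemburg_norm_distr A (dconv f M) \<le> ennreal (\<integral>y. norm (M y) \<partial>lborel) * luxemburg_norm_distr A f + ennreal e"
    unfolding n(2) m_def[symmetric] using m n e by (simp add: ennreal_mult'')
qed

lemma luxemburg_norm_distr_add:
  fixes f h :: "'a::euclidean_space distr"
  assumes A: "valid_orlicz A"
  shows "luxemburg_norm_distr A (\<lambda>\<phi>. f \<phi> + h \<phi>) \<le> luxemburg_norm_distr A f + luxemburg_norm_distr A h"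
proof (rule ennreal_le_epsilon)
  fix e :: real assume e: "0 < e" and fin: "luxemburg_norm_distr A f + luxemburg_norm_distr A h < top"
  obtain n where n: "0 \<le> n" "luxemburg_norm_distr A f = ennreal n"
    using fin by (cases "luxemburg_norm_distr A f") auto
  obtain k where k: "0 \<le> k" "luxemburg_norm_distr A h = ennreal k"
    using fin by (cases "luxemburg_norm_distr A h") auto
  have "luxemburg_norm_distr A f < ennreal (n + e / 2)" using n e by (simp add: ennreal_less_iff)
  then obtain g where g: "represents g f" "modular_ball A (n + e / 2) g" "0 < n + e / 2" "g \<in> borel_measurable borel"
    using luxemburg_norm_distr_lessE[OF A] by metis
  have "luxemburg_norm_distr A h < ennreal (k + e / 2)" using k e by (simp add: ennreal_less_iff)
  then obtain g' where g': "represents g' h" "modular_ball A (k + e / 2) g'" "0 < k + e / 2" "g' \<in> borel_measurable borel"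
    using luxemburg_norm_distr_lessE[OF A] by metis
  have "represents (\<lambda>x. g x + g' x) (\<lambda>\<phi>. f \<phi> + h \<phi>)"
    using g(1) g'(1) unfolding represents_def by (auto simp: distrib_right)
  moreover have "modular_ball A ((n + e / 2) + (k + e / 2)) (\<lambda>x. g x + g' x)"
    by (rule modular_ball_add[OF A g(2,3) g'(2,3) g(4) g'(4)])
  ultimately have "luxemburg_norm_distr A (\<lambda>\<phi>. f \<phi> + h \<phi>) \<le> ennreal ((n + e / 2) + (k + e / 2))"
    using g(3) g'(3) by (intro luxemburg_norm_distr_le) auto
  also have "(n + e / 2) + (k + e / 2) = n + k + e" by simp
  finally show "luxemburg_norm_distr A (\<lambda>\<phi>. f \<phi> + h \<phi>) \<le> luxemburg_norm_distr A f + luxemburg_norm_distr A h + ennreal e"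
    unfolding n(2) k(2) using n k e by simp
qed

lemma luxemburg_norm_distr_cmult_le:
  fixes f :: "'a::euclidean_space distr"
  assumes A: "valid_orlicz A" and c: "c \<noteq> 0"
  shows "luxemburg_norm_distr A (\<lambda>\<phi>. c * f \<phi>) \<le> ennreal (norm c) * luxemburg_norm_distr A f"
proof (rule ennreal_le_epsilon)
  fix e :: real assume e: "0 < e" and fin: "ennreal (norm c) * luxemburg_norm_distr A f < top"
  obtain n where n: "0 \<le> n" "luxemburg_norm_distr A f = ennreal n"
    using fin c by (cases "luxemburg_norm_distr A f") (auto simp: ennreal_mult_top)
  define e' where "e' = e / norm c"
  have e': "0 < e'" using e c by (simp add: e'_def)
  have "luxemburg_norm_distr A f < ennreal (n + e')" using n e' by (simp add: ennreal_less_iff)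
  then obtain g where g: "represents g f" "modular_ball A (n + e') g" "0 < n + e'" "g \<in> borel_measurable borel"
    using luxemburg_norm_distr_lessE[OF A] by metis
  have "represents (\<lambda>x. c * g x) (\<lambda>\<phi>. c * f \<phi>)"
    using g(1) unfolding represents_def by (auto simp: mult.assoc)
  then have "luxemburg_norm_distr A (\<lambda>\<phi>. c * f \<phi>) \<le> ennreal (norm c * (n + e'))"
    using modular_ball_cmult[OF c g(2)] g(3) c by (intro luxemburg_norm_distr_le) auto
  also have "norm c * (n + e') = norm c * n + e" using c by (simp add: e'_def algebra_simps)
  finally show "luxemburg_norm_distr A (\<lambda>\<phi>. c * f \<phi>) \<le> ennreal (norm c) * luxemburg_norm_distr A f + ennreal e"
    unfolding n(2) using n e by (simp add: ennreal_mult'')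
qed

text \<open>The reverse inequality is the previous lemma applied to \<open>1 / c\<close>.\<close>

lemma luxemburg_norm_distr_cmult_ge:
  fixes f :: "'a::euclidean_space distr"
  assumes A: "valid_orlicz A" and c: "c \<noteq> 0"
  shows "ennreal (norm c) * luxemburg_norm_distr A f \<le> luxemburg_norm_distr A (\<lambda>\<phi>. c * f \<phi>)"
proof -
  have "luxemburg_norm_distr A f \<le> ennreal (norm (1 / c)) * luxemburg_norm_distr A (\<lambda>\<phi>. c * f \<phi>)"
    using luxemburg_norm_distr_cmult_le[OF A, of "1 / c" "\<lambda>\<phi>. c * f \<phi>"] c by simp
  then have "ennreal (norm c) * luxemburg_norm_distr A f \<le> ennreal (norm c) * (ennreal (norm (1 / c)) * luxemburg_norm_distr A (\<lambda>\<phi>. c * f \<phi>))"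
    by (intro mult_left_mono) auto
  also have "\<dots> = luxemburg_norm_distr A (\<lambda>\<phi>. c * f \<phi>)"
    using c by (simp add: mult.assoc[symmetric] ennreal_mult[symmetric] norm_divide)
  finally show ?thesis .
qed

lemma bounded_orbits_integrable:
  assumes "bounded_orbits f" "\<phi> \<in> schwartz" "integrable lborel M"
  shows "integrable lborel (\<lambda>y. f (\<lambda>x. \<phi> (x - y)) * M y)"
proof -
  obtain C where C: "\<And>y. norm (f (\<lambda>x. \<phi> (x - y))) \<le> C" and [measurable]: "(\<lambda>y. f (\<lambda>x. \<phi> (x - y))) \<in> borel_measurable borel"
    using assms unfolding bounded_orbits_def by meson
  have [measurable]: "M \<in> borel_measurable borel" using borel_measurable_integrable[OF assms(3)] by simp
  show ?thesis
  proof (rule Bochner_Integration.integrable_bound[OF integrable_mult_right[OF integrable_norm[OF assms(3)], of C]])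
    show "AE y in lborel. norm (f (\<lambda>x. \<phi> (x - y)) * M y) \<le> norm (C * norm (M y))"
    proof (rule AE_I2)
      fix y
      have "norm (f (\<lambda>x. \<phi> (x - y)) * M y) \<le> C * norm (M y)"
        unfolding norm_mult by (intro mult_right_mono C) auto
      also have "\<dots> \<le> norm (C * norm (M y))" by simp
      finally show "norm (f (\<lambda>x. \<phi> (x - y)) * M y) \<le> norm (C * norm (M y))" .
    qed
  qed measurable
qed

lemma dconv_diff:
  assumes "bounded_orbits f" "\<phi> \<in> schwartz" "integrable lborel M" "integrable lborel M'"
  shows "dconv f (\<lambda>y. M y - M' y) \<phi> = dconv f M \<phi> - dconv f M' \<phi>"
  unfolding dconv_def right_diff_distrib
  by (intro Bochner_Integration.integral_diff bounded_orbits_integrable assms)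

lemma dconv_translate:
  "dconv f M (\<lambda>x. \<phi> (x - z)) = (\<integral>y. f (\<lambda>x. \<phi> (x - y)) * M (y - z) \<partial>lborel)"
  using lborel_integral_shift[of "\<lambda>y. f (\<lambda>x. \<phi> (x - y)) * M (y - z)" z]
  by (simp add: dconv_def algebra_simps)

lemma integrable_convolution_pair:
  fixes K M :: "'a::euclidean_space \<Rightarrow> complex"
  assumes K: "integrable lborel K" and M: "integrable lborel M"
  shows "integrable (lborel \<Otimes>\<^sub>M lborel) (\<lambda>(y, x). K y * M (x - y))"
proof (rule lborel_pair.integrable_pairI_nn)
  have [measurable]: "K \<in> borel_measurable borel" "M \<in> borel_measurable borel"
    using borel_measurable_integrable[OF M] borel_measurable_integrable[OF K] by simp_all
  have "(\<integral>\<^sup>+y. (\<integral>\<^sup>+x. norm (K y * M (x - y)) \<partial>lborel) \<partial>lborel) = (\<integral>\<^sup>+y. ennreal (norm (K y)) * (\<integral>\<^sup>+x. norm (M (x - y)) \<partial>lborel) \<partial>lborel)"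
    by (simp add: norm_mult ennreal_mult nn_integral_cmult)
  also have "\<dots> = (\<integral>\<^sup>+y. ennreal (norm (K y)) * (\<integral>\<^sup>+x. norm (M x) \<partial>lborel) \<partial>lborel)"
    using nn_integral_lborel_minus_shift[of "\<lambda>x. ennreal (norm (M x))"] by simp
  also have "\<dots> = (\<integral>\<^sup>+y. norm (K y) \<partial>lborel) * (\<integral>\<^sup>+x. norm (M x) \<partial>lborel)"
    by (intro nn_integral_multc) auto
  also have "\<dots> < \<infinity>" using K M unfolding integrable_iff_bounded by (simp add: ennreal_mult_less_top)
  finally show "(\<integral>\<^sup>+y. (\<integral>\<^sup>+x. norm (K y * M (x - y)) \<partial>lborel) \<partial>lborel) < \<infinity>" .
  show "(\<lambda>(y, x). K y * M (x - y)) \<in> borel_measurable (lborel \<Otimes>\<^sub>M lborel)" by measurable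
qed

text \<open>By Fubini's theorem \<open>f \<star> (K * M)\<close> averages the values of \<open>f \<star> K\<close> at translated test functions, and all of these vanish.\<close>

lemma dconv_convolution_zero:
  fixes f :: "'a::euclidean_space distr"
  assumes f: "bounded_orbits f" and K: "integrable lborel K" and M: "integrable lborel M"
    and zero: "\<And>\<phi>. \<phi> \<in> schwartz \<Longrightarrow> dconv f K \<phi> = 0" and \<phi>: "\<phi> \<in> schwartz"
  shows "dconv f (\<lambda>x. \<integral>y. K y * M (x - y) \<partial>lborel) \<phi> = 0"
proof -
  let ?F = "\<lambda>x. f (\<lambda>w. \<phi> (w - x))"
  obtain C where C: "\<And>x. norm (?F x) \<le> C" and Fm [measurable]: "?F \<in> borel_measurable borel"
    using f \<phi> unfolding bounded_orbits_def by meson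
  have [measurable]: "K \<in> borel_measurable borel" "M \<in> borel_measurable borel"
    using borel_measurable_integrable[OF M] borel_measurable_integrable[OF K] by simp_all
  have "integrable (lborel \<Otimes>\<^sub>M lborel) (\<lambda>(z, x). M z * K (x - z))"
    by (rule integrable_convolution_pair[OF M K])
  then have pair: "integrable (lborel \<Otimes>\<^sub>M lborel) (\<lambda>(z, x). ?F x * (M z * K (x - z)))"
    by (rule Bochner_Integration.integrable_bound[OF integrable_mult_right[of C, OF integrable_norm]])
      (auto simp: norm_mult abs_mult split_beta intro!: AE_I2 mult_right_mono order_trans[OF C abs_ge_self])
  have "dconv f (\<lambda>x. \<integral>y. K y * M (x - y) \<partial>lborel) \<phi> = (\<integral>x. (\<integral>z. ?F x * (M z * K (x - z)) \<partial>lborel) \<partial>lborel)"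
  proof -
    have "(\<integral>y. K y * M (x - y) \<partial>lborel) = (\<integral>z. M z * K (x - z) \<partial>lborel)" for x
      using lborel_integral_reflect[of "\<lambda>z. M z * K (x - z)" x] by (simp add: mult.commute)
    then show ?thesis by (simp add: dconv_def)
  qed
  also have "\<dots> = (\<integral>z. (\<integral>x. ?F x * (M z * K (x - z)) \<partial>lborel) \<partial>lborel)"
    by (rule lborel_pair.Fubini_integral[OF pair])
  also have "\<dots> = (\<integral>z. M z * dconv f K (\<lambda>w. \<phi> (w - z)) \<partial>lborel)"
    unfolding dconv_translate integral_mult_right_zero[symmetric] by (simp only: mult_ac)
  also have "\<dots> = 0" by (simp add: zero[OF schwartz_translate[OF \<phi>]])
  finally show ?thesis .
qed

section \<open>The subordinator and its jump kernel\<close>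

text \<open>Half of the exponent is spent on the factor \<open>exp (- \<rho>\<^sup>2 / (8 t))\<close>, the other half is the heat kernel at time \<open>2 t\<close>.\<close>

lemma heat_kernel_tail:
  fixes z :: "'a::euclidean_space"
  assumes t: "0 < t" and \<rho>: "0 \<le> \<rho>" "\<rho> \<le> norm z"
  shows "heat_kernel t z \<le> 2 powr (real DIM('a) / 2) * exp (- (\<rho>\<^sup>2 / (8 * t))) * heat_kernel (2 * t) z"
proof -
  let ?a = "real DIM('a) / 2"
  have 1: "(4 * pi * t) powr (- ?a) = 2 powr ?a * (4 * pi * (2 * t)) powr (- ?a)"
  proof -
    have "(4 * pi * (2 * t)) powr (- ?a) = (2 * (4 * pi * t)) powr (- ?a)" by (simp add: mult_ac)
    also have "\<dots> = 2 powr (- ?a) * (4 * pi * t) powr (- ?a)" using t by (intro powr_mult)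
    finally have "2 powr ?a * (4 * pi * (2 * t)) powr (- ?a) = (2 powr ?a * 2 powr (- ?a)) * (4 * pi * t) powr (- ?a)"
      by (simp only: mult.assoc)
    also have "(2::real) powr ?a * 2 powr (- ?a) = 1" by (subst powr_add[symmetric]) simp
    finally show ?thesis by simp
  qed
  have "\<rho>\<^sup>2 / (8 * t) + (norm z)\<^sup>2 / (4 * (2 * t)) \<le> (norm z)\<^sup>2 / (4 * t)"
  proof -
    have "\<rho>\<^sup>2 \<le> (norm z)\<^sup>2" using \<rho> by (intro power_mono)
    then show ?thesis using t by (simp add: field_simps)
  qed
  then have 2: "exp (- ((norm z)\<^sup>2 / (4 * t))) \<le> exp (- (\<rho>\<^sup>2 / (8 * t))) * exp (- ((norm z)\<^sup>2 / (4 * (2 * t))))"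
    by (subst exp_add[symmetric]) simp
  have "(2 powr ?a * (4 * pi * (2 * t)) powr (- ?a)) * exp (- ((norm z)\<^sup>2 / (4 * t))) \<le>
    (2 powr ?a * (4 * pi * (2 * t)) powr (- ?a)) * (exp (- (\<rho>\<^sup>2 / (8 * t))) * exp (- ((norm z)\<^sup>2 / (4 * (2 * t)))))"
    by (intro mult_left_mono 2) simp
  then show ?thesis unfolding heat_kernel_def 1 by (simp only: mult_ac)
qed

lemma heat_kernel_tail_integral:
  assumes t: "0 < t" and \<rho>: "0 \<le> \<rho>"
  shows "(\<integral>\<^sup>+z. ennreal (indicator {z::'a::euclidean_space. \<rho> \<le> norm z} z * heat_kernel t z) \<partial>lborel)
    \<le> ennreal (2 powr (real DIM('a) / 2) * exp (- (\<rho>\<^sup>2 / (8 * t))))"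
proof -
  let ?c = "2 powr (real DIM('a) / 2) * exp (- (\<rho>\<^sup>2 / (8 * t)))"
  have "(\<integral>\<^sup>+z. ennreal (indicator {z::'a. \<rho> \<le> norm z} z * heat_kernel t z) \<partial>lborel) \<le> (\<integral>\<^sup>+z. ennreal ?c * ennreal (heat_kernel (2 * t) (z::'a)) \<partial>lborel)"
  proof (intro nn_integral_mono)
    fix z :: 'a
    show "ennreal (indicator {z::'a. \<rho> \<le> norm z} z * heat_kernel t z) \<le> ennreal ?c * ennreal (heat_kernel (2 * t) z)"
      using heat_kernel_tail[OF t \<rho>, of z]
      by (auto simp: ennreal_mult'[symmetric] heat_kernel_nonneg split: split_indicator intro!: ennreal_leI)
  qed
  also have "\<dots> = ennreal ?c"
    using t by (subst nn_integral_cmult) (simp_all add: heat_kernel_nn_integral)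
  finally show ?thesis .
qed

lemma heat_kernel_sqrt_product:
  fixes x y :: "'a::euclidean_space"
  assumes t: "0 < t"
  shows "sqrt (heat_kernel t x * heat_kernel t (x - y)) = exp (- ((norm y)\<^sup>2 / (16 * t))) * heat_kernel t (x - y /\<^sub>R 2)"
proof -
  define k where "k = (4 * pi * t) powr (- (real DIM('a) / 2))"
  define E where "E = exp (- ((norm y)\<^sup>2 / (16 * t)))"
  have k: "0 \<le> k" "0 \<le> E" by (auto simp: k_def E_def)
  have "(norm x)\<^sup>2 + (norm (x - y))\<^sup>2 = 2 * (norm (x - y /\<^sub>R 2))\<^sup>2 + (norm y)\<^sup>2 / 2"
    unfolding power2_norm_eq_inner by (simp add: inner_diff_left inner_diff_right inner_commute algebra_simps)
  moreover have "P / (4 * t) + Q / (4 * t) = 2 * (R / (4 * t) + Y / (16 * t))" if "P + Q = 2 * R + Y / 2" for P Q R Y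
  proof -
    have "P / (4 * t) + Q / (4 * t) = (2 * R + Y / 2) / (4 * t)"
      unfolding that[symmetric] by (rule add_divide_distrib[symmetric])
    then show ?thesis by (simp add: add_divide_distrib)
  qed
  ultimately have "(norm x)\<^sup>2 / (4 * t) + (norm (x - y))\<^sup>2 / (4 * t) = 2 * ((norm (x - y /\<^sub>R 2))\<^sup>2 / (4 * t) + (norm y)\<^sup>2 / (16 * t))"
    by blast
  then have "exp (- ((norm x)\<^sup>2 / (4 * t))) * exp (- ((norm (x - y))\<^sup>2 / (4 * t))) = (E * exp (- ((norm (x - y /\<^sub>R 2))\<^sup>2 / (4 * t))))\<^sup>2"
    unfolding E_def exp_add[symmetric] exp_double[symmetric] by simp
  then have "heat_kernel t x * heat_kernel t (x - y) = (E * heat_kernel t (x - y /\<^sub>R 2))\<^sup>2"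
    unfolding heat_kernel_def k_def[symmetric] by (simp add: power2_eq_square mult_ac)
  then show ?thesis
    using k heat_kernel_nonneg[of t "x - y /\<^sub>R 2"] by (simp add: E_def real_sqrt_unique)
qed

text \<open>The Hellinger distance replaces a derivative. With \<open>p\<close> the kernel and \<open>q\<close> its translate,
\<open>|p - q| = |sqrt p - sqrt q| (sqrt p + sqrt q)\<close> is split by the inequality between the arithmetic and the geometric mean
with weight \<open>\<delta> = |y| / sqrt t\<close>, and the integral of \<open>sqrt (p q)\<close> is explicit by \<open>heat_kernel_sqrt_product\<close>.\<close>

lemma heat_kernel_translation:
  fixes y :: "'a::euclidean_space"
  assumes t: "0 < t"
  shows "(\<integral>\<^sup>+x. ennreal \<bar>heat_kernel t x - heat_kernel t (x - y)\<bar> \<partial>lborel) \<le> ennreal (3 * norm y / sqrt t)"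
proof (cases "y = 0")
  case False
  define \<delta> where "\<delta> = norm y / sqrt t"
  have \<delta>: "0 < \<delta>" using False t by (simp add: \<delta>_def)
  define E where "E = exp (- (\<delta>\<^sup>2 / 16))"
  have E: "E = exp (- ((norm y)\<^sup>2 / (16 * t)))" using t by (simp add: E_def \<delta>_def power_divide)
  have E': "1 - E \<le> \<delta>\<^sup>2 / 16" "E \<le> 1" using exp_ge_add_one_self[of "- (\<delta>\<^sup>2 / 16)"] by (auto simp: E_def)
  let ?p = "\<lambda>x::'a. heat_kernel t x" and ?q = "\<lambda>x::'a. heat_kernel t (x - y)"
  let ?b = "\<lambda>x::'a. (1 / (2 * \<delta>) + \<delta> / 2) * (?p x + ?q x) + (\<delta> - 1 / \<delta>) * (E * heat_kernel t (x - y /\<^sub>R 2))"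
  have ip: "integrable lborel ?p" by (rule heat_kernel_integrable[OF t])
  have iq: "integrable lborel ?q" by (rule lborel_integrable_minus_shift[OF ip])
  have ir: "integrable lborel (\<lambda>x::'a. heat_kernel t (x - y /\<^sub>R 2))" by (rule lborel_integrable_minus_shift[OF ip])
  have pointwise: "\<bar>?p x - ?q x\<bar> \<le> ?b x" for x
  proof -
    define a where "a = sqrt (?p x)"
    define b where "b = sqrt (?q x)"
    have a: "0 \<le> a" "a\<^sup>2 = ?p x" "0 \<le> b" "b\<^sup>2 = ?q x" by (auto simp: a_def b_def heat_kernel_nonneg)
    have ab: "a * b = E * heat_kernel t (x - y /\<^sub>R 2)"
      unfolding a_def b_def real_sqrt_mult[symmetric] E by (rule heat_kernel_sqrt_product[OF t])
    have "?p x - ?q x = (a - b) * (a + b)" unfolding a(2,4)[symmetric] by (simp add: power2_eq_square algebra_simps)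
    then have "\<bar>?p x - ?q x\<bar> = \<bar>a - b\<bar> * (a + b)" using a by (simp add: abs_mult)
    also have "\<dots> \<le> (1 / (2 * \<delta>)) * (a - b)\<^sup>2 + (\<delta> / 2) * (a + b)\<^sup>2"
    proof -
      have "2 * \<delta> * (u * v) \<le> u\<^sup>2 + \<delta>\<^sup>2 * v\<^sup>2" for u v
        using zero_le_power2[of "u - \<delta> * v"] by (simp add: power2_diff power_mult_distrib mult_ac)
      from this[of "\<bar>a - b\<bar>" "a + b"]
      have "2 * \<delta> * (\<bar>a - b\<bar> * (a + b)) \<le> (a - b)\<^sup>2 + \<delta>\<^sup>2 * (a + b)\<^sup>2"
        by (simp only: power2_abs)
      then have "\<bar>a - b\<bar> * (a + b) \<le> ((a - b)\<^sup>2 + \<delta>\<^sup>2 * (a + b)\<^sup>2) / (2 * \<delta>)"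
        using \<delta> by (simp add: pos_le_divide_eq mult_ac)
      also have "\<dots> = (1 / (2 * \<delta>)) * (a - b)\<^sup>2 + (\<delta> / 2) * (a + b)\<^sup>2"
        using \<delta> by (simp add: add_divide_distrib power2_eq_square)
      finally show ?thesis .
    qed
    also have "\<dots> = (1 / (2 * \<delta>) + \<delta> / 2) * (a\<^sup>2 + b\<^sup>2) + (\<delta> - 1 / \<delta>) * (a * b)"
    proof -
      have "1 / (2 * \<delta>) = (1 / \<delta>) / 2" by simp
      then show ?thesis by algebra
    qed
    finally show ?thesis unfolding a ab .
  qed
  have ib: "integrable lborel ?b"
    by (intro Bochner_Integration.integrable_add integrable_mult_right ip iq ir)
  have "(\<integral>\<^sup>+x. ennreal \<bar>?p x - ?q x\<bar> \<partial>lborel) \<le> (\<integral>\<^sup>+x. ennreal (?b x) \<partial>lborel)"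
    by (intro nn_integral_mono ennreal_leI pointwise)
  also have "\<dots> = ennreal (\<integral>x. ?b x \<partial>lborel)"
    using order_trans[OF abs_ge_zero pointwise] by (intro nn_integral_eq_integral ib) auto
  also have "(\<integral>x. ?b x \<partial>lborel) = (1 / (2 * \<delta>) + \<delta> / 2) * 2 + (\<delta> - 1 / \<delta>) * E"
  proof -
    have "(\<integral>x. ?q x \<partial>lborel) = 1" "(\<integral>x. heat_kernel t (x - y /\<^sub>R 2) \<partial>lborel) = 1"
      using lborel_integral_minus_shift[of "heat_kernel t :: 'a \<Rightarrow> real"] heat_kernel_integral[OF t, where 'a='a] by auto
    then show ?thesis using heat_kernel_integral[OF t, where 'a='a] ip iq ir by simp
  qed
  also have "\<dots> = (1 - E) / \<delta> + \<delta> * (1 + E)"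
    using \<delta> by (simp add: field_simps)
  also have "\<dots> \<le> (\<delta>\<^sup>2 / 16) / \<delta> + \<delta> * (1 + 1)"
    using \<delta> E' by (intro add_mono divide_right_mono mult_left_mono) auto
  also have "\<dots> \<le> 3 * \<delta>" using \<delta> by (simp add: power2_eq_square)
  also have "3 * \<delta> = 3 * norm y / sqrt t" by (simp add: \<delta>_def)
  finally show ?thesis by (simp add: ennreal_leI)
qed simp

lemma levy_measure_sets: "levy_measure \<nu> \<Longrightarrow> sets \<nu> = sets borel"
  by (simp add: levy_measure_def)

lemma levy_measure_space: "levy_measure \<nu> \<Longrightarrow> space \<nu> = UNIV"
  by (metis levy_measure_sets sets_eq_imp_space_eq space_borel)

lemma levy_measure_AE_pos:
  assumes "levy_measure \<nu>" shows "AE t in \<nu>. 0 < t"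
proof -
  have "{..0} \<in> null_sets \<nu>"
    using assms by (simp add: levy_measure_def null_sets_def)
  then show ?thesis by (rule AE_I') (auto simp: levy_measure_space[OF assms])
qed

lemma levy_measure_integrable_min:
  assumes "levy_measure \<nu>" shows "integrable \<nu> (\<lambda>t. min 1 t)"
proof (rule integrableI_bounded)
  note [measurable_cong] = levy_measure_sets[OF assms]
  show "(\<lambda>t. min 1 t) \<in> borel_measurable \<nu>" by measurable
  have "(\<integral>\<^sup>+t. ennreal (norm (min 1 t)) \<partial>\<nu>) = (\<integral>\<^sup>+t. ennreal (min 1 t) \<partial>\<nu>)"
    by (intro nn_integral_cong_AE) (use levy_measure_AE_pos[OF assms] in \<open>auto elim!: eventually_mono\<close>)
  then show "(\<integral>\<^sup>+t. ennreal (norm (min 1 t)) \<partial>\<nu>) < \<infinity>" using assms by (simp add: levy_measure_def)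
qed

lemma levy_measure_tail_finite:
  assumes \<nu>: "levy_measure \<nu>" and s: "0 < s"
  shows "emeasure \<nu> {s<..} < \<infinity>"
proof -
  note [measurable_cong] = levy_measure_sets[OF \<nu>]
  have "ennreal (min 1 s) * emeasure \<nu> {s<..} = (\<integral>\<^sup>+t. ennreal (min 1 s) * indicator {s<..} t \<partial>\<nu>)"
    by (subst nn_integral_cmult_indicator) (auto simp: levy_measure_sets[OF \<nu>])
  also have "\<dots> \<le> (\<integral>\<^sup>+t. ennreal (min 1 t) \<partial>\<nu>)"
    by (intro nn_integral_mono) (auto split: split_indicator intro!: ennreal_leI)
  also have "\<dots> < \<infinity>" using \<nu> by (simp add: levy_measure_def)
  finally show ?thesis using s by (auto simp: ennreal_mult_less_top)
qed

lemma levy_measure_sigma_finite: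
  assumes \<nu>: "levy_measure \<nu>" shows "sigma_finite_measure \<nu>"
proof
  let ?S = "insert {..0} (range (\<lambda>n. {1 / real (Suc n)<..}))"
  show "\<exists>A. countable A \<and> A \<subseteq> sets \<nu> \<and> \<Union>A = space \<nu> \<and> (\<forall>a\<in>A. emeasure \<nu> a \<noteq> \<infinity>)"
  proof (intro exI[of _ ?S] conjI ballI)
    show "?S \<subseteq> sets \<nu>" by (auto simp: levy_measure_sets[OF \<nu>])
    have "x \<in> \<Union>?S" for x :: real
    proof (cases "x \<le> 0")
      case False
      then obtain n where "inverse (real (Suc n)) < x" using reals_Archimedean[of x] by auto
      then show ?thesis by (auto simp: inverse_eq_divide)
    qed auto
    then show "\<Union>?S = space \<nu>" using levy_measure_space[OF \<nu>] by auto
    fix a assume "a \<in> ?S"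
    then show "emeasure \<nu> a \<noteq> \<infinity>"
      using \<nu> levy_measure_tail_finite[OF \<nu>] by (auto simp: levy_measure_def less_top)
  qed auto
qed

lemma one_minus_exp_bound:
  fixes s t :: real
  assumes "0 \<le> s" "0 < t"
  shows "0 \<le> 1 - exp (- (s * t))" "1 - exp (- (s * t)) \<le> max 1 s * min 1 t"
proof -
  have "0 \<le> s * t" using assms by simp
  then show "0 \<le> 1 - exp (- (s * t))" by simp
  have "1 - exp (- (s * t)) \<le> s * t" using exp_ge_add_one_self[of "- (s * t)"] by simp
  also have "s * t \<le> max 1 s * t" using assms by (intro mult_right_mono) auto
  finally show "1 - exp (- (s * t)) \<le> max 1 s * min 1 t"
    by (cases "t \<le> 1") (auto simp: min_def max_def intro: order_trans[of _ 1])
qed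

lemma laplace_exponent_integrable:
  assumes \<nu>: "levy_measure \<nu>" and s: "0 \<le> s"
  shows "integrable \<nu> (\<lambda>t. 1 - exp (- (s * t)))"
proof (rule Bochner_Integration.integrable_bound[OF integrable_mult_right[OF levy_measure_integrable_min[OF \<nu>], of "max 1 s"]])
  note [measurable_cong] = levy_measure_sets[OF \<nu>]
  show "(\<lambda>t. 1 - exp (- (s * t))) \<in> borel_measurable \<nu>" by measurable
  show "AE t in \<nu>. norm (1 - exp (- (s * t))) \<le> norm (max 1 s * min 1 t)"
    using levy_measure_AE_pos[OF \<nu>]
  proof eventually_elim
    case (elim t)
    then show ?case using one_minus_exp_bound[OF s elim] by (simp del: exp_le_cancel_iff)
  qed
qed

lemma laplace_exponent_mono:
  assumes \<nu>: "levy_measure \<nu>" and s: "0 \<le> s" "s \<le> s'"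
  shows "laplace_exponent \<nu> s \<le> laplace_exponent \<nu> s'"
  unfolding laplace_exponent_def
proof (rule integral_mono_AE)
  show "AE t in \<nu>. 1 - exp (- (s * t)) \<le> 1 - exp (- (s' * t))"
    using levy_measure_AE_pos[OF \<nu>] by eventually_elim (use s in simp)
qed (use \<nu> s in \<open>auto intro!: laplace_exponent_integrable\<close>)

lemma laplace_exponent_continuous_on:
  assumes \<nu>: "levy_measure \<nu>"
  shows "continuous_on {0..} (laplace_exponent \<nu>)"
  unfolding continuous_on_sequentially
proof (intro allI ballI impI)
  note [measurable_cong] = levy_measure_sets[OF \<nu>]
  fix x :: "nat \<Rightarrow> real" and a :: real
  assume a: "a \<in> {0..}" and x: "(\<forall>n. x n \<in> {0..}) \<and> x \<longlonglongrightarrow> a"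
  have "Bseq x" using x by (intro convergent_imp_Bseq) (auto simp: convergent_def)
  then obtain b where "\<And>n. norm (x n) \<le> b" by (metis BseqE)
  then have b: "x n \<le> b" for n by (metis abs_le_D1 real_norm_def)
  have "(\<lambda>n. \<integral>t. (1 - exp (- (x n * t))) \<partial>\<nu>) \<longlonglongrightarrow> (\<integral>t. (1 - exp (- (a * t))) \<partial>\<nu>)"
  proof (rule integral_dominated_convergence[where w="\<lambda>t. max 1 b * min 1 t"])
    show "integrable \<nu> (\<lambda>t. max 1 b * min 1 t)"
      by (intro integrable_mult_right levy_measure_integrable_min \<nu>)
    show "AE t in \<nu>. (\<lambda>n. 1 - exp (- (x n * t))) \<longlonglongrightarrow> 1 - exp (- (a * t))"
      using x by (intro AE_I2 tendsto_intros) auto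
    show "AE t in \<nu>. norm (1 - exp (- (x n * t))) \<le> max 1 b * min 1 t" for n
      using levy_measure_AE_pos[OF \<nu>]
    proof eventually_elim
      case (elim t)
      have "0 \<le> x n" using x by simp
      have "max 1 (x n) * min 1 t \<le> max 1 b * min 1 t"
        using elim b[of n] by (intro mult_right_mono) auto
      then show ?case using one_minus_exp_bound[OF \<open>0 \<le> x n\<close> elim] by (simp del: exp_le_cancel_iff)
    qed
  qed measurable
  then show "(laplace_exponent \<nu> \<circ> x) \<longlonglongrightarrow> laplace_exponent \<nu> a"
    by (simp add: laplace_exponent_def o_def)
qed

text \<open>The intermediate value theorem on \<open>[0, b]\<close>, where \<open>b\<close> exists because the Laplace exponent is unbounded. In this way
\<open>inv_into\<close> is a genuine right inverse on the positive half line.\<close>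

lemma psi_inv:
  assumes \<nu>: "levy_measure \<nu>" and top: "filterlim (laplace_exponent \<nu>) at_top at_top" and y: "0 < y"
  shows "0 < psi_inv \<nu> y" "psi \<nu> (psi_inv \<nu> y) = y"
proof -
  have "\<forall>\<^sub>F b in at_top. y \<le> laplace_exponent \<nu> b" using top by (simp add: filterlim_at_top)
  then obtain N where "\<And>b. N \<le> b \<Longrightarrow> y \<le> laplace_exponent \<nu> b" by (auto simp: eventually_at_top_linorder)
  then have b: "0 \<le> max 0 N" "y \<le> laplace_exponent \<nu> (max 0 N)" by auto
  define b where "b = max 0 N"
  note b = b[folded b_def]
  have "continuous_on {0..b} (laplace_exponent \<nu>)"
    by (rule continuous_on_subset[OF laplace_exponent_continuous_on[OF \<nu>]]) auto
  moreover have z: "laplace_exponent \<nu> 0 = 0" by (simp add: laplace_exponent_def)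
  ultimately obtain x where x: "0 \<le> x" "laplace_exponent \<nu> x = y"
    using IVT'[of "laplace_exponent \<nu>" 0 y b] b y by auto
  then have "0 < x" using y z by (cases "x = 0") auto
  then have "sqrt x \<in> {0<..}" "psi \<nu> (sqrt x) = y" using x by (auto simp: psi_def)
  then have y': "y \<in> psi \<nu> ` {0<..}" by blast
  show "psi \<nu> (psi_inv \<nu> y) = y" unfolding psi_inv_def by (rule f_inv_into_f[OF y'])
  show "0 < psi_inv \<nu> y" using inv_into_into[OF y'] unfolding psi_inv_def by simp
qed

lemma psi_inv_greater:
  assumes \<nu>: "levy_measure \<nu>" and top: "filterlim (laplace_exponent \<nu>) at_top at_top" and y: "0 < y"
    and s: "0 \<le> s" "laplace_exponent \<nu> s < y"
  shows "s < (psi_inv \<nu> y)\<^sup>2"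
proof (rule ccontr)
  assume "\<not> s < (psi_inv \<nu> y)\<^sup>2"
  then have "laplace_exponent \<nu> ((psi_inv \<nu> y)\<^sup>2) \<le> laplace_exponent \<nu> s"
    by (intro laplace_exponent_mono[OF \<nu>]) auto
  then show False using psi_inv(2)[OF \<nu> top y] s by (simp add: psi_def)
qed

lemma psi_inv_mono:
  assumes \<nu>: "levy_measure \<nu>" and top: "filterlim (laplace_exponent \<nu>) at_top at_top" and y: "0 < y" "y < y'"
  shows "psi_inv \<nu> y < psi_inv \<nu> y'"
proof -
  have "laplace_exponent \<nu> ((psi_inv \<nu> y)\<^sup>2) < y'" using psi_inv(2)[OF \<nu> top y(1)] y by (simp add: psi_def)
  then have "(psi_inv \<nu> y)\<^sup>2 < (psi_inv \<nu> y')\<^sup>2"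
    using y by (intro psi_inv_greater[OF \<nu> top]) auto
  moreover have "0 \<le> psi_inv \<nu> y'" using psi_inv(1)[OF \<nu> top, of y'] y by simp
  ultimately show ?thesis by (rule power_less_imp_less_base)
qed

text \<open>For \<open>t \<le> M / s\<close> one has \<open>1 - exp (- s t) \<le> exp M (exp (- s t) - exp (- 2 s t))\<close>, whose integral is
\<open>exp M (\<phi>(2 s) - \<phi>(s))\<close> and hence \<open>o(\<phi>(s))\<close> by slow variation. The times \<open>t > \<tau>\<close> contribute at most a
constant, which is negligible because \<open>\<phi>\<close> is unbounded. So at least half of \<open>\<phi>(s)\<close> comes from the times in between, where
the integrand is at most one.\<close>

lemma laplace_exponent_mass:
  assumes \<nu>: "levy_measure \<nu>" and sv: "slowly_varying (laplace_exponent \<nu>)"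
    and top: "filterlim (laplace_exponent \<nu>) at_top at_top" and M: "0 < M" and \<tau>: "0 < \<tau>"
  shows "\<exists>s\<^sub>0>0. \<forall>s\<ge>s\<^sub>0. laplace_exponent \<nu> s / 2 \<le> measure \<nu> {M / s<..\<tau>}"
proof -
  note [measurable_cong] = levy_measure_sets[OF \<nu>]
  let ?\<phi> = "laplace_exponent \<nu>"
  define T where "T = measure \<nu> {\<tau><..}"
  have main: "?\<phi> s \<le> exp M * (?\<phi> (2 * s) - ?\<phi> s) + measure \<nu> {M / s<..\<tau>} + T" if s: "0 < s" for s
  proof -
    have fin1: "emeasure \<nu> {M / s<..\<tau>} < \<infinity>"
      using M s by (intro le_less_trans[OF _ levy_measure_tail_finite[OF \<nu>, of "M / s"]] emeasure_mono)
        (auto simp: levy_measure_sets[OF \<nu>])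
    have fin2: "emeasure \<nu> {\<tau><..} < \<infinity>" by (rule levy_measure_tail_finite[OF \<nu> \<tau>])
    have i1: "integrable \<nu> (indicator {M / s<..\<tau>} :: real \<Rightarrow> real)"
      using fin1 by (intro integrable_real_indicator) (auto simp: levy_measure_sets[OF \<nu>])
    have i2: "integrable \<nu> (indicator {\<tau><..} :: real \<Rightarrow> real)"
      using fin2 by (intro integrable_real_indicator) (auto simp: levy_measure_sets[OF \<nu>])
    have j1: "integrable \<nu> (\<lambda>t. 1 - exp (- (s * t)))" and j2: "integrable \<nu> (\<lambda>t. 1 - exp (- (2 * s * t)))"
      using s by (auto intro!: laplace_exponent_integrable[OF \<nu>])
    have "?\<phi> s \<le> (\<integral>t. exp M * ((1 - exp (- (2 * s * t))) - (1 - exp (- (s * t)))) + indicator {M / s<..\<tau>} t + indicator {\<tau><..} t \<partial>\<nu>)"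
      unfolding laplace_exponent_def
    proof (rule integral_mono_AE[OF j1])
      show "integrable \<nu> (\<lambda>t. exp M * ((1 - exp (- (2 * s * t))) - (1 - exp (- (s * t)))) + indicator {M / s<..\<tau>} t + indicator {\<tau><..} t)"
        by (intro Bochner_Integration.integrable_add integrable_mult_right Bochner_Integration.integrable_diff i1 i2 j1 j2)
      show "AE t in \<nu>. 1 - exp (- (s * t)) \<le> exp M * ((1 - exp (- (2 * s * t))) - (1 - exp (- (s * t)))) + indicator {M / s<..\<tau>} t + indicator {\<tau><..} t"
        using levy_measure_AE_pos[OF \<nu>]
      proof eventually_elim
        case (elim t)
        define e where "e = exp (- (s * t))"
        have e: "0 < e" "e \<le> 1" using elim s by (auto simp: e_def)
        have e2: "exp (- (2 * s * t)) = e * e" by (simp add: e_def exp_add[symmetric])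
        have nn: "0 \<le> exp M * (e - e * e)" using e by (simp add: mult_le_one mult_left_le)
        show ?case
        proof (cases "t \<le> M / s")
          case True
          then have "s * t \<le> M" using s by (simp add: pos_le_divide_eq mult.commute)
          then have "1 \<le> exp M * e" by (simp add: e_def exp_add[symmetric])
          then have "1 * (1 - e) \<le> (exp M * e) * (1 - e)" using e by (intro mult_right_mono) auto
          then have "1 - e \<le> exp M * (e - e * e)" by (simp add: algebra_simps)
          then show ?thesis unfolding e2 e_def[symmetric] by (simp add: add_nonneg_nonneg add_increasing2)
        next
          case False
          then have "indicator {M / s<..\<tau>} t + indicator {\<tau><..} t = (1::real)" by (auto split: split_indicator)
          moreover have "exp M * ((1 - e * e) - (1 - e)) = exp M * (e - e * e)" by simp
          ultimately show ?thesis unfolding e2 e_def[symmetric] using nn e by linarith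
        qed
      qed
    qed
    also have "\<dots> = exp M * (?\<phi> (2 * s) - ?\<phi> s) + measure \<nu> {M / s<..\<tau>} + T"
    proof -
      have k: "integrable \<nu> (\<lambda>t. exp M * ((1 - exp (- (2 * s * t))) - (1 - exp (- (s * t)))))"
        by (intro integrable_mult_right Bochner_Integration.integrable_diff j1 j2)
      show ?thesis
        unfolding laplace_exponent_def T_def Bochner_Integration.integral_add[OF Bochner_Integration.integrable_add[OF k i1] i2]
          Bochner_Integration.integral_add[OF k i1] integral_mult_right_zero Bochner_Integration.integral_diff[OF j2 j1]
        by (simp add: levy_measure_space[OF \<nu>])
    qed
    finally show ?thesis .
  qed
  have lim: "((\<lambda>s. ?\<phi> (2 * s) / ?\<phi> s) \<longlongrightarrow> 1) at_top" and pos: "\<And>s. 0 < s \<Longrightarrow> 0 < ?\<phi> s"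
    using sv by (auto simp: slowly_varying_def)
  have "\<forall>\<^sub>F s in at_top. ?\<phi> (2 * s) / ?\<phi> s < 1 + exp (- M) / 4"
    using lim by (rule order_tendstoD) simp
  moreover have "\<forall>\<^sub>F s in at_top. 4 * T \<le> ?\<phi> s" using top by (simp add: filterlim_at_top)
  ultimately have "\<forall>\<^sub>F s in at_top. ?\<phi> s / 2 \<le> measure \<nu> {M / s<..\<tau>}"
    using eventually_gt_at_top[of 0]
  proof eventually_elim
    case (elim s)
    have p: "0 < ?\<phi> s" using pos elim by simp
    then have "?\<phi> (2 * s) - ?\<phi> s < exp (- M) / 4 * ?\<phi> s"
      using elim by (simp add: pos_divide_less_eq algebra_simps)
    then have "exp M * (?\<phi> (2 * s) - ?\<phi> s) \<le> exp M * (exp (- M) / 4 * ?\<phi> s)" by (intro mult_left_mono) auto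
    also have "\<dots> = ?\<phi> s / 4" by (simp add: exp_minus)
    finally show ?case using main[of s] elim by linarith
  qed
  then obtain s0 where "\<forall>s\<ge>s0. ?\<phi> s / 2 \<le> measure \<nu> {M / s<..\<tau>}" by (auto simp: eventually_at_top_linorder)
  then show ?thesis by (intro exI[of _ "max s0 1"]) auto
qed

section \<open>The jump kernel as a mixture of heat kernels\<close>

lemma jump_kernel_eq: "jump_kernel \<nu> z = (\<integral>t. heat_kernel t z \<partial>\<nu>)"
  by (simp add: jump_kernel_def heat_kernel_def)

lemma jump_kernel_nonneg: "0 \<le> jump_kernel \<nu> z"
  by (simp add: jump_kernel_eq heat_kernel_nonneg)

lemma jump_kernel_measurable:
  assumes \<nu>: "levy_measure \<nu>"
  shows "(jump_kernel \<nu> :: 'a::euclidean_space \<Rightarrow> real) \<in> borel_measurable borel"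
proof -
  interpret sigma_finite_measure \<nu> by (rule levy_measure_sigma_finite[OF \<nu>])
  note [measurable_cong] = levy_measure_sets[OF \<nu>]
  show ?thesis unfolding jump_kernel_eq[abs_def] by measurable
qed

text \<open>For fixed \<open>z \<noteq> 0\<close> the heat kernel vanishes faster than any power of \<open>t\<close> as \<open>t\<close> tends to zero and is bounded for large
\<open>t\<close>, so it is dominated by a multiple of \<open>min 1 t\<close>.\<close>

lemma heat_kernel_levy_integrable:
  fixes z :: "'a::euclidean_space"
  assumes \<nu>: "levy_measure \<nu>" and z: "z \<noteq> 0"
  shows "integrable \<nu> (\<lambda>t. heat_kernel t z)"
proof -
  note [measurable_cong] = levy_measure_sets[OF \<nu>]
  let ?d = "DIM('a)"
  let ?a = "real ?d / 2"
  \<comment> \<open>Any exponent that is at least \<open>DIM('a) / 2 + 1\<close> would do.\<close>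
  define n where "n = ?d + 1"
  define w where "w = (norm z)\<^sup>2"
  have w: "0 < w" using z by (simp add: w_def)
  define K where "K = real n * (4 / w)"
  have K0: "0 \<le> K ^ n" using w by (simp add: K_def)
  define C where "C = (4 * pi) powr (- ?a) * (K ^ n + 1)"
  have bound: "heat_kernel t z \<le> C * min 1 t" if t: "0 < t" for t
  proof -
    have split: "(4 * pi * t) powr (- ?a) = (4 * pi) powr (- ?a) * t powr (- ?a)"
      using t by (intro powr_mult)
    show ?thesis
    proof (cases "t \<le> 1")
      case True
      \<comment> \<open>\<open>exp x \<ge> (x / n) ^ n\<close> beats the singularity of the prefactor at \<open>t = 0\<close>.\<close>
      define x where "x = w / (4 * t)"
      have x: "0 < x" using w t by (simp add: x_def)
      have n: "0 < real n" by (simp add: n_def)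
      have "x / real n \<le> exp (x / real n)"
        using exp_ge_add_one_self[of "x / real n"] by linarith
      then have "(x / real n) ^ n \<le> exp (x / real n) ^ n"
        using x n by (intro power_mono) auto
      also have "\<dots> = exp x" using n by (simp add: exp_of_nat_mult[symmetric])
      finally have "inverse (exp x) \<le> inverse ((x / real n) ^ n)"
        using x n by (intro le_imp_inverse_le) auto
      also have "\<dots> = (K * t) ^ n" using w t n by (simp add: x_def K_def power_inverse[symmetric] mult_ac)
      finally have "exp (- (w / (4 * t))) \<le> K ^ n * t ^ n"
        by (simp add: x_def exp_minus power_mult_distrib)
      then have "heat_kernel t z \<le> (4 * pi) powr (- ?a) * (t powr (- ?a) * (K ^ n * t ^ n))"
        unfolding heat_kernel_def split w_def[symmetric] unfolding mult.assoc by (intro mult_left_mono) auto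
      also have "t powr (- ?a) * (K ^ n * t ^ n) = K ^ n * (t powr (- ?a) * t powr real n)"
        using t by (simp add: powr_realpow)
      also have "t powr (- ?a) * t powr real n = t powr (real n - ?a)" by (simp add: powr_add[symmetric])
      also have "t powr (real n - ?a) \<le> t powr 1"
        using t True by (intro powr_mono') (auto simp: n_def)
      finally have "heat_kernel t z \<le> (4 * pi) powr (- ?a) * (K ^ n * t)"
        using t K0 by (simp add: mult_left_mono)
      also have "\<dots> \<le> (4 * pi) powr (- ?a) * ((K ^ n + 1) * t)"
        using t by (intro mult_left_mono mult_right_mono) auto
      also have "\<dots> = C * min 1 t" using True by (simp add: C_def)
      finally show ?thesis .
    next
      case False
      have "t powr (- ?a) \<le> 1" using False by (simp add: powr_minus inverse_eq_divide ge_one_powr_ge_zero)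
      then have "(4 * pi * t) powr (- ?a) \<le> (4 * pi) powr (- ?a) * 1"
        unfolding split by (intro mult_left_mono) auto
      moreover have "exp (- (w / (4 * t))) \<le> 1" using w t by simp
      ultimately have "heat_kernel t z \<le> ((4 * pi) powr (- ?a) * 1) * 1"
        unfolding heat_kernel_def w_def[symmetric] by (intro mult_mono) auto
      also have "\<dots> \<le> C"
        using K0 by (simp add: C_def algebra_simps)
      finally show ?thesis using False by simp
    qed
  qed
  show ?thesis
  proof (rule Bochner_Integration.integrable_bound[OF integrable_mult_right[OF levy_measure_integrable_min[OF \<nu>], of C]])
    show "(\<lambda>t. heat_kernel t z) \<in> borel_measurable \<nu>" by measurable
    show "AE t in \<nu>. norm (heat_kernel t z) \<le> norm (C * min 1 t)"
      using levy_measure_AE_pos[OF \<nu>]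
    proof eventually_elim
      case (elim t)
      then show ?case using bound[OF elim] heat_kernel_nonneg[of t z] by simp
    qed
  qed
qed

text \<open>The part of the jump kernel that stems from the times between \<open>s\<close> and \<open>\<tau>\<close>. Times below \<open>s\<close> are left out because their
heat kernels are not smooth on the scale of interest, times above \<open>\<tau>\<close> because their heat kernels reach beyond the
region where the coefficient is known to be positive.\<close>

definition truncated_kernel :: "real measure \<Rightarrow> real \<Rightarrow> real \<Rightarrow> 'a::euclidean_space \<Rightarrow> real" where
  "truncated_kernel \<nu> s \<tau> z = (\<integral>t. indicator {s<..\<tau>} t * heat_kernel t z \<partial>\<nu>)"

lemma levy_measure_Ioc_finite:
  assumes \<nu>: "levy_measure \<nu>" and s: "0 < s"
  shows "emeasure \<nu> {s<..\<tau>} = ennreal (measure \<nu> {s<..\<tau>})"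
proof -
  have "emeasure \<nu> {s<..\<tau>} \<le> emeasure \<nu> {s<..}"
    by (intro emeasure_mono) (auto simp: levy_measure_sets[OF \<nu>])
  then show ?thesis
    using levy_measure_tail_finite[OF \<nu> s] by (intro emeasure_eq_ennreal_measure) (auto simp: top_unique)
qed

lemma truncated_kernel_nonneg: "0 \<le> truncated_kernel \<nu> s \<tau> z"
  by (simp add: truncated_kernel_def heat_kernel_nonneg)

lemma truncated_kernel_integrand_integrable:
  fixes z :: "'a::euclidean_space"
  assumes \<nu>: "levy_measure \<nu>" and s: "0 < s"
  shows "integrable \<nu> (\<lambda>t. indicator {s<..\<tau>} t * heat_kernel t z)"
proof -
  note [measurable_cong] = levy_measure_sets[OF \<nu>]
  have i: "integrable \<nu> (indicator {s<..\<tau>} :: real \<Rightarrow> real)"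
    using levy_measure_Ioc_finite[OF \<nu> s] by (intro integrable_real_indicator) (auto simp: levy_measure_sets[OF \<nu>])
  let ?a = "real DIM('a) / 2"
  show ?thesis
  proof (rule Bochner_Integration.integrable_bound[OF integrable_mult_right[OF i, of "(4 * pi * s) powr (- ?a)"]])
    show "AE t in \<nu>. norm (indicator {s<..\<tau>} t * heat_kernel t z) \<le> norm ((4 * pi * s) powr (- ?a) * indicator {s<..\<tau>} t)"
    proof (rule AE_I2)
      fix t
      show "norm (indicator {s<..\<tau>} t * heat_kernel t z) \<le> norm ((4 * pi * s) powr (- ?a) * indicator {s<..\<tau>} t)"
      proof (cases "t \<in> {s<..\<tau>}")
        case True
        then have t: "s < t" by simp
        have "(4 * pi * t) powr (- ?a) \<le> (4 * pi * s) powr (- ?a)"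
          using s t by (intro powr_mono2') auto
        moreover have "exp (- ((norm z)\<^sup>2 / (4 * t))) \<le> 1" using s t by simp
        ultimately have "heat_kernel t z \<le> (4 * pi * s) powr (- ?a) * 1"
          unfolding heat_kernel_def by (intro mult_mono) auto
        then show ?thesis using heat_kernel_nonneg[of t z] True by simp
      qed simp
    qed
  qed measurable
qed

lemma truncated_kernel_le_jump_kernel:
  fixes z :: "'a::euclidean_space"
  assumes \<nu>: "levy_measure \<nu>" and s: "0 < s" and z: "z \<noteq> 0"
  shows "truncated_kernel \<nu> s \<tau> z \<le> jump_kernel \<nu> z"
  unfolding truncated_kernel_def jump_kernel_eq
  by (intro integral_mono truncated_kernel_integrand_integrable heat_kernel_levy_integrable assms)
    (auto split: split_indicator simp: heat_kernel_nonneg)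

lemma truncated_kernel_measurable:
  assumes \<nu>: "levy_measure \<nu>"
  shows "(truncated_kernel \<nu> s \<tau> :: 'a::euclidean_space \<Rightarrow> real) \<in> borel_measurable borel"
proof -
  interpret sigma_finite_measure \<nu> by (rule levy_measure_sigma_finite[OF \<nu>])
  note [measurable_cong] = levy_measure_sets[OF \<nu>]
  show ?thesis unfolding truncated_kernel_def[abs_def] by measurable
qed

text \<open>Tonelli's theorem moves an estimate for a single heat kernel to the mixture.\<close>

lemma truncated_kernel_weighted:
  fixes h :: "'a::euclidean_space \<Rightarrow> real"
  assumes \<nu>: "levy_measure \<nu>" and s: "0 < s" and [measurable]: "h \<in> borel_measurable borel" and h: "\<And>z. 0 \<le> h z"
    and c: "0 \<le> c" "\<And>t. s < t \<Longrightarrow> t \<le> \<tau> \<Longrightarrow> (\<integral>\<^sup>+z. ennreal (h z * heat_kernel t z) \<partial>lborel) \<le> ennreal c"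
  shows "(\<integral>\<^sup>+z. ennreal (h z * truncated_kernel \<nu> s \<tau> z) \<partial>lborel) \<le> ennreal (c * measure \<nu> {s<..\<tau>})"
proof -
  note [measurable_cong] = levy_measure_sets[OF \<nu>]
  interpret \<nu>: sigma_finite_measure \<nu> by (rule levy_measure_sigma_finite[OF \<nu>])
  interpret P: pair_sigma_finite "lborel :: 'a measure" \<nu> ..
  have "(\<integral>\<^sup>+z. ennreal (h z * truncated_kernel \<nu> s \<tau> z) \<partial>lborel) = (\<integral>\<^sup>+z. (\<integral>\<^sup>+t. ennreal (h z * (indicator {s<..\<tau>} t * heat_kernel t z)) \<partial>\<nu>) \<partial>lborel)"
  proof (intro nn_integral_cong)
    fix z :: 'a
    have "(\<integral>\<^sup>+t. ennreal (h z * (indicator {s<..\<tau>} t * heat_kernel t z)) \<partial>\<nu>) = ennreal (\<integral>t. h z * (indicator {s<..\<tau>} t * heat_kernel t z) \<partial>\<nu>)"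
      by (intro nn_integral_eq_integral integrable_mult_right truncated_kernel_integrand_integrable[OF \<nu> s]) (simp add: h heat_kernel_nonneg)
    then show "ennreal (h z * truncated_kernel \<nu> s \<tau> z) = (\<integral>\<^sup>+t. ennreal (h z * (indicator {s<..\<tau>} t * heat_kernel t z)) \<partial>\<nu>)"
      by (simp add: truncated_kernel_def)
  qed
  also have "\<dots> = (\<integral>\<^sup>+t. (\<integral>\<^sup>+z. ennreal (h z * (indicator {s<..\<tau>} t * heat_kernel t z)) \<partial>lborel) \<partial>\<nu>)"
    by (rule P.Fubini'[symmetric]) measurable
  also have "\<dots> \<le> (\<integral>\<^sup>+t. ennreal c * indicator {s<..\<tau>} t \<partial>\<nu>)"
  proof (intro nn_integral_mono)
    fix t
    show "(\<integral>\<^sup>+z. ennreal (h z * (indicator {s<..\<tau>} t * heat_kernel t z)) \<partial>lborel) \<le> ennreal c * indicator {s<..\<tau>} t"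
      using c(2)[of t] by (auto split: split_indicator)
  qed
  also have "\<dots> = ennreal c * emeasure \<nu> {s<..\<tau>}"
    by (intro nn_integral_cmult_indicator) (simp add: levy_measure_sets[OF \<nu>])
  also have "\<dots> = ennreal (c * measure \<nu> {s<..\<tau>})"
    using c(1) by (simp add: levy_measure_Ioc_finite[OF \<nu> s] ennreal_mult)
  finally show ?thesis .
qed

lemma
  assumes \<nu>: "levy_measure \<nu>" and s: "0 < s"
  shows truncated_kernel_integrable: "integrable lborel (truncated_kernel \<nu> s \<tau> :: 'a::euclidean_space \<Rightarrow> real)"
    and truncated_kernel_integral: "(\<integral>z. truncated_kernel \<nu> s \<tau> (z::'a) \<partial>lborel) = measure \<nu> {s<..\<tau>}"
proof -
  note [measurable_cong] = levy_measure_sets[OF \<nu>]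
  interpret \<nu>: sigma_finite_measure \<nu> by (rule levy_measure_sigma_finite[OF \<nu>])
  interpret P: pair_sigma_finite \<nu> "lborel :: 'a measure" ..
  have pair: "integrable (\<nu> \<Otimes>\<^sub>M lborel) (\<lambda>(t, z). indicator {s<..\<tau>} t * heat_kernel t (z::'a))"
  proof (rule P.integrable_pairI_nn)
    have "(\<integral>\<^sup>+t. (\<integral>\<^sup>+z. ennreal (norm (indicator {s<..\<tau>} t * heat_kernel t (z::'a))) \<partial>lborel) \<partial>\<nu>) = (\<integral>\<^sup>+t. indicator {s<..\<tau>} t \<partial>\<nu>)"
    proof (intro nn_integral_cong)
      fix t
      show "(\<integral>\<^sup>+z. ennreal (norm (indicator {s<..\<tau>} t * heat_kernel t (z::'a))) \<partial>lborel) = indicator {s<..\<tau>} t"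
        using heat_kernel_nn_integral[of t, where 'a='a] s by (auto split: split_indicator simp: heat_kernel_nonneg)
    qed
    also have "\<dots> < \<infinity>" using levy_measure_Ioc_finite[OF \<nu> s, of \<tau>] by (simp add: levy_measure_sets[OF \<nu>])
    finally show "(\<integral>\<^sup>+t. (\<integral>\<^sup>+z. ennreal (norm (indicator {s<..\<tau>} t * heat_kernel t (z::'a))) \<partial>lborel) \<partial>\<nu>) < \<infinity>" .
  qed measurable
  show "integrable lborel (truncated_kernel \<nu> s \<tau> :: 'a \<Rightarrow> real)"
    unfolding truncated_kernel_def[abs_def] by (rule P.integrable_snd[OF pair])
  have "(\<integral>z. truncated_kernel \<nu> s \<tau> (z::'a) \<partial>lborel) = (\<integral>t. (\<integral>z. indicator {s<..\<tau>} t * heat_kernel t (z::'a) \<partial>lborel) \<partial>\<nu>)"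
    unfolding truncated_kernel_def by (rule P.Fubini_integral[OF pair])
  also have "\<dots> = (\<integral>t. indicator {s<..\<tau>} t \<partial>\<nu>)"
    using s heat_kernel_integral[where 'a='a] by (intro Bochner_Integration.integral_cong) (auto split: split_indicator)
  also have "\<dots> = measure \<nu> {s<..\<tau>}" by (simp add: levy_measure_space[OF \<nu>])
  finally show "(\<integral>z. truncated_kernel \<nu> s \<tau> (z::'a) \<partial>lborel) = measure \<nu> {s<..\<tau>}" .
qed

lemma truncated_kernel_tail:
  assumes \<nu>: "levy_measure \<nu>" and s: "0 < s" and \<rho>: "0 < \<rho>" and \<tau>: "0 < \<tau>"
  shows "(\<integral>\<^sup>+z. ennreal (indicator {z::'a::euclidean_space. \<rho> \<le> norm z} z * truncated_kernel \<nu> s \<tau> z) \<partial>lborel)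
    \<le> ennreal (2 powr (real DIM('a) / 2) * exp (- (\<rho>\<^sup>2 / (8 * \<tau>))) * measure \<nu> {s<..\<tau>})"
proof (rule truncated_kernel_weighted[OF \<nu> s])
  fix t assume t: "s < t" "t \<le> \<tau>"
  have "(\<integral>\<^sup>+z. ennreal (indicator {z::'a. \<rho> \<le> norm z} z * heat_kernel t z) \<partial>lborel) \<le> ennreal (2 powr (real DIM('a) / 2) * exp (- (\<rho>\<^sup>2 / (8 * t))))"
    using s t \<rho> by (intro heat_kernel_tail_integral) auto
  also have "\<dots> \<le> ennreal (2 powr (real DIM('a) / 2) * exp (- (\<rho>\<^sup>2 / (8 * \<tau>))))"
    using s t \<rho> by (intro ennreal_leI mult_left_mono) (auto intro!: divide_left_mono)
  finally show "(\<integral>\<^sup>+z. ennreal (indicator {z::'a. \<rho> \<le> norm z} z * heat_kernel t z) \<partial>lborel) \<le> ennreal (2 powr (real DIM('a) / 2) * exp (- (\<rho>\<^sup>2 / (8 * \<tau>))))" .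
qed auto

text \<open>The modulus of continuity of each heat kernel is at most the one at the smallest time \<open>s\<close>.\<close>

lemma truncated_kernel_translation:
  fixes y :: "'a::euclidean_space"
  assumes \<nu>: "levy_measure \<nu>" and s: "0 < s"
  shows "(\<integral>x. \<bar>truncated_kernel \<nu> s \<tau> x - truncated_kernel \<nu> s \<tau> (x - y)\<bar> \<partial>lborel) \<le> 3 * norm y / sqrt s * measure \<nu> {s<..\<tau>}"
proof -
  note [measurable_cong] = levy_measure_sets[OF \<nu>]
  note [measurable] = truncated_kernel_measurable[OF \<nu>]
  interpret \<nu>: sigma_finite_measure \<nu> by (rule levy_measure_sigma_finite[OF \<nu>])
  interpret P: pair_sigma_finite "lborel :: 'a measure" \<nu> ..
  let ?c = "3 * norm y / sqrt s"
  have "(\<integral>\<^sup>+x. ennreal \<bar>truncated_kernel \<nu> s \<tau> x - truncated_kernel \<nu> s \<tau> (x - y)\<bar> \<partial>lborel) \<le>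
    (\<integral>\<^sup>+x. (\<integral>\<^sup>+t. indicator {s<..\<tau>} t * ennreal \<bar>heat_kernel t x - heat_kernel t (x - y)\<bar> \<partial>\<nu>) \<partial>lborel)"
  proof (intro nn_integral_mono)
    fix x :: 'a
    have "truncated_kernel \<nu> s \<tau> x - truncated_kernel \<nu> s \<tau> (x - y) =
      (\<integral>t. indicator {s<..\<tau>} t * heat_kernel t x - indicator {s<..\<tau>} t * heat_kernel t (x - y) \<partial>\<nu>)"
      unfolding truncated_kernel_def
      by (intro Bochner_Integration.integral_diff[symmetric] truncated_kernel_integrand_integrable[OF \<nu> s])
    then have "ennreal \<bar>truncated_kernel \<nu> s \<tau> x - truncated_kernel \<nu> s \<tau> (x - y)\<bar> \<le>
      (\<integral>\<^sup>+t. ennreal (norm (indicator {s<..\<tau>} t * heat_kernel t x - indicator {s<..\<tau>} t * heat_kernel t (x - y))) \<partial>\<nu>)"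
      using norm_integral_le_nn_integral[of \<nu> "\<lambda>t. indicator {s<..\<tau>} t * heat_kernel t x - indicator {s<..\<tau>} t * heat_kernel t (x - y)"]
      by simp
    also have "\<dots> = (\<integral>\<^sup>+t. indicator {s<..\<tau>} t * ennreal \<bar>heat_kernel t x - heat_kernel t (x - y)\<bar> \<partial>\<nu>)"
      by (intro nn_integral_cong) (auto split: split_indicator)
    finally show "ennreal \<bar>truncated_kernel \<nu> s \<tau> x - truncated_kernel \<nu> s \<tau> (x - y)\<bar> \<le>
      (\<integral>\<^sup>+t. indicator {s<..\<tau>} t * ennreal \<bar>heat_kernel t x - heat_kernel t (x - y)\<bar> \<partial>\<nu>)" .
  qed
  also have "\<dots> = (\<integral>\<^sup>+t. (\<integral>\<^sup>+x. indicator {s<..\<tau>} t * ennreal \<bar>heat_kernel t x - heat_kernel t (x - y)\<bar> \<partial>lborel) \<partial>\<nu>)"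
    by (rule P.Fubini'[symmetric]) measurable
  also have "\<dots> \<le> (\<integral>\<^sup>+t. ennreal ?c * indicator {s<..\<tau>} t \<partial>\<nu>)"
  proof (intro nn_integral_mono)
    fix t
    show "(\<integral>\<^sup>+x. indicator {s<..\<tau>} t * ennreal \<bar>heat_kernel t x - heat_kernel t (x - y)\<bar> \<partial>lborel) \<le> ennreal ?c * indicator {s<..\<tau>} t"
    proof (cases "t \<in> {s<..\<tau>}")
      case True
      then have "(\<integral>\<^sup>+x. ennreal \<bar>heat_kernel t x - heat_kernel t (x - y)\<bar> \<partial>lborel) \<le> ennreal (3 * norm y / sqrt t)"
        using s by (intro heat_kernel_translation) auto
      also have "\<dots> \<le> ennreal ?c"
        using True s by (intro ennreal_leI divide_left_mono) auto
      finally show ?thesis using True by simp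
    qed simp
  qed
  also have "\<dots> = ennreal ?c * emeasure \<nu> {s<..\<tau>}"
    by (intro nn_integral_cmult_indicator) (simp add: levy_measure_sets[OF \<nu>])
  also have "\<dots> = ennreal (?c * measure \<nu> {s<..\<tau>})"
    unfolding levy_measure_Ioc_finite[OF \<nu> s] using s by (intro ennreal_mult[symmetric]) auto
  finally have *: "(\<integral>\<^sup>+x. ennreal \<bar>truncated_kernel \<nu> s \<tau> x - truncated_kernel \<nu> s \<tau> (x - y)\<bar> \<partial>lborel) \<le> ennreal (?c * measure \<nu> {s<..\<tau>})" .
  have "integrable lborel (\<lambda>x::'a. truncated_kernel \<nu> s \<tau> x - truncated_kernel \<nu> s \<tau> (x - y))"
    by (intro Bochner_Integration.integrable_diff lborel_integrable_minus_shift truncated_kernel_integrable[OF \<nu> s])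
  then have "ennreal (\<integral>x. \<bar>truncated_kernel \<nu> s \<tau> x - truncated_kernel \<nu> s \<tau> (x - y)\<bar> \<partial>lborel) \<le> ennreal (?c * measure \<nu> {s<..\<tau>})"
    using * by (subst nn_integral_eq_integral[symmetric]) auto
  then show ?thesis using s by (subst (asm) ennreal_le_iff) auto
qed

section \<open>Truncated generators and principal values\<close>

text \<open>The operator with kernel \<open>K\<close>, restricted to jumps larger than \<open>\<epsilon>\<close>, in weak form.\<close>

definition truncated_generator :: "('a::euclidean_space \<Rightarrow> real) \<Rightarrow> real \<Rightarrow> 'a distr \<Rightarrow> 'a distr" where
  "truncated_generator K \<epsilon> f = (\<lambda>\<phi>. \<integral>z. indicator {z. \<epsilon> < norm z} z *\<^sub>R
     ((f (\<lambda>x. \<phi> (x - z)) - f \<phi>) * complex_of_real (K z)) \<partial>lborel)"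

text \<open>The core of the argument: \<open>(lam + |K|) f = w + r + f \<star> (K - M)\<close>, and the norm of the last term is at most
\<open>\<parallel>K - M\<parallel>\<^sub>1\<close> times the norm of \<open>f\<close>. Here \<open>w\<close> is the datum and \<open>r\<close> collects the error of the truncation.\<close>

lemma dissipative_estimate:
  fixes f w r :: "'a::euclidean_space distr" and K :: "'a \<Rightarrow> real"
  assumes A: "valid_orlicz A" and fin: "luxemburg_norm_distr A f < \<infinity>" and lam: "0 < lam"
    and K: "integrable lborel K" "\<And>z. 0 \<le> K z" and M: "integrable lborel M"
    and zero: "\<And>\<phi>. \<phi> \<in> schwartz \<Longrightarrow> dconv f M \<phi> = 0"
    and eq: "\<And>\<phi>. \<phi> \<in> schwartz \<Longrightarrow> complex_of_real lam * f \<phi> =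
      w \<phi> + r \<phi> + (dconv f (\<lambda>z. complex_of_real (K z)) \<phi> - complex_of_real (\<integral>z. K z \<partial>lborel) * f \<phi>)"
  shows "ennreal (lam + (\<integral>z. K z \<partial>lborel)) * luxemburg_norm_distr A f \<le>
    luxemburg_norm_distr A w + luxemburg_norm_distr A r
    + ennreal (\<integral>z. norm (complex_of_real (K z) - M z) \<partial>lborel) * luxemburg_norm_distr A f"
proof -
  define k where "k = (\<integral>z. K z \<partial>lborel)"
  have k: "0 \<le> k" unfolding k_def using K by simp
  have Kc: "integrable lborel (\<lambda>z. complex_of_real (K z))" using K by simp
  have orb: "bounded_orbits f" by (rule finite_norm_bounded_orbits[OF A fin])
  let ?h = "dconv f (\<lambda>z. complex_of_real (K z) - M z)"
  have nc: "norm (complex_of_real (lam + k)) = lam + k" using lam k by (simp only: norm_of_real)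
  have nz: "complex_of_real (lam + k) \<noteq> 0" unfolding of_real_eq_0_iff using lam k by linarith
  have "ennreal (lam + k) * luxemburg_norm_distr A f \<le> luxemburg_norm_distr A (\<lambda>\<phi>. complex_of_real (lam + k) * f \<phi>)"
    using luxemburg_norm_distr_cmult_ge[OF A nz, of f] unfolding nc .
  also have "\<dots> = luxemburg_norm_distr A (\<lambda>\<phi>. (w \<phi> + r \<phi>) + ?h \<phi>)"
  proof (rule luxemburg_norm_distr_cong)
    fix \<phi> :: "'a \<Rightarrow> complex" assume \<phi>: "\<phi> \<in> schwartz"
    show "complex_of_real (lam + k) * f \<phi> = (w \<phi> + r \<phi>) + ?h \<phi>"
      unfolding dconv_diff[OF orb \<phi> Kc M] zero[OF \<phi>] using eq[OF \<phi>] by (simp add: k_def algebra_simps)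
  qed
  also have "\<dots> \<le> luxemburg_norm_distr A (\<lambda>\<phi>. w \<phi> + r \<phi>) + luxemburg_norm_distr A ?h"
    by (rule luxemburg_norm_distr_add[OF A])
  also have "\<dots> \<le> (luxemburg_norm_distr A w + luxemburg_norm_distr A r) + ennreal (\<integral>z. norm (complex_of_real (K z) - M z) \<partial>lborel) * luxemburg_norm_distr A f"
    by (intro add_mono luxemburg_norm_distr_add[OF A] luxemburg_norm_distr_dconv[OF A fin] Bochner_Integration.integrable_diff Kc M)
  finally show ?thesis by (simp add: k_def)
qed

lemma truncated_integral_tendsto:
  fixes h :: "'a::euclidean_space \<Rightarrow> 'b::{banach, second_countable_topology}"
  assumes h: "integrable lborel h"
  shows "((\<lambda>\<epsilon>. \<integral>z. indicator {z. \<epsilon> < norm z} z *\<^sub>R h z \<partial>lborel) \<longlongrightarrow> (\<integral>z. h z \<partial>lborel)) (at_right 0)"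
proof (rule tendsto_at_right_sequentially[where b=1])
  fix S :: "nat \<Rightarrow> real" assume S: "\<And>n. 0 < S n" "S \<longlonglongrightarrow> 0"
  have [measurable]: "h \<in> borel_measurable borel" using borel_measurable_integrable[OF h] by simp
  show "(\<lambda>n. \<integral>z. indicator {z. S n < norm z} z *\<^sub>R h z \<partial>lborel) \<longlonglongrightarrow> (\<integral>z. h z \<partial>lborel)"
  proof (rule integral_dominated_convergence[where w="\<lambda>z. norm (h z)"])
    have "AE z::'a in lborel. z \<noteq> 0" by (rule AE_lborel_singleton)
    then show "AE z in lborel. (\<lambda>n. indicator {z. S n < norm z} z *\<^sub>R h z) \<longlonglongrightarrow> h z"
    proof eventually_elim
      case (elim z)
      then have "\<forall>\<^sub>F n in sequentially. S n < norm z" using S(2) by (intro order_tendstoD) auto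
      then have "\<forall>\<^sub>F n in sequentially. indicator {z. S n < norm z} z *\<^sub>R h z = h z"
        by eventually_elim simp
      then show ?case by (rule tendsto_eventually)
    qed
    show "AE z in lborel. norm (indicator {z. S n < norm z} z *\<^sub>R h z) \<le> norm (h z)" for n
      by (auto split: split_indicator)
  qed (use h in \<open>auto intro: integrable_norm\<close>)
qed simp

text \<open>If vectors \<open>b\<close> converge when tested against each element of \<open>V\<close>, then their orthogonal projections to the span of \<open>V\<close> converge,
since the span has a finite orthonormal basis, and the projections have the same inner products with \<open>V\<close>. The vectors \<open>b\<close>
themselves may diverge.\<close>

lemma finite_span_projection:
  fixes V :: "'a::euclidean_space set" and b :: "real \<Rightarrow> 'a"
  assumes lim: "\<And>v. v \<in> V \<Longrightarrow> \<exists>l. ((\<lambda>\<epsilon>. b \<epsilon> \<bullet> v) \<longlongrightarrow> l) F"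
  obtains p p\<^sub>0 where "(p \<longlongrightarrow> p\<^sub>0) F" "\<And>v \<epsilon>. v \<in> V \<Longrightarrow> p \<epsilon> \<bullet> v = b \<epsilon> \<bullet> v"
proof -
  obtain B where B: "B \<subseteq> span V" "pairwise orthogonal B" "\<And>x. x \<in> B \<Longrightarrow> norm x = 1" "independent B" "span B = span V"
    using orthonormal_basis_subspace[OF subspace_span[of V]] by metis
  have fin: "finite B" using B(4) independent_imp_finite by blast
  have "\<exists>l. ((\<lambda>\<epsilon>. b \<epsilon> \<bullet> v) \<longlongrightarrow> l) F" if "v \<in> span V" for v
    using that
  proof (induction rule: span_induct_alt)
    case base
    show ?case by (auto intro: tendsto_const)
  next
    case (step c x y)
    obtain l m where "((\<lambda>\<epsilon>. b \<epsilon> \<bullet> x) \<longlongrightarrow> l) F" "((\<lambda>\<epsilon>. b \<epsilon> \<bullet> y) \<longlongrightarrow> m) F" using step lim by blast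
    then have "((\<lambda>\<epsilon>. c * (b \<epsilon> \<bullet> x) + b \<epsilon> \<bullet> y) \<longlongrightarrow> c * l + m) F" by (intro tendsto_intros)
    then show ?case by (auto simp: inner_add_right)
  qed
  then obtain \<beta> where \<beta>: "\<And>e. e \<in> B \<Longrightarrow> ((\<lambda>\<epsilon>. b \<epsilon> \<bullet> e) \<longlongrightarrow> \<beta> e) F" using B(1) by (metis subsetD)
  show thesis
  proof (rule that[of "\<lambda>\<epsilon>. \<Sum>e\<in>B. (b \<epsilon> \<bullet> e) *\<^sub>R e" "\<Sum>e\<in>B. \<beta> e *\<^sub>R e"])
    show "((\<lambda>\<epsilon>. \<Sum>e\<in>B. (b \<epsilon> \<bullet> e) *\<^sub>R e) \<longlongrightarrow> (\<Sum>e\<in>B. \<beta> e *\<^sub>R e)) F"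
      by (intro tendsto_sum tendsto_scaleR tendsto_const \<beta>)
    fix v \<epsilon> assume "v \<in> V"
    then have "v \<in> span B" using B(5) span_base by blast
    then have v: "(\<Sum>e\<in>B. (v \<bullet> e) *\<^sub>R e) = v" using B fin by (intro orthonormal_basis_expand) auto
    have "(\<Sum>e\<in>B. (b \<epsilon> \<bullet> e) *\<^sub>R e) \<bullet> v = (\<Sum>e\<in>B. (b \<epsilon> \<bullet> e) * (v \<bullet> e))"
      by (subst inner_sum_left) (simp add: inner_commute[of v])
    also have "\<dots> = b \<epsilon> \<bullet> (\<Sum>e\<in>B. (v \<bullet> e) *\<^sub>R e)"
      by (simp add: inner_sum_right mult.commute)
    finally show "(\<Sum>e\<in>B. (b \<epsilon> \<bullet> e) *\<^sub>R e) \<bullet> v = b \<epsilon> \<bullet> v" unfolding v .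
  qed
qed

lemma truncated_levy_integrable:
  fixes K :: "'a::euclidean_space \<Rightarrow> real"
  assumes [measurable]: "K \<in> borel_measurable borel" and K0: "\<And>z. 0 \<le> K z"
    and K2: "(\<integral>\<^sup>+z. ennreal (min 1 ((norm z)\<^sup>2) * K z) \<partial>lborel) < \<infinity>" and \<epsilon>: "0 < \<epsilon>"
  shows "integrable lborel (\<lambda>z. indicator {z. \<epsilon> < norm z} z * K z)"
proof (rule integrableI_bounded)
  show "(\<lambda>z. indicator {z. \<epsilon> < norm z} z * K z) \<in> borel_measurable lborel" by measurable
  have "(\<integral>\<^sup>+z. ennreal (norm (indicator {z. \<epsilon> < norm z} z * K z)) \<partial>lborel) \<le> (\<integral>\<^sup>+z. ennreal (1 / min 1 (\<epsilon>\<^sup>2)) * ennreal (min 1 ((norm z)\<^sup>2) * K z) \<partial>lborel)"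
  proof (intro nn_integral_mono)
    fix z :: 'a
    show "ennreal (norm (indicator {z. \<epsilon> < norm z} z * K z)) \<le> ennreal (1 / min 1 (\<epsilon>\<^sup>2)) * ennreal (min 1 ((norm z)\<^sup>2) * K z)"
    proof (cases "\<epsilon> < norm z")
      case True
      then have "min 1 (\<epsilon>\<^sup>2) \<le> min 1 ((norm z)\<^sup>2)"
        using \<epsilon> by (intro min.mono power_mono) auto
      then have "1 \<le> 1 / min 1 (\<epsilon>\<^sup>2) * min 1 ((norm z)\<^sup>2)" using \<epsilon> by (simp add: pos_le_divide_eq)
      then have "1 * K z \<le> 1 / min 1 (\<epsilon>\<^sup>2) * min 1 ((norm z)\<^sup>2) * K z" by (intro mult_right_mono K0)
      then show ?thesis using True \<epsilon> K0 by (simp add: ennreal_mult'[symmetric] ennreal_leI mult.assoc)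
    qed simp
  qed
  also have "\<dots> = ennreal (1 / min 1 (\<epsilon>\<^sup>2)) * (\<integral>\<^sup>+z. ennreal (min 1 ((norm z)\<^sup>2) * K z) \<partial>lborel)"
    by (intro nn_integral_cmult) measurable
  also have "\<dots> < \<infinity>" using K2 by (simp add: ennreal_mult_less_top)
  finally show "(\<integral>\<^sup>+z. ennreal (norm (indicator {z. \<epsilon> < norm z} z * K z)) \<partial>lborel) < \<infinity>" .
qed

text \<open>Weak convergence of the truncated operators improves to convergence in norm, at a rate \<open>R\<close> relative to the norm of \<open>f\<close>.

Let \<open>F(z)\<close> be the value of \<open>f\<close> at the test function translated by \<open>z\<close>. Since \<open>f = f \<star> \<kappa>\<close>, the increment
\<open>F(z) - F(0)\<close> is an integral of \<open>F\<close> against \<open>\<kappa>(y - z) - \<kappa>(y)\<close>, and Taylor's formula splits it into a part linear in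
\<open>z\<close> and a remainder of size \<open>|z|\<^sup>2\<close>. The remainder is absolutely integrable against \<open>K\<close>. The linear part contributes the
derivative of \<open>f\<close> in the direction of the drift \<open>b(\<epsilon>) = \<integral>z K(z) dz\<close> over \<open>\<epsilon> < |z| \<le> 1\<close>. If \<open>|z| K(z)\<close> is
integrable at the origin, the drift converges. Otherwise the principal value is assumed to exist, and only the derivatives
of \<open>f\<close> in the direction \<open>b(\<epsilon>)\<close> are known to converge; but then \<open>b(\<epsilon>)\<close> may be replaced by its projection to
the finite dimensional space of directions that are visible to \<open>f\<close>, and the projection converges.\<close>

lemma principal_value_approximation:
  fixes f :: "'a::euclidean_space distr" and K :: "'a \<Rightarrow> real"
  assumes A: "valid_orlicz A" and fin: "luxemburg_norm_distr A f < \<infinity>"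
    and \<kappa>: "\<kappa> \<in> schwartz" and rep: "\<And>\<phi>. \<phi> \<in> schwartz \<Longrightarrow> dconv f \<kappa> \<phi> = f \<phi>"
    and Km [measurable]: "K \<in> borel_measurable borel" and K0: "\<And>z. 0 \<le> K z"
    and K2: "(\<integral>\<^sup>+z. ennreal (min 1 ((norm z)\<^sup>2) * K z) \<partial>lborel) < \<infinity>"
    and lim: "(\<integral>\<^sup>+z. ennreal (min 1 (norm z) * K z) \<partial>lborel) < \<infinity> \<or>
      (\<forall>\<phi>\<in>schwartz. \<exists>l. ((\<lambda>\<epsilon>. truncated_generator K \<epsilon> f \<phi>) \<longlongrightarrow> l) (at_right 0))"
  shows "\<exists>L R. (R \<longlongrightarrow> 0) (at_right 0) \<and>
    (\<forall>\<phi>\<in>schwartz. ((\<lambda>\<epsilon>. truncated_generator K \<epsilon> f \<phi>) \<longlongrightarrow> L \<phi>) (at_right 0)) \<and>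
    (\<forall>\<epsilon>. 0 < \<epsilon> \<longrightarrow> \<epsilon> \<le> 1 \<longrightarrow>
      luxemburg_norm_distr A (\<lambda>\<phi>. L \<phi> - truncated_generator K \<epsilon> f \<phi>) \<le> ennreal (R \<epsilon>) * luxemburg_norm_distr A f)"
proof -
  define F where "F = (\<lambda>\<phi> y. f (\<lambda>x. \<phi> (x - y)))"
  have orb: "bounded_orbits f" by (rule finite_norm_bounded_orbits[OF A fin])
  have Fm: "F \<phi> \<in> borel_measurable borel" and Fb: "\<exists>C. \<forall>y. norm (F \<phi> y) \<le> C" if "\<phi> \<in> schwartz" for \<phi>
    using orb that unfolding bounded_orbits_def F_def by auto
  have F0: "F \<phi> 0 = f \<phi>" for \<phi> by (simp add: F_def)
  have Fint: "integrable lborel (\<lambda>y. F \<phi> y * M y)" if "\<phi> \<in> schwartz" "integrable lborel M" for \<phi> M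
    using bounded_orbits_integrable[OF orb that] by (simp add: F_def)
  define D\<kappa> where "D\<kappa> = (\<lambda>v y. frechet_derivative \<kappa> (at y) v)"
  define \<rho> where "\<rho> = (\<lambda>z y. \<kappa> (y - z) - \<kappa> y + D\<kappa> z y)"
  have iD: "integrable lborel (D\<kappa> v)" for v
    unfolding D\<kappa>_def by (rule schwartz_derivative_integrable[OF \<kappa>])
  have i\<kappa>: "integrable lborel \<kappa>" by (rule schwartz_integrable[OF \<kappa>])
  have i\<kappa>z: "integrable lborel (\<lambda>y. \<kappa> (y - z))" for z by (rule lborel_integrable_minus_shift[OF i\<kappa>])
  have i\<rho>: "integrable lborel (\<rho> z)" for z
    unfolding \<rho>_def by (intro Bochner_Integration.integrable_add Bochner_Integration.integrable_diff i\<kappa> i\<kappa>z iD)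
  have D\<kappa>_sum: "D\<kappa> v y = (\<Sum>i\<in>Basis. complex_of_real (v \<bullet> i) * D\<kappa> i y)" for v y
    unfolding D\<kappa>_def by (subst smooth_frechet_derivative_sum_Basis[OF schwartz_smooth[OF \<kappa>]]) (simp add: scaleR_conv_of_real)
  have D\<kappa>_neg: "D\<kappa> (- z) y = - D\<kappa> z y" for z y
    by (subst (1 2) D\<kappa>_sum) (simp add: sum_negf)
  obtain C1 where C1: "C1 \<ge> 0" "\<And>v y. norm (D\<kappa> v y) \<le> C1 * norm v * decay y"
    using schwartz_derivative_decay[OF \<kappa>] unfolding D\<kappa>_def by metis
  obtain C2 where C2: "C2 \<ge> 0" "\<And>z y. norm z \<le> 1 \<Longrightarrow> norm (\<rho> z y) \<le> C2 * (norm z)\<^sup>2 * decay y"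
  proof -
    obtain C where C: "C \<ge> 0"
      "\<And>y z. norm z \<le> 1 \<Longrightarrow> norm (\<kappa> (y + z) - \<kappa> y - frechet_derivative \<kappa> (at y) z) \<le> C * (norm z)\<^sup>2 * decay y"
      using schwartz_second_order[OF \<kappa>] by metis
    have "norm (\<rho> z y) \<le> C * (norm z)\<^sup>2 * decay y" if "norm z \<le> 1" for z y
      using C(2)[of "- z" y] that D\<kappa>_neg[of z y] by (simp add: \<rho>_def D\<kappa>_def)
    then show thesis using that C(1) by blast
  qed
  define I where "I = (\<integral>y. decay (y::'a) \<partial>lborel)"
  have I0: "0 \<le> I" unfolding I_def by (intro integral_nonneg_AE) (simp add: decay_pos less_imp_le)
  \<comment> \<open>The terms of first and second order of the increment of \<open>F \<phi>\<close>.\<close>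
  define D where "D = (\<lambda>\<phi> v. \<integral>y. F \<phi> y * D\<kappa> v y \<partial>lborel)"
  define Q where "Q = (\<lambda>\<phi> z. \<integral>y. F \<phi> y * \<rho> z y \<partial>lborel)"
  have increment: "F \<phi> z - F \<phi> 0 = Q \<phi> z - D \<phi> z" if \<phi>: "\<phi> \<in> schwartz" for \<phi> z
  proof -
    have "F \<phi> z = dconv f \<kappa> (\<lambda>x. \<phi> (x - z))"
      unfolding F_def by (rule rep[symmetric, OF schwartz_translate[OF \<phi>]])
    also have "\<dots> = (\<integral>y. F \<phi> y * \<kappa> (y - z) \<partial>lborel)" unfolding dconv_translate F_def ..
    finally have 1: "F \<phi> z = (\<integral>y. F \<phi> y * \<kappa> (y - z) \<partial>lborel)" .
    have 2: "F \<phi> 0 = (\<integral>y. F \<phi> y * \<kappa> y \<partial>lborel)"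
      using rep[OF \<phi>] by (simp add: F0 dconv_def F_def)
    have "Q \<phi> z = (\<integral>y. F \<phi> y * \<kappa> (y - z) - F \<phi> y * \<kappa> y + F \<phi> y * D\<kappa> z y \<partial>lborel)"
      unfolding Q_def \<rho>_def by (simp add: algebra_simps)
    also have "\<dots> = F \<phi> z - F \<phi> 0 + D \<phi> z"
      unfolding Bochner_Integration.integral_add[OF Bochner_Integration.integrable_diff[OF Fint[OF \<phi> i\<kappa>z] Fint[OF \<phi> i\<kappa>]] Fint[OF \<phi> iD]]
        Bochner_Integration.integral_diff[OF Fint[OF \<phi> i\<kappa>z] Fint[OF \<phi> i\<kappa>]] D_def 1[symmetric] 2[symmetric] ..
    finally show ?thesis by simp
  qed
  have D_sum: "D \<phi> v = (\<Sum>i\<in>Basis. complex_of_real (v \<bullet> i) * D \<phi> i)" if \<phi>: "\<phi> \<in> schwartz" for \<phi> v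
  proof -
    have "D \<phi> v = (\<integral>y. (\<Sum>i\<in>Basis. complex_of_real (v \<bullet> i) * (F \<phi> y * D\<kappa> i y)) \<partial>lborel)"
      unfolding D_def by (subst D\<kappa>_sum) (simp add: sum_distrib_left mult_ac)
    also have "\<dots> = (\<Sum>i\<in>Basis. \<integral>y. complex_of_real (v \<bullet> i) * (F \<phi> y * D\<kappa> i y) \<partial>lborel)"
      by (intro Bochner_Integration.integral_sum integrable_mult_right Fint[OF \<phi> iD])
    finally show ?thesis by (simp only: integral_mult_right_zero D_def)
  qed
  \<comment> \<open>Vectors that represent the real and the imaginary part of the linear functional \<open>D \<phi>\<close>.\<close>
  define dR where "dR = (\<lambda>\<phi>. \<Sum>i\<in>(Basis::'a set). Re (D \<phi> i) *\<^sub>R i)"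
  define dI where "dI = (\<lambda>\<phi>. \<Sum>i\<in>(Basis::'a set). Im (D \<phi> i) *\<^sub>R i)"
  have D_inner: "D \<phi> v = Complex (v \<bullet> dR \<phi>) (v \<bullet> dI \<phi>)" if "\<phi> \<in> schwartz" for \<phi> v
    unfolding dR_def dI_def inner_sum_right
    by (subst D_sum[OF that]) (simp add: complex_eq_iff mult.commute)
  have Q_bound: "norm (Q \<phi> z) \<le> c * C2 * I * (norm z)\<^sup>2" if \<phi>: "\<phi> \<in> schwartz" and c: "\<And>y. norm (F \<phi> y) \<le> c" and z: "norm z \<le> 1" for \<phi> z c
  proof -
    have c0: "0 \<le> c" using order_trans[OF norm_ge_zero c[of 0]] .
    have "norm (Q \<phi> z) \<le> (\<integral>y. c * (C2 * (norm z)\<^sup>2 * decay (y::'a)) \<partial>lborel)"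
      unfolding Q_def
    proof (rule Bochner_Integration.integral_norm_bound_integral[OF Fint[OF \<phi> i\<rho>]])
      show "norm (F \<phi> y * \<rho> z y) \<le> c * (C2 * (norm z)\<^sup>2 * decay y)" for y
        unfolding norm_mult by (intro mult_mono c C2(2) z c0) auto
    qed (intro integrable_mult_right decay_integrable)
    then show ?thesis by (simp add: I_def mult_ac)
  qed
  have \<rho>m [measurable]: "(\<lambda>(z, y). \<rho> z y) \<in> borel_measurable (borel \<Otimes>\<^sub>M borel)"
  proof -
    have [measurable]: "\<kappa> \<in> borel_measurable borel" by (rule schwartz_measurable[OF \<kappa>])
    have [measurable]: "D\<kappa> i \<in> borel_measurable borel" for i
      using borel_measurable_integrable[OF iD] by simp
    have "\<rho> = (\<lambda>z y. \<kappa> (y - z) - \<kappa> y + (\<Sum>i\<in>Basis. complex_of_real (z \<bullet> i) * D\<kappa> i y))"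
      unfolding \<rho>_def by (intro ext) (subst D\<kappa>_sum, rule refl)
    then show ?thesis by simp
  qed
  have Qm: "Q \<phi> \<in> borel_measurable borel" if "\<phi> \<in> schwartz" for \<phi>
  proof -
    note [measurable] = Fm[OF that]
    show ?thesis unfolding Q_def by measurable
  qed
  \<comment> \<open>The density that measures how much second order mass \<open>K\<close> has near the origin.\<close>
  define J where "J = (\<lambda>z::'a. indicator {z. norm z \<le> 1} z * ((norm z)\<^sup>2 * K z))"
  have iJ: "integrable lborel J"
  proof (rule integrableI_bounded)
    show "J \<in> borel_measurable lborel" unfolding J_def by measurable
    have "(\<integral>\<^sup>+z. ennreal (norm (J z)) \<partial>lborel) \<le> (\<integral>\<^sup>+z. ennreal (min 1 ((norm z)\<^sup>2) * K z) \<partial>lborel)"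
    proof (intro nn_integral_mono ennreal_leI)
      fix z :: 'a
      show "norm (J z) \<le> min 1 ((norm z)\<^sup>2) * K z"
      proof (cases "norm z \<le> 1")
        case True
        then have "min 1 ((norm z)\<^sup>2) = (norm z)\<^sup>2" by (intro min_absorb2 power_le_one) auto
        then show ?thesis using True K0[of z] by (simp add: J_def)
      qed (simp add: J_def K0)
    qed
    then show "(\<integral>\<^sup>+z. ennreal (norm (J z)) \<partial>lborel) < \<infinity>" using K2 by (rule le_less_trans)
  qed
  note iK = truncated_levy_integrable[OF Km K0 K2]
  \<comment> \<open>The remainder, weighted by \<open>K\<close>, is absolutely integrable over the unit ball.\<close>
  define q where "q = (\<lambda>\<phi> z. indicator {z. norm z \<le> 1} z *\<^sub>R (Q \<phi> z * complex_of_real (K z)))"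
  have iq: "integrable lborel (q \<phi>)" if \<phi>: "\<phi> \<in> schwartz" for \<phi>
  proof -
    note [measurable] = Qm[OF \<phi>]
    obtain c where c: "\<And>y. norm (F \<phi> y) \<le> c" using Fb[OF \<phi>] by blast
    show ?thesis
    proof (rule Bochner_Integration.integrable_bound[OF integrable_mult_right[OF iJ, of "c * C2 * I"]])
      show "q \<phi> \<in> borel_measurable lborel" unfolding q_def by measurable
      show "AE z in lborel. norm (q \<phi> z) \<le> norm (c * C2 * I * J z)"
      proof (rule AE_I2)
        fix z
        show "norm (q \<phi> z) \<le> norm (c * C2 * I * J z)"
        proof (cases "norm z \<le> 1")
          case True
          have "norm (q \<phi> z) = norm (Q \<phi> z) * K z" using True K0 by (simp add: q_def norm_mult)
          also have "\<dots> \<le> (c * C2 * I * (norm z)\<^sup>2) * K z"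
            by (intro mult_right_mono Q_bound[OF \<phi> c True] K0)
          also have "\<dots> = c * C2 * I * J z" using True by (simp add: J_def)
          finally show ?thesis by simp
        qed (simp add: q_def)
      qed
    qed
  qed
  have lin: "bounded_linear (D \<phi>)" if \<phi>: "\<phi> \<in> schwartz" for \<phi>
  proof -
    have "D \<phi> = (\<lambda>v. complex_of_real (v \<bullet> dR \<phi>) + \<i> * complex_of_real (v \<bullet> dI \<phi>))"
      using D_inner[OF \<phi>] by (simp add: complex_eq_iff fun_eq_iff)
    moreover have "bounded_linear (\<lambda>v. complex_of_real (v \<bullet> dR \<phi>) + \<i> * complex_of_real (v \<bullet> dI \<phi>))"
      by (intro bounded_linear_add bounded_linear_const_mult bounded_linear_compose[OF bounded_linear_of_real] bounded_linear_inner_left)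
    ultimately show ?thesis by simp
  qed
  define b where "b = (\<lambda>\<epsilon>. \<integral>z. (indicator {z. \<epsilon> < norm z \<and> norm z \<le> 1} z * K z) *\<^sub>R z \<partial>lborel)"
  have ib: "integrable lborel (\<lambda>z. (indicator {z. \<epsilon> < norm z \<and> norm z \<le> 1} z * K z) *\<^sub>R z)" if \<epsilon>: "0 < \<epsilon>" for \<epsilon>
  proof (rule Bochner_Integration.integrable_bound[OF iK[OF \<epsilon>]])
    show "AE z in lborel. norm ((indicator {z. \<epsilon> < norm z \<and> norm z \<le> 1} z * K z) *\<^sub>R z) \<le> norm (indicator {z. \<epsilon> < norm z} z * K z)"
      by (intro AE_I2) (auto split: split_indicator simp: K0 mult_left_le)
  qed measurable
  have Db: "integrable lborel (\<lambda>z. (indicator {z. \<epsilon> < norm z \<and> norm z \<le> 1} z * K z) *\<^sub>R D \<phi> z)"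
    "(\<integral>z. (indicator {z. \<epsilon> < norm z \<and> norm z \<le> 1} z * K z) *\<^sub>R D \<phi> z \<partial>lborel) = D \<phi> (b \<epsilon>)"
    if \<phi>: "\<phi> \<in> schwartz" and \<epsilon>: "0 < \<epsilon>" for \<phi> \<epsilon>
    using integrable_bounded_linear[OF lin[OF \<phi>] ib[OF \<epsilon>]] integral_bounded_linear[OF lin[OF \<phi>] ib[OF \<epsilon>]]
    by (simp_all add: linear_scale[OF bounded_linear.linear[OF lin[OF \<phi>]]] b_def)
  define T where "T = (\<lambda>\<epsilon> \<phi>. truncated_generator K \<epsilon> f \<phi>)"
  \<comment> \<open>Large jumps, drift and remainder. The radius one is that of \<open>schwartz_second_order\<close>.\<close>
  have T_split: "T \<epsilon> \<phi> = T 1 \<phi> - D \<phi> (b \<epsilon>) + (\<integral>z. indicator {z. \<epsilon> < norm z} z *\<^sub>R q \<phi> z \<partial>lborel)"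
    if \<phi>: "\<phi> \<in> schwartz" and \<epsilon>: "0 < \<epsilon>" "\<epsilon> \<le> 1" for \<phi> \<epsilon>
  proof -
    note [measurable] = Fm[OF \<phi>] borel_measurable_integrable[OF iq[OF \<phi>], simplified]
    obtain c where c: "\<And>y. norm (F \<phi> y) \<le> c" using Fb[OF \<phi>] by blast
    have i1: "integrable lborel (\<lambda>z. indicator {z. 1 < norm z} z *\<^sub>R ((F \<phi> z - F \<phi> 0) * complex_of_real (K z)))"
    proof (rule Bochner_Integration.integrable_bound[OF integrable_mult_right[OF iK[of 1], of "2 * c"]])
      show "AE z in lborel. norm (indicator {z. 1 < norm z} z *\<^sub>R ((F \<phi> z - F \<phi> 0) * complex_of_real (K z))) \<le> norm (2 * c * (indicator {z. 1 < norm z} z * K z))"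
      proof (rule AE_I2)
        fix z
        have c0: "0 \<le> c" using order_trans[OF norm_ge_zero c[of 0]] .
        have "norm (F \<phi> z - F \<phi> 0) \<le> c + c" by (intro order_trans[OF norm_triangle_ineq4] add_mono c)
        then have "norm (F \<phi> z - F \<phi> 0) * K z \<le> 2 * c * K z" by (intro mult_right_mono K0) simp
        then show "norm (indicator {z. 1 < norm z} z *\<^sub>R ((F \<phi> z - F \<phi> 0) * complex_of_real (K z))) \<le> norm (2 * c * (indicator {z. 1 < norm z} z * K z))"
          using c0 K0[of z] by (auto split: split_indicator simp: norm_mult abs_mult)
      qed
    qed (simp_all add: Fm[OF \<phi>])
    have i3: "integrable lborel (\<lambda>z. indicator {z. \<epsilon> < norm z} z *\<^sub>R q \<phi> z)"
      by (rule Bochner_Integration.integrable_bound[OF iq[OF \<phi>]]) (auto split: split_indicator)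
    have pw: "indicator {z. \<epsilon> < norm z} z *\<^sub>R ((F \<phi> z - F \<phi> 0) * complex_of_real (K z)) =
      indicator {z. 1 < norm z} z *\<^sub>R ((F \<phi> z - F \<phi> 0) * complex_of_real (K z))
      - (indicator {z. \<epsilon> < norm z \<and> norm z \<le> 1} z * K z) *\<^sub>R D \<phi> z + indicator {z. \<epsilon> < norm z} z *\<^sub>R q \<phi> z" for z
    proof (cases "norm z \<le> 1")
      case True
      have "(F \<phi> z - F \<phi> 0) * complex_of_real (K z) = Q \<phi> z * complex_of_real (K z) - K z *\<^sub>R D \<phi> z"
        unfolding increment[OF \<phi>] by (simp add: scaleR_conv_of_real algebra_simps)
      then show ?thesis using True by (simp add: q_def indicator_def)
    next
      case False
      then show ?thesis using \<epsilon> by (simp add: q_def indicator_def)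
    qed
    have "T \<epsilon> \<phi> = (\<integral>z. indicator {z. \<epsilon> < norm z} z *\<^sub>R ((F \<phi> z - F \<phi> 0) * complex_of_real (K z)) \<partial>lborel)"
      by (simp add: T_def truncated_generator_def F_def)
    also have "\<dots> = T 1 \<phi> - D \<phi> (b \<epsilon>) + (\<integral>z. indicator {z. \<epsilon> < norm z} z *\<^sub>R q \<phi> z \<partial>lborel)"
      unfolding pw Bochner_Integration.integral_add[OF Bochner_Integration.integrable_diff[OF i1 Db(1)[OF \<phi> \<epsilon>(1)]] i3]
        Bochner_Integration.integral_diff[OF i1 Db(1)[OF \<phi> \<epsilon>(1)]] Db(2)[OF \<phi> \<epsilon>(1)]
      by (simp add: T_def truncated_generator_def F_def)
    finally show ?thesis .
  qed
  have small: "\<forall>\<^sub>F \<epsilon> in at_right 0. 0 < \<epsilon> \<and> \<epsilon> \<le> (1::real)"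
    by (rule eventually_at_rightI[of 0 1]) auto
  have q_lim: "((\<lambda>\<epsilon>. \<integral>z. indicator {z. \<epsilon> < norm z} z *\<^sub>R q \<phi> z \<partial>lborel) \<longlongrightarrow> (\<integral>z. q \<phi> z \<partial>lborel)) (at_right 0)"
    if "\<phi> \<in> schwartz" for \<phi>
    by (rule truncated_integral_tendsto[OF iq[OF that]])
  \<comment> \<open>Either the drift converges, or convergence of its action is read off from \<open>T_split\<close>.\<close>
  have D_lim: "\<exists>l. ((\<lambda>\<epsilon>. D \<phi> (b \<epsilon>)) \<longlongrightarrow> l) (at_right 0)" if \<phi>: "\<phi> \<in> schwartz" for \<phi>
    using lim
  proof
    assume K1: "(\<integral>\<^sup>+z. ennreal (min 1 (norm z) * K z) \<partial>lborel) < \<infinity>"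
    define h where "h = (\<lambda>z::'a. (indicator {z. norm z \<le> 1} z * K z) *\<^sub>R z)"
    have "integrable lborel h"
    proof (rule integrableI_bounded)
      show "h \<in> borel_measurable lborel" unfolding h_def by measurable
      have "(\<integral>\<^sup>+z. ennreal (norm (h z)) \<partial>lborel) \<le> (\<integral>\<^sup>+z. ennreal (min 1 (norm z) * K z) \<partial>lborel)"
        by (intro nn_integral_mono ennreal_leI) (auto simp: h_def K0 min_def mult.commute split: split_indicator)
      then show "(\<integral>\<^sup>+z. ennreal (norm (h z)) \<partial>lborel) < \<infinity>" using K1 by (rule le_less_trans)
    qed
    moreover have "b = (\<lambda>\<epsilon>. \<integral>z. indicator {z. \<epsilon> < norm z} z *\<^sub>R h z \<partial>lborel)"
      unfolding b_def h_def by (intro ext Bochner_Integration.integral_cong) (auto split: split_indicator)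
    ultimately have "(b \<longlongrightarrow> (\<integral>z. h z \<partial>lborel)) (at_right 0)"
      using truncated_integral_tendsto[of h] by simp
    from bounded_linear.tendsto[OF lin[OF \<phi>] this] show ?thesis by blast
  next
    assume "\<forall>\<phi>\<in>schwartz. \<exists>l. ((\<lambda>\<epsilon>. truncated_generator K \<epsilon> f \<phi>) \<longlongrightarrow> l) (at_right 0)"
    then obtain l where l: "((\<lambda>\<epsilon>. T \<epsilon> \<phi>) \<longlongrightarrow> l) (at_right 0)" using \<phi> unfolding T_def by blast
    have "((\<lambda>\<epsilon>. T 1 \<phi> + (\<integral>z. indicator {z. \<epsilon> < norm z} z *\<^sub>R q \<phi> z \<partial>lborel) - T \<epsilon> \<phi>) \<longlongrightarrow> T 1 \<phi> + (\<integral>z. q \<phi> z \<partial>lborel) - l) (at_right 0)"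
      by (intro tendsto_intros q_lim[OF \<phi>] l)
    moreover have "\<forall>\<^sub>F \<epsilon> in at_right 0. T 1 \<phi> + (\<integral>z. indicator {z. \<epsilon> < norm z} z *\<^sub>R q \<phi> z \<partial>lborel) - T \<epsilon> \<phi> = D \<phi> (b \<epsilon>)"
      using small
    proof eventually_elim
      case (elim \<epsilon>)
      then show ?case using T_split[OF \<phi>, of \<epsilon>] by simp
    qed
    ultimately have "((\<lambda>\<epsilon>. D \<phi> (b \<epsilon>)) \<longlongrightarrow> T 1 \<phi> + (\<integral>z. q \<phi> z \<partial>lborel) - l) (at_right 0)"
      by (rule Lim_transform_eventually)
    then show ?thesis by blast
  qed
  \<comment> \<open>The directions that are visible to \<open>f\<close>.\<close>
  define V where "V = dR ` schwartz \<union> dI ` schwartz"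
  have "\<exists>l. ((\<lambda>\<epsilon>. b \<epsilon> \<bullet> v) \<longlongrightarrow> l) (at_right 0)" if v: "v \<in> V" for v
  proof -
    obtain \<phi> where \<phi>: "\<phi> \<in> schwartz" "v = dR \<phi> \<or> v = dI \<phi>" using v by (auto simp: V_def)
    obtain l where l: "((\<lambda>\<epsilon>. D \<phi> (b \<epsilon>)) \<longlongrightarrow> l) (at_right 0)" using D_lim[OF \<phi>(1)] by blast
    show ?thesis
      using \<phi>(2) tendsto_Re[OF l] tendsto_Im[OF l] by (auto simp: D_inner[OF \<phi>(1)])
  qed
  then obtain p p\<^sub>0 where p: "(p \<longlongrightarrow> p\<^sub>0) (at_right 0)" and pv: "\<And>v \<epsilon>. v \<in> V \<Longrightarrow> p \<epsilon> \<bullet> v = b \<epsilon> \<bullet> v"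
    using finite_span_projection[of V b "at_right 0"] by metis
  have Dp: "D \<phi> (b \<epsilon>) = D \<phi> (p \<epsilon>)" if "\<phi> \<in> schwartz" for \<phi> \<epsilon>
    using that by (simp add: D_inner pv V_def)
  \<comment> \<open>The limit, and the bound for the error: the first summand of \<open>R\<close> stems from the drift, the second from the remainder.\<close>
  define L where "L = (\<lambda>\<phi>. T 1 \<phi> - D \<phi> p\<^sub>0 + (\<integral>z. q \<phi> z \<partial>lborel))"
  define R where "R = (\<lambda>\<epsilon>. C1 * norm (p \<epsilon> - p\<^sub>0) * I + C2 * I * ((\<integral>z. J z \<partial>lborel) - (\<integral>z. indicator {z. \<epsilon> < norm z} z *\<^sub>R J z \<partial>lborel)))"
  show ?thesis
  proof (intro exI[of _ L] exI[of _ R] conjI ballI allI impI)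
    have "((\<lambda>\<epsilon>. norm (p \<epsilon> - p\<^sub>0)) \<longlongrightarrow> 0) (at_right 0)" using p by (simp add: tendsto_norm_zero_iff LIM_zero)
    then have "(R \<longlongrightarrow> C1 * 0 * I + C2 * I * ((\<integral>z. J z \<partial>lborel) - (\<integral>z. J z \<partial>lborel))) (at_right 0)"
      unfolding R_def by (intro tendsto_intros truncated_integral_tendsto[OF iJ])
    then show "(R \<longlongrightarrow> 0) (at_right 0)" by simp
  next
    fix \<phi> :: "'a \<Rightarrow> complex" assume \<phi>: "\<phi> \<in> schwartz"
    have "((\<lambda>\<epsilon>. T 1 \<phi> - D \<phi> (p \<epsilon>) + (\<integral>z. indicator {z. \<epsilon> < norm z} z *\<^sub>R q \<phi> z \<partial>lborel)) \<longlongrightarrow> L \<phi>) (at_right 0)"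
      unfolding L_def by (intro tendsto_intros q_lim[OF \<phi>] bounded_linear.tendsto[OF lin[OF \<phi>] p])
    moreover have "\<forall>\<^sub>F \<epsilon> in at_right 0. T 1 \<phi> - D \<phi> (p \<epsilon>) + (\<integral>z. indicator {z. \<epsilon> < norm z} z *\<^sub>R q \<phi> z \<partial>lborel) = T \<epsilon> \<phi>"
      using small
    proof eventually_elim
      case (elim \<epsilon>)
      then show ?case using T_split[OF \<phi>, of \<epsilon>] Dp[OF \<phi>, of \<epsilon>] by simp
    qed
    ultimately have "((\<lambda>\<epsilon>. T \<epsilon> \<phi>) \<longlongrightarrow> L \<phi>) (at_right 0)" by (rule Lim_transform_eventually)
    then show "((\<lambda>\<epsilon>. truncated_generator K \<epsilon> f \<phi>) \<longlongrightarrow> L \<phi>) (at_right 0)" by (simp add: T_def)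
  next
    fix \<epsilon> :: real assume \<epsilon>: "0 < \<epsilon>" "\<epsilon> \<le> 1"
    \<comment> \<open>The error is the convolution of \<open>f\<close> with the kernel \<open>N\<close> below, to which both sources contribute.\<close>
    define w where "w = (\<lambda>z. indicator {z. norm z \<le> \<epsilon>} z * K z)"
    define G where "G = (\<lambda>z y. complex_of_real (w z) * \<rho> z y)"
    define j where "j = (\<lambda>z. indicator {z. norm z \<le> \<epsilon>} z * J z)"
    have wm [measurable]: "w \<in> borel_measurable borel" unfolding w_def by measurable
    have ij: "integrable lborel j"
      unfolding j_def by (rule Bochner_Integration.integrable_bound[OF iJ])
        (use borel_measurable_integrable[OF iJ] in \<open>auto split: split_indicator\<close>)
    have j0: "0 \<le> j z" for z unfolding j_def J_def by (simp add: K0)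
    have int_j: "(\<integral>z. j z \<partial>lborel) = (\<integral>z. J z \<partial>lborel) - (\<integral>z. indicator {z. \<epsilon> < norm z} z *\<^sub>R J z \<partial>lborel)"
    proof -
      have "integrable lborel (\<lambda>z. indicator {z. \<epsilon> < norm z} z *\<^sub>R J z)"
        by (rule Bochner_Integration.integrable_bound[OF iJ])
          (use borel_measurable_integrable[OF iJ] in \<open>auto split: split_indicator\<close>)
      from Bochner_Integration.integral_diff[OF iJ this]
      have "(\<integral>z. J z \<partial>lborel) - (\<integral>z. indicator {z. \<epsilon> < norm z} z *\<^sub>R J z \<partial>lborel) = (\<integral>z. J z - indicator {z. \<epsilon> < norm z} z *\<^sub>R J z \<partial>lborel)" by simp
      also have "\<dots> = (\<integral>z. j z \<partial>lborel)"
        unfolding j_def by (intro Bochner_Integration.integral_cong) (auto split: split_indicator)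
      finally show ?thesis by simp
    qed
    have G_bound: "norm (G z y) \<le> C2 * j z * decay y" for z y
    proof (cases "norm z \<le> \<epsilon>")
      case True
      then have z: "norm z \<le> 1" using \<epsilon> by simp
      have "norm (G z y) = K z * norm (\<rho> z y)" using True K0 by (simp add: G_def w_def norm_mult)
      also have "\<dots> \<le> K z * (C2 * (norm z)\<^sup>2 * decay y)" by (intro mult_left_mono C2(2) z K0)
      also have "\<dots> = C2 * j z * decay y" using True z by (simp add: j_def J_def)
      finally show ?thesis .
    qed (simp add: G_def w_def j_def)
    have Gm [measurable]: "(\<lambda>(z, y). G z y) \<in> borel_measurable (borel \<Otimes>\<^sub>M borel)"
      unfolding G_def by measurable
    have pair_majorant: "integrable (lborel \<Otimes>\<^sub>M lborel) (\<lambda>(z, y). c * (C2 * j z * decay (y::'a)))" for c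
    proof -
      have [measurable]: "j \<in> borel_measurable borel" using borel_measurable_integrable[OF ij] by simp
      have "integrable (lborel \<Otimes>\<^sub>M lborel) (\<lambda>(z, y). j z * decay (y::'a))"
      proof (rule lborel_pair.integrable_pairI_nn)
        have "(\<integral>\<^sup>+z. (\<integral>\<^sup>+y. ennreal (norm (j z * decay (y::'a))) \<partial>lborel) \<partial>lborel) = (\<integral>\<^sup>+z. norm (j z) \<partial>lborel) * (\<integral>\<^sup>+y. norm (decay (y::'a)) \<partial>lborel)"
          unfolding norm_mult by (simp add: ennreal_mult nn_integral_cmult nn_integral_multc)
        also have "\<dots> < \<infinity>"
          using ij decay_integrable[where 'a='a] unfolding integrable_iff_bounded by (simp add: ennreal_mult_less_top)
        finally show "(\<integral>\<^sup>+z. (\<integral>\<^sup>+y. ennreal (norm (j z * decay (y::'a))) \<partial>lborel) \<partial>lborel) < \<infinity>" .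
      qed measurable
      from integrable_mult_right[OF this, of "c * C2"]
      have "integrable (lborel \<Otimes>\<^sub>M lborel) (\<lambda>p. (c * C2) * (case p of (z, y) \<Rightarrow> j z * decay (y::'a)))" .
      moreover have "(\<lambda>p. (c * C2) * (case p of (z, y) \<Rightarrow> j z * decay (y::'a))) = (\<lambda>(z, y). c * (C2 * j z * decay y))"
        by (simp add: fun_eq_iff)
      ultimately show ?thesis by (simp only:)
    qed
    have pairG: "integrable (lborel \<Otimes>\<^sub>M lborel) (\<lambda>(z, y). G z y)"
      by (rule Bochner_Integration.integrable_bound[OF pair_majorant[of 1]])
        (auto intro!: AE_I2 order_trans[OF G_bound abs_ge_self])
    define N2 where "N2 = (\<lambda>y. \<integral>z. G z y \<partial>lborel)"
    have iN2: "integrable lborel N2" unfolding N2_def by (rule lborel_pair.integrable_snd[OF pairG])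
    have N2_norm: "(\<integral>y. norm (N2 y) \<partial>lborel) \<le> C2 * I * (\<integral>z. j z \<partial>lborel)"
    proof -
      have pairM: "integrable (lborel \<Otimes>\<^sub>M lborel) (\<lambda>(z, y). C2 * j z * decay (y::'a))"
        using pair_majorant[of 1] by simp
      have "(\<integral>y. norm (N2 y) \<partial>lborel) \<le> (\<integral>y. C2 * (\<integral>z. j z \<partial>lborel) * decay (y::'a) \<partial>lborel)"
      proof (intro integral_mono integrable_norm iN2 integrable_mult_right decay_integrable)
        fix y :: 'a
        have "norm (N2 y) \<le> (\<integral>z. norm (G z y) \<partial>lborel)" unfolding N2_def by (rule integral_norm_bound)
        also have "\<dots> \<le> (\<integral>z. C2 * j z * decay y \<partial>lborel)"
          by (intro integral_mono_AE' integrable_mult_left integrable_mult_right ij AE_I2 G_bound)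
            (use j0 C2(1) decay_pos[of y] in \<open>auto intro!: AE_I2 mult_nonneg_nonneg simp: less_imp_le\<close>)
        also have "\<dots> = C2 * (\<integral>z. j z \<partial>lborel) * decay y" by simp
        finally show "norm (N2 y) \<le> C2 * (\<integral>z. j z \<partial>lborel) * decay y" .
      qed
      then show ?thesis by (simp add: I_def mult_ac)
    qed
    define N where "N = (\<lambda>y. D\<kappa> (p \<epsilon> - p\<^sub>0) y + N2 y)"
    have iN: "integrable lborel N" unfolding N_def by (intro Bochner_Integration.integrable_add iD iN2)
    have N_norm: "(\<integral>y. norm (N y) \<partial>lborel) \<le> R \<epsilon>"
    proof -
      have "(\<integral>y. norm (N y) \<partial>lborel) \<le> (\<integral>y. C1 * norm (p \<epsilon> - p\<^sub>0) * decay y + norm (N2 y) \<partial>lborel)"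
      proof (intro integral_mono integrable_norm iN Bochner_Integration.integrable_add integrable_mult_right decay_integrable iN2)
        fix y :: 'a
        show "norm (N y) \<le> C1 * norm (p \<epsilon> - p\<^sub>0) * decay y + norm (N2 y)"
          unfolding N_def by (intro order_trans[OF norm_triangle_ineq] add_right_mono C1(2))
      qed
      also have "\<dots> = C1 * norm (p \<epsilon> - p\<^sub>0) * I + (\<integral>y. norm (N2 y) \<partial>lborel)"
        unfolding I_def using decay_integrable[where 'a='a] iN2 by (simp add: integrable_norm)
      also have "\<dots> \<le> R \<epsilon>" unfolding R_def int_j[symmetric] using N2_norm by simp
      finally show ?thesis .
    qed
    have "luxemburg_norm_distr A (\<lambda>\<phi>. L \<phi> - T \<epsilon> \<phi>) = luxemburg_norm_distr A (dconv f N)"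
    proof (rule luxemburg_norm_distr_cong)
      fix \<phi> :: "'a \<Rightarrow> complex" assume \<phi>: "\<phi> \<in> schwartz"
      note [measurable] = Fm[OF \<phi>]
      obtain c where c: "\<And>y. norm (F \<phi> y) \<le> c" using Fb[OF \<phi>] by blast
      have c0: "0 \<le> c" using order_trans[OF norm_ge_zero c[of 0]] .
      have pairFG: "integrable (lborel \<Otimes>\<^sub>M lborel) (\<lambda>(z, y). F \<phi> y * G z y)"
      proof (rule Bochner_Integration.integrable_bound[OF pair_majorant[of c]])
        show "AE x in lborel \<Otimes>\<^sub>M lborel. norm (case x of (z, y) \<Rightarrow> F \<phi> y * G z y) \<le> norm (case x of (z, y) \<Rightarrow> c * (C2 * j z * decay y))"
        proof (rule AE_I2, clarify)
          fix z y :: 'a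
          have "norm (F \<phi> y * G z y) \<le> c * (C2 * j z * decay y)"
            unfolding norm_mult by (intro mult_mono c G_bound c0) auto
          then show "norm (F \<phi> y * G z y) \<le> norm (c * (C2 * j z * decay y))" by simp
        qed
      qed measurable
      have "(\<integral>y. F \<phi> y * N2 y \<partial>lborel) = (\<integral>y. (\<integral>z. F \<phi> y * G z y \<partial>lborel) \<partial>lborel)"
        unfolding N2_def by (simp only: integral_mult_right_zero)
      also have "\<dots> = (\<integral>z. (\<integral>y. F \<phi> y * G z y \<partial>lborel) \<partial>lborel)"
        by (rule lborel_pair.Fubini_integral[OF pairFG])
      also have "\<dots> = (\<integral>z. complex_of_real (w z) * Q \<phi> z \<partial>lborel)"
        unfolding G_def Q_def by (simp only: integral_mult_right_zero[symmetric] mult.left_commute)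
      also have "\<dots> = (\<integral>z. q \<phi> z - indicator {z. \<epsilon> < norm z} z *\<^sub>R q \<phi> z \<partial>lborel)"
        using \<epsilon> by (intro Bochner_Integration.integral_cong) (auto simp: w_def q_def split: split_indicator)
      also have "\<dots> = (\<integral>z. q \<phi> z \<partial>lborel) - (\<integral>z. indicator {z. \<epsilon> < norm z} z *\<^sub>R q \<phi> z \<partial>lborel)"
      proof (intro Bochner_Integration.integral_diff iq[OF \<phi>])
        show "integrable lborel (\<lambda>z. indicator {z. \<epsilon> < norm z} z *\<^sub>R q \<phi> z)"
          by (rule Bochner_Integration.integrable_bound[OF iq[OF \<phi>]])
            (use borel_measurable_integrable[OF iq[OF \<phi>]] in \<open>auto split: split_indicator\<close>)
      qed
      finally have N2_eq: "(\<integral>y. F \<phi> y * N2 y \<partial>lborel) = (\<integral>z. q \<phi> z \<partial>lborel) - (\<integral>z. indicator {z. \<epsilon> < norm z} z *\<^sub>R q \<phi> z \<partial>lborel)" .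
      have "dconv f N \<phi> = (\<integral>y. F \<phi> y * D\<kappa> (p \<epsilon> - p\<^sub>0) y + F \<phi> y * N2 y \<partial>lborel)"
        by (simp add: dconv_def F_def N_def distrib_left)
      also have "\<dots> = D \<phi> (p \<epsilon> - p\<^sub>0) + (\<integral>y. F \<phi> y * N2 y \<partial>lborel)"
        unfolding D_def by (intro Bochner_Integration.integral_add Fint[OF \<phi>] iD iN2)
      also have "D \<phi> (p \<epsilon> - p\<^sub>0) = D \<phi> (p \<epsilon>) - D \<phi> p\<^sub>0"
        by (rule linear_diff[OF bounded_linear.linear[OF lin[OF \<phi>]]])
      finally show "L \<phi> - T \<epsilon> \<phi> = dconv f N \<phi>"
        unfolding N2_eq L_def T_split[OF \<phi> \<epsilon>] Dp[OF \<phi>] by simp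
    qed
    also have "\<dots> \<le> ennreal (\<integral>y. norm (N y) \<partial>lborel) * luxemburg_norm_distr A f"
      by (rule luxemburg_norm_distr_dconv[OF A fin iN])
    also have "\<dots> \<le> ennreal (R \<epsilon>) * luxemburg_norm_distr A f"
      by (intro mult_right_mono ennreal_leI N_norm) simp
    finally show "luxemburg_norm_distr A (\<lambda>\<phi>. L \<phi> - truncated_generator K \<epsilon> f \<phi>) \<le> ennreal (R \<epsilon>) * luxemburg_norm_distr A f"
      by (simp add: T_def)
  qed
qed

section \<open>Coercivity from a spectral gap\<close>

lemma truncated_generator_eq_dconv:
  fixes f :: "'a::euclidean_space distr" and K :: "'a \<Rightarrow> real"
  assumes orb: "bounded_orbits f" and \<phi>: "\<phi> \<in> schwartz"
    and iK: "integrable lborel (\<lambda>z. indicator {z. \<epsilon> < norm z} z * K z)"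
  shows "truncated_generator K \<epsilon> f \<phi> = dconv f (\<lambda>z. complex_of_real (indicator {z. \<epsilon> < norm z} z * K z)) \<phi>
    - complex_of_real (\<integral>z. indicator {z. \<epsilon> < norm z} z * K z \<partial>lborel) * f \<phi>"
proof -
  let ?k = "\<lambda>z. complex_of_real (indicator {z. \<epsilon> < norm z} z * K z)"
  have ik: "integrable lborel ?k" using iK by (simp only: complex_of_real_integrable_eq)
  have "truncated_generator K \<epsilon> f \<phi> = (\<integral>z. f (\<lambda>x. \<phi> (x - z)) * ?k z - f \<phi> * ?k z \<partial>lborel)"
    unfolding truncated_generator_def
    by (intro Bochner_Integration.integral_cong) (auto simp: scaleR_conv_of_real algebra_simps)
  also have "\<dots> = dconv f ?k \<phi> - f \<phi> * (\<integral>z. ?k z \<partial>lborel)"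
    unfolding Bochner_Integration.integral_diff[OF bounded_orbits_integrable[OF orb \<phi> ik] integrable_mult_right[OF ik]]
      integral_mult_right_zero dconv_def ..
  also have "(\<integral>z. ?k z \<partial>lborel) = complex_of_real (\<integral>z. indicator {z. \<epsilon> < norm z} z * K z \<partial>lborel)"
    by (rule integral_complex_of_real)
  finally show ?thesis by (simp only: mult.commute)
qed

text \<open>Both sides test \<open>f\<close> against the convolution of \<open>\<phi>\<close> with the kernel. This step needs that \<open>f\<close> is given by a function, as an
arbitrary functional need not commute with integrals.\<close>

lemma dconv_multiplier_kernel:
  fixes f :: "'a::euclidean_space distr"
  assumes A: "valid_orlicz A" and fin: "luxemburg_norm_distr A f < \<infinity>"
    and m: "test_fun m" and \<phi>: "\<phi> \<in> schwartz"
  shows "dconv f (multiplier_kernel m) \<phi> = f (multiplier m \<phi>)"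
proof -
  let ?k = "multiplier_kernel m"
  obtain g \<kappa> where g: "represents g f" "modular_ball A \<kappa> g" "0 < \<kappa>" and gm [measurable]: "g \<in> borel_measurable borel"
    using luxemburg_norm_distr_finiteE[OF A fin] by metis
  have [measurable]: "\<phi> \<in> borel_measurable borel" "?k \<in> borel_measurable borel"
    by (intro schwartz_measurable \<phi> multiplier_kernel_schwartz m)+
  have ik: "integrable lborel ?k" by (intro schwartz_integrable multiplier_kernel_schwartz m)
  obtain C where C: "0 \<le> C" "\<And>y. (\<integral>\<^sup>+x. ennreal (norm (g (x + y)) * norm (\<phi> x)) \<partial>lborel) \<le> ennreal C"
    using represents_tested_bound[OF A g(2,3) gm \<phi>] by metis
  have pair: "integrable (lborel \<Otimes>\<^sub>M lborel) (\<lambda>(y, x). g x * (\<phi> (x - y) * ?k y))"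
  proof (rule lborel_pair.integrable_pairI_nn)
    have "(\<integral>\<^sup>+y. (\<integral>\<^sup>+x. norm (g x * (\<phi> (x - y) * ?k y)) \<partial>lborel) \<partial>lborel) \<le> (\<integral>\<^sup>+y. ennreal (norm (?k y)) * ennreal C \<partial>lborel)"
    proof (intro nn_integral_mono)
      fix y
      have "(\<integral>\<^sup>+x. norm (g x * (\<phi> (x - y) * ?k y)) \<partial>lborel) = ennreal (norm (?k y)) * (\<integral>\<^sup>+x. ennreal (norm (g x) * norm (\<phi> (x - y))) \<partial>lborel)"
        by (subst nn_integral_cmult[symmetric]) (auto simp: norm_mult ennreal_mult[symmetric] mult_ac)
      also have "(\<integral>\<^sup>+x. ennreal (norm (g x) * norm (\<phi> (x - y))) \<partial>lborel) = (\<integral>\<^sup>+x. ennreal (norm (g (x + y)) * norm (\<phi> x)) \<partial>lborel)"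
        using nn_integral_lborel_shift[of "\<lambda>x. ennreal (norm (g x) * norm (\<phi> (x - y)))" y] by simp
      also have "ennreal (norm (?k y)) * \<dots> \<le> ennreal (norm (?k y)) * ennreal C"
        by (intro mult_left_mono C) simp
      finally show "(\<integral>\<^sup>+x. norm (g x * (\<phi> (x - y) * ?k y)) \<partial>lborel) \<le> ennreal (norm (?k y)) * ennreal C" .
    qed
    also have "\<dots> = (\<integral>\<^sup>+y. ennreal (norm (?k y)) \<partial>lborel) * ennreal C"
      by (intro nn_integral_multc) auto
    also have "\<dots> < \<infinity>" using ik unfolding integrable_iff_bounded by (simp add: ennreal_mult_less_top)
    finally show "(\<integral>\<^sup>+y. (\<integral>\<^sup>+x. norm (g x * (\<phi> (x - y) * ?k y)) \<partial>lborel) \<partial>lborel) < \<infinity>" .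
  qed measurable
  have "f (multiplier m \<phi>) = (\<integral>x. g x * multiplier m \<phi> x \<partial>lborel)"
    using g(1) multiplier_schwartz[OF m \<phi>] by (simp add: represents_def)
  also have "\<dots> = (\<integral>x. (\<integral>y. g x * (\<phi> (x - y) * ?k y) \<partial>lborel) \<partial>lborel)"
    unfolding multiplier_eq_convolution[OF rapidly_decaying_integrable[OF test_fun_rapidly_decaying[OF m]] schwartz_integrable[OF \<phi>]]
    by (simp only: integral_mult_right_zero)
  also have "\<dots> = (\<integral>y. (\<integral>x. g x * (\<phi> (x - y) * ?k y) \<partial>lborel) \<partial>lborel)"
    by (rule lborel_pair.Fubini_integral[OF pair])
  also have "\<dots> = (\<integral>y. f (\<lambda>x. \<phi> (x - y)) * ?k y \<partial>lborel)"
  proof -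
    have "f (\<lambda>x. \<phi> (x - y)) = (\<integral>x. g x * \<phi> (x - y) \<partial>lborel)" for y
      using g(1) schwartz_translate[OF \<phi>] by (simp add: represents_def)
    then show ?thesis by (simp only: integral_mult_left_zero mult.assoc[symmetric])
  qed
  finally show ?thesis by (simp add: dconv_def)
qed

text \<open>Any lower bound \<open>G \<epsilon>\<close> for the gap between the mass of the truncated kernel and its distance to \<open>M\<close> is a gain in the
dissipative estimate. It persists in the limit because the error of the truncation is small in norm.\<close>

lemma spectral_gap_estimate:
  fixes f :: "'a::euclidean_space distr" and K :: "'a \<Rightarrow> real"
  assumes A: "valid_orlicz A" and fin: "luxemburg_norm_distr A f < \<infinity>" and lam: "0 < lam"
    and \<kappa>: "\<kappa> \<in> schwartz" and rep: "\<And>\<phi>. \<phi> \<in> schwartz \<Longrightarrow> dconv f \<kappa> \<phi> = f \<phi>"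
    and K: "K \<in> borel_measurable borel" and K0: "\<And>z. 0 \<le> K z"
    and K2: "(\<integral>\<^sup>+z. ennreal (min 1 ((norm z)\<^sup>2) * K z) \<partial>lborel) < \<infinity>"
    and lim: "(\<integral>\<^sup>+z. ennreal (min 1 (norm z) * K z) \<partial>lborel) < \<infinity> \<or>
      (\<forall>\<phi>\<in>schwartz. \<exists>l. ((\<lambda>\<epsilon>. truncated_generator K \<epsilon> f \<phi>) \<longlongrightarrow> l) (at_right 0))"
    and M: "integrable lborel M" and zero: "\<And>\<phi>. \<phi> \<in> schwartz \<Longrightarrow> dconv f M \<phi> = 0"
    and gap: "\<And>\<epsilon>. 0 < \<epsilon> \<Longrightarrow> \<epsilon> \<le> 1 \<Longrightarrow> G \<epsilon> + (\<integral>z. norm (complex_of_real (indicator {z. \<epsilon> < norm z} z * K z) - M z) \<partial>lborel)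
        \<le> (\<integral>z. indicator {z. \<epsilon> < norm z} z * K z \<partial>lborel)"
    and G: "(G \<longlongrightarrow> G\<^sub>0) (at_right 0)"
  shows "ennreal (lam + G\<^sub>0) * luxemburg_norm_distr A f \<le>
    luxemburg_norm_distr A (\<lambda>\<phi>. complex_of_real lam * f \<phi> - Lim (at_right 0) (\<lambda>\<epsilon>. truncated_generator K \<epsilon> f \<phi>))"
proof -
  obtain L R where R: "(R \<longlongrightarrow> 0) (at_right 0)"
    and L: "\<And>\<phi>. \<phi> \<in> schwartz \<Longrightarrow> ((\<lambda>\<epsilon>. truncated_generator K \<epsilon> f \<phi>) \<longlongrightarrow> L \<phi>) (at_right 0)"
    and rem: "\<And>\<epsilon>. 0 < \<epsilon> \<Longrightarrow> \<epsilon> \<le> 1 \<Longrightarrow> luxemburg_norm_distr A (\<lambda>\<phi>. L \<phi> - truncated_generator K \<epsilon> f \<phi>) \<le> ennreal (R \<epsilon>) * luxemburg_norm_distr A f"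
    using principal_value_approximation[OF A fin \<kappa> rep K K0 K2 lim] by blast
  define w where "w = (\<lambda>\<phi>. complex_of_real lam * f \<phi> - L \<phi>)"
  have "luxemburg_norm_distr A (\<lambda>\<phi>. complex_of_real lam * f \<phi> - Lim (at_right 0) (\<lambda>\<epsilon>. truncated_generator K \<epsilon> f \<phi>)) = luxemburg_norm_distr A w"
    by (rule luxemburg_norm_distr_cong) (simp add: w_def tendsto_Lim[OF trivial_limit_at_right_real L])
  moreover have "ennreal (lam + G\<^sub>0) * luxemburg_norm_distr A f \<le> luxemburg_norm_distr A w"
  proof (cases "luxemburg_norm_distr A w = \<infinity>")
    case False
    then obtain v where v: "0 \<le> v" "luxemburg_norm_distr A w = ennreal v"
      by (cases "luxemburg_norm_distr A w") auto
    obtain n where n: "0 \<le> n" "luxemburg_norm_distr A f = ennreal n"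
      using fin by (cases "luxemburg_norm_distr A f") auto
    have orb: "bounded_orbits f" by (rule finite_norm_bounded_orbits[OF A fin])
    have step: "(lam + G \<epsilon> - max 0 (R \<epsilon>)) * n \<le> v" if \<epsilon>: "0 < \<epsilon>" "\<epsilon> \<le> 1" for \<epsilon>
    proof -
      let ?K = "\<lambda>z. indicator {z. \<epsilon> < norm z} z * K z"
      let ?k = "\<integral>z. ?K z \<partial>lborel"
      let ?d = "\<integral>z. norm (complex_of_real (?K z) - M z) \<partial>lborel"
      have iK: "integrable lborel ?K" by (rule truncated_levy_integrable[OF K K0 K2 \<epsilon>(1)])
      have k: "0 \<le> ?k" by (simp add: K0)
      \<comment> \<open>The sign of \<open>R \<epsilon>\<close> is unknown here, and \<open>ennreal\<close> truncates at zero.\<close>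
      define r where "r = max 0 (R \<epsilon>)"
      have r: "0 \<le> r" "R \<epsilon> \<le> r" by (auto simp: r_def)
      have "ennreal (lam + ?k) * luxemburg_norm_distr A f \<le> luxemburg_norm_distr A w + luxemburg_norm_distr A (\<lambda>\<phi>. L \<phi> - truncated_generator K \<epsilon> f \<phi>)
        + ennreal ?d * luxemburg_norm_distr A f"
      proof (rule dissipative_estimate[OF A fin lam iK _ M zero])
        fix \<phi> :: "'a \<Rightarrow> complex" assume \<phi>: "\<phi> \<in> schwartz"
        show "complex_of_real lam * f \<phi> = w \<phi> + (L \<phi> - truncated_generator K \<epsilon> f \<phi>) + (dconv f (\<lambda>z. complex_of_real (?K z)) \<phi> - complex_of_real ?k * f \<phi>)"
          unfolding truncated_generator_eq_dconv[OF orb \<phi> iK] w_def by simp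
      qed (simp_all add: K0)
      also have "\<dots> \<le> ennreal v + ennreal (R \<epsilon>) * ennreal n + ennreal ?d * ennreal n"
        using rem[OF \<epsilon>] unfolding v(2) n(2) by (intro add_mono order_refl)
      also have "\<dots> \<le> ennreal v + ennreal (r) * ennreal n + ennreal ?d * ennreal n"
        by (intro add_mono order_refl mult_right_mono ennreal_leI r) auto
      also have "\<dots> = ennreal (v + r * n + ?d * n)"
        using v n r by (simp add: ennreal_mult[symmetric] ennreal_plus[symmetric] del: ennreal_plus)
      finally have "ennreal ((lam + ?k) * n) \<le> ennreal (v + r * n + ?d * n)"
        unfolding n(2) using lam k n by (simp add: ennreal_mult)
      then have "(lam + ?k) * n \<le> v + r * n + ?d * n"
        using v n r by (subst (asm) ennreal_le_iff) auto
      moreover have "(G \<epsilon> + ?d) * n \<le> ?k * n" by (intro mult_right_mono gap \<epsilon> n)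
      ultimately show ?thesis unfolding r_def[symmetric] by (simp add: algebra_simps)
    qed
    have "(lam + G\<^sub>0 - max 0 0) * n \<le> v"
    proof (rule tendsto_upperbound)
      show "((\<lambda>\<epsilon>. (lam + G \<epsilon> - max 0 (R \<epsilon>)) * n) \<longlongrightarrow> (lam + G\<^sub>0 - max 0 0) * n) (at_right 0)"
        by (intro tendsto_intros G R)
      show "\<forall>\<^sub>F \<epsilon> in at_right 0. (lam + G \<epsilon> - max 0 (R \<epsilon>)) * n \<le> v"
        by (rule eventually_at_rightI[of 0 1]) (auto intro: step)
    qed simp
    then show ?thesis unfolding n(2) v(2) using n v by (subst ennreal_mult''[symmetric]) (auto intro: ennreal_leI)
  qed simp
  ultimately show ?thesis by simp
qed

text \<open>As \<open>k\<close> has mass one, \<open>P - k * P\<close> is the average of \<open>P - P(\<cdot> - y)\<close> with weight \<open>k(y)\<close>.\<close>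

lemma convolution_approximate_identity:
  fixes k :: "'a::euclidean_space \<Rightarrow> complex" and P :: "'a \<Rightarrow> real"
  assumes k: "integrable lborel k" "(\<integral>y. k y \<partial>lborel) = 1" "integrable lborel (\<lambda>y. norm y * norm (k y))"
    and P: "integrable lborel P" and c: "\<And>y. (\<integral>x. \<bar>P x - P (x - y)\<bar> \<partial>lborel) \<le> c * norm y"
  shows "(\<integral>x. norm (complex_of_real (P x) - (\<integral>y. k y * complex_of_real (P (x - y)) \<partial>lborel)) \<partial>lborel)
    \<le> c * (\<integral>y. norm y * norm (k y) \<partial>lborel)"
proof -
  have [measurable]: "k \<in> borel_measurable borel" "P \<in> borel_measurable borel"
    using borel_measurable_integrable[OF k(1)] borel_measurable_integrable[OF P] by simp_all
  have Pc: "integrable lborel (\<lambda>x. complex_of_real (P x))" using P by simp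
  let ?D = "\<lambda>x. complex_of_real (P x) - (\<integral>y. k y * complex_of_real (P (x - y)) \<partial>lborel)"
  have pair: "integrable (lborel \<Otimes>\<^sub>M lborel) (\<lambda>(y, x). k y * complex_of_real (P (x - y)))"
    by (rule integrable_convolution_pair[OF k(1) Pc])
  have iD: "integrable lborel ?D"
    by (intro Bochner_Integration.integrable_diff Pc lborel_pair.integrable_snd[OF pair])
  have c0: "(\<integral>x. \<bar>P x - P (x - y)\<bar> \<partial>lborel) \<le> c * norm y" "0 \<le> c * norm y" for y
    using c[of y] order_trans[OF _ c[of y]] by (auto intro: integral_nonneg_AE)
  have "AE x in lborel. integrable lborel (\<lambda>y. k y * complex_of_real (P (x - y)))"
    using lborel_pair.AE_integrable_snd[OF pair] by simp
  then have bound: "AE x in lborel. ennreal (norm (?D x)) \<le> (\<integral>\<^sup>+y. ennreal (norm (k y)) * ennreal \<bar>P x - P (x - y)\<bar> \<partial>lborel)"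
  proof eventually_elim
    case (elim x)
    have "?D x = (\<integral>y. k y * complex_of_real (P x) \<partial>lborel) - (\<integral>y. k y * complex_of_real (P (x - y)) \<partial>lborel)"
      by (simp add: k(2))
    also have "\<dots> = (\<integral>y. k y * complex_of_real (P x) - k y * complex_of_real (P (x - y)) \<partial>lborel)"
      by (intro Bochner_Integration.integral_diff[symmetric] integrable_mult_left k(1) elim)
    finally have "ennreal (norm (?D x)) \<le> (\<integral>\<^sup>+y. ennreal (norm (k y * complex_of_real (P x) - k y * complex_of_real (P (x - y)))) \<partial>lborel)"
      by (simp only: norm_integral_le_nn_integral)
    also have "\<dots> = (\<integral>\<^sup>+y. ennreal (norm (k y)) * ennreal \<bar>P x - P (x - y)\<bar> \<partial>lborel)"
      by (intro nn_integral_cong)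
        (simp add: right_diff_distrib[symmetric] of_real_diff[symmetric] norm_mult ennreal_mult del: of_real_diff)
    finally show ?case .
  qed
  have "ennreal (\<integral>x. norm (?D x) \<partial>lborel) = (\<integral>\<^sup>+x. ennreal (norm (?D x)) \<partial>lborel)"
    by (intro nn_integral_eq_integral[symmetric] integrable_norm iD) auto
  also have "\<dots> \<le> (\<integral>\<^sup>+x. (\<integral>\<^sup>+y. ennreal (norm (k y)) * ennreal \<bar>P x - P (x - y)\<bar> \<partial>lborel) \<partial>lborel)"
    by (rule nn_integral_mono_AE[OF bound])
  also have "\<dots> = (\<integral>\<^sup>+y. (\<integral>\<^sup>+x. ennreal (norm (k y)) * ennreal \<bar>P x - P (x - y)\<bar> \<partial>lborel) \<partial>lborel)"
    by (rule lborel_pair.Fubini') measurable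
  also have "\<dots> \<le> (\<integral>\<^sup>+y. ennreal (c * (norm y * norm (k y))) \<partial>lborel)"
  proof (intro nn_integral_mono)
    fix y
    have "(\<integral>\<^sup>+x. ennreal \<bar>P x - P (x - y)\<bar> \<partial>lborel) = ennreal (\<integral>x. \<bar>P x - P (x - y)\<bar> \<partial>lborel)"
      by (intro nn_integral_eq_integral integrable_abs Bochner_Integration.integrable_diff P lborel_integrable_minus_shift) auto
    also have "\<dots> \<le> ennreal (c * norm y)" by (intro ennreal_leI c)
    finally have "ennreal (norm (k y)) * (\<integral>\<^sup>+x. ennreal \<bar>P x - P (x - y)\<bar> \<partial>lborel) \<le> ennreal (norm (k y)) * ennreal (c * norm y)"
      by (rule mult_left_mono) simp
    also have "\<dots> = ennreal (c * (norm y * norm (k y)))"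
      by (subst ennreal_mult'[symmetric]) (simp_all add: mult_ac)
    finally show "(\<integral>\<^sup>+x. ennreal (norm (k y)) * ennreal \<bar>P x - P (x - y)\<bar> \<partial>lborel) \<le> ennreal (c * (norm y * norm (k y)))"
      by (subst nn_integral_cmult) simp_all
  qed
  also have "\<dots> = ennreal (\<integral>y. c * (norm y * norm (k y)) \<partial>lborel)"
    using mult_nonneg_nonneg[OF c0(2) norm_ge_zero] by (intro nn_integral_eq_integral integrable_mult_right k(3)) (auto simp: mult.assoc)
  finally have le: "ennreal (\<integral>x. norm (?D x) \<partial>lborel) \<le> ennreal (\<integral>y. c * (norm y * norm (k y)) \<partial>lborel)" .
  have "0 \<le> c * (norm y * norm (k y))" for y
    using mult_nonneg_nonneg[OF c0(2)[of y] norm_ge_zero[of "k y"]] by (simp add: mult.assoc)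
  then have "0 \<le> (\<integral>y. c * (norm y * norm (k y)) \<partial>lborel)" by (rule Bochner_Integration.integral_nonneg)
  then have "(\<integral>x. norm (?D x) \<partial>lborel) \<le> (\<integral>y. c * (norm y * norm (k y)) \<partial>lborel)"
    using le by (simp only: ennreal_le_iff)
  then show ?thesis by (simp only: integral_mult_right_zero)
qed

text \<open>The distance of two functions is the difference of their integrals plus twice the integral of the negative part. The kernel
\<open>P\<close> exceeds the truncation of \<open>K\<close> only for \<open>|z| \<ge> \<rho>\<close> or \<open>|z| \<le> \<epsilon>\<close>.\<close>

lemma kernel_comparison:
  fixes K P :: "'a::euclidean_space \<Rightarrow> real"
  assumes iK: "integrable lborel (\<lambda>z. indicator {z. \<epsilon> < norm z} z * K z)" and K0: "\<And>z. 0 \<le> K z"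
    and P: "integrable lborel P" and P0: "\<And>z. 0 \<le> P z"
    and le: "\<And>z. z \<noteq> 0 \<Longrightarrow> norm z < \<rho> \<Longrightarrow> P z \<le> K z" and \<epsilon>: "0 < \<epsilon>"
  shows "(\<integral>z. \<bar>indicator {z. \<epsilon> < norm z} z * K z - P z\<bar> \<partial>lborel) \<le>
    (\<integral>z. indicator {z. \<epsilon> < norm z} z * K z \<partial>lborel) - (\<integral>z. P z \<partial>lborel)
    + 2 * (\<integral>z. indicator {z. \<rho> \<le> norm z} z * P z \<partial>lborel)
    + 2 * ((\<integral>z. P z \<partial>lborel) - (\<integral>z. indicator {z. \<epsilon> < norm z} z * P z \<partial>lborel))"
proof -
  have [measurable]: "P \<in> borel_measurable borel" using borel_measurable_integrable[OF P] by simp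
  let ?K = "\<lambda>z. indicator {z. \<epsilon> < norm z} z * K z"
  have i1: "integrable lborel (\<lambda>z. indicator {z. \<rho> \<le> norm z} z * P z)"
    and i2: "integrable lborel (\<lambda>z. indicator {z. \<epsilon> < norm z} z * P z)"
    by (rule Bochner_Integration.integrable_bound[OF P]; auto split: split_indicator)+
  have "(\<integral>z. \<bar>?K z - P z\<bar> \<partial>lborel) \<le> (\<integral>z. ?K z - P z + 2 * (indicator {z. \<rho> \<le> norm z} z * P z)
      + 2 * (P z - indicator {z. \<epsilon> < norm z} z * P z) \<partial>lborel)"
  proof (intro integral_mono integrable_abs Bochner_Integration.integrable_diff Bochner_Integration.integrable_add integrable_mult_right iK P i1 i2)
    fix z :: 'a
    show "\<bar>?K z - P z\<bar> \<le> ?K z - P z + 2 * (indicator {z. \<rho> \<le> norm z} z * P z) + 2 * (P z - indicator {z. \<epsilon> < norm z} z * P z)"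
    proof (cases "\<epsilon> < norm z")
      case True
      then have "z \<noteq> 0" using \<epsilon> by auto
      then show ?thesis using True le[of z] P0[of z] K0[of z] by (cases "norm z < \<rho>") auto
    next
      case False
      then show ?thesis using P0[of z] by (auto split: split_indicator)
    qed
  qed
  also have "\<dots> = (\<integral>z. ?K z \<partial>lborel) - (\<integral>z. P z \<partial>lborel) + 2 * (\<integral>z. indicator {z. \<rho> \<le> norm z} z * P z \<partial>lborel)
    + 2 * ((\<integral>z. P z \<partial>lborel) - (\<integral>z. indicator {z. \<epsilon> < norm z} z * P z \<partial>lborel))"
    using iK P i1 i2 by simp
  finally show ?thesis .
qed

section \<open>Estimates for the blocks\<close>

lemma multiplier_kernel_first_moment_scale:
  fixes m :: "'a::euclidean_space \<Rightarrow> complex"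
  assumes r: "0 < r"
  shows "(\<integral>y. norm y * norm (multiplier_kernel (\<lambda>\<xi>. m (\<xi> /\<^sub>R r)) y) \<partial>lborel) = (\<integral>y. norm y * norm (multiplier_kernel m y) \<partial>lborel) / r"
proof -
  have "(\<integral>y. norm y * norm (multiplier_kernel m y) \<partial>lborel) =
    \<bar>r\<bar> ^ DIM('a) *\<^sub>R (\<integral>y. norm (0 + r *\<^sub>R y) * norm (multiplier_kernel m (0 + r *\<^sub>R y)) \<partial>lborel)"
    using r by (intro lborel_integral_affine) simp
  also have "\<dots> = (\<integral>y. r ^ DIM('a) * (norm (0 + r *\<^sub>R y) * norm (multiplier_kernel m (0 + r *\<^sub>R y))) \<partial>lborel)"
    unfolding integral_mult_right_zero using r by simp
  also have "\<dots> = (\<integral>y. r * (norm y * norm (multiplier_kernel (\<lambda>\<xi>. m (\<xi> /\<^sub>R r)) y)) \<partial>lborel)"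
    using r by (intro Bochner_Integration.integral_cong)
      (simp_all add: multiplier_kernel_scale norm_mult norm_power)
  also have "\<dots> = r * (\<integral>y. norm y * norm (multiplier_kernel (\<lambda>\<xi>. m (\<xi> /\<^sub>R r)) y) \<partial>lborel)"
    by (rule integral_mult_right_zero)
  finally show ?thesis using r by simp
qed

lemma lp_block_eq_multiplier:
  "lp_block \<nu> \<theta> j u = (\<lambda>\<phi>. u (multiplier (\<lambda>\<xi>. complex_of_real (lp_symbol \<nu> \<theta> j \<xi>)) \<phi>))"
  by (simp add: lp_block_def inv_fourier_distr_def mult_distr_def fourier_distr_def multiplier_def)

lemma nonlocal_trunc_multiplier:
  "nonlocal_trunc \<nu> a \<epsilon> u (multiplier m \<phi>) =
    truncated_generator (\<lambda>z. a z * jump_kernel \<nu> z) \<epsilon> (\<lambda>\<phi>. u (multiplier m \<phi>)) \<phi>"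
  by (simp add: nonlocal_trunc_def truncated_generator_def multiplier_translate)

text \<open>Blocks commute with the nonlocal operator, including its definition as a limit, because multipliers commute with
translations.\<close>

lemma lp_block_resolvent:
  "lp_block \<nu> \<theta> j (\<lambda>\<phi>. c * u \<phi> - nonlocal_op \<nu> a u \<phi>) = (\<lambda>\<phi>. c * lp_block \<nu> \<theta> j u \<phi> -
    Lim (at_right 0) (\<lambda>\<epsilon>. truncated_generator (\<lambda>z. a z * jump_kernel \<nu> z) \<epsilon> (lp_block \<nu> \<theta> j u) \<phi>))"
  by (simp add: lp_block_eq_multiplier nonlocal_op_def nonlocal_trunc_multiplier)

lemma tempered_zero: "tempered u \<Longrightarrow> u (\<lambda>_. 0) = 0"
proof -
  assume u: "tempered u"
  have "test_fun (\<lambda>_::'a. 0::complex)" by (auto simp: test_fun_def smooth_const)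
  then have zero: "(\<lambda>_::'a. 0::complex) \<in> schwartz" by (rule test_fun_schwartz)
  have "u (\<lambda>x. c * \<phi> x) = c * u \<phi>" if "\<phi> \<in> schwartz" for \<phi> c
    using u that by (simp add: tempered_def)
  from this[OF zero, of 0] show ?thesis by simp
qed

text \<open>The standing hypotheses on the subordinator and on the cutoff. Slow variation enters in \<open>uniform_block_estimate\<close>.\<close>

locale littlewood_paley =
  fixes \<nu> :: "real measure" and \<theta> :: "'a::euclidean_space \<Rightarrow> real"
  assumes levy: "levy_measure \<nu>"
    and unbounded: "filterlim (laplace_exponent \<nu>) at_top at_top"
    and cutoff: "lp_cutoff \<theta>"
begin

definition band :: "int \<Rightarrow> real" where
  "band j = psi_inv \<nu> (2 powr real_of_int j)"

definition dilated_cutoff :: "real \<Rightarrow> 'a \<Rightarrow> complex" where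
  "dilated_cutoff r \<xi> = complex_of_real (\<theta> (\<xi> /\<^sub>R r))"

lemma band_pos: "0 < band j"
  unfolding band_def by (rule psi_inv(1)[OF levy unbounded]) simp

lemma band_less: "band j < band (j + 1)"
  unfolding band_def by (rule psi_inv_mono[OF levy unbounded]) auto

lemma dilated_cutoff_test_fun: "0 < r \<Longrightarrow> test_fun (dilated_cutoff r)"
  unfolding dilated_cutoff_def[abs_def] by (rule lp_cutoff_test_fun[OF cutoff])

lemma dilated_cutoff_one: "0 < r \<Longrightarrow> norm \<xi> \<le> 3 / 4 * r \<Longrightarrow> dilated_cutoff r \<xi> = 1"
  using cutoff by (simp add: dilated_cutoff_def lp_cutoff_def divide_simps)

lemma dilated_cutoff_zero: "0 < r \<Longrightarrow> r \<le> norm \<xi> \<Longrightarrow> dilated_cutoff r \<xi> = 0"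
  using cutoff by (simp add: dilated_cutoff_def lp_cutoff_def divide_simps)

lemma lp_symbol_eq:
  "complex_of_real (lp_symbol \<nu> \<theta> j \<xi>) =
    (if j = -1 then dilated_cutoff (band 0) \<xi> else dilated_cutoff (band (j + 1)) \<xi> - dilated_cutoff (band j) \<xi>)"
  by (simp add: lp_symbol_def cutoff_at_def dilated_cutoff_def band_def)

abbreviation symbol :: "int \<Rightarrow> 'a \<Rightarrow> complex" where
  "symbol j \<equiv> (\<lambda>\<xi>. complex_of_real (lp_symbol \<nu> \<theta> j \<xi>))"

lemma symbol_test_fun: "test_fun (symbol j)"
proof (cases "j = -1")
  case True
  then show ?thesis unfolding lp_symbol_eq by (simp add: dilated_cutoff_test_fun band_pos)
next
  case False
  then show ?thesis
    unfolding lp_symbol_eq by (simp add: test_fun_diff dilated_cutoff_test_fun band_pos)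
qed

text \<open>The symbol of a block vanishes for \<open>|\<xi>| \<ge> band (j + 1)\<close>, and the cutoff at twice this frequency equals one
below it, as \<open>3/4 \<cdot> 2 > 1\<close>. For \<open>j = -1\<close> the edge is \<open>band 0\<close>.\<close>

lemma symbol_high: "symbol j \<xi> * dilated_cutoff (2 * band (j + 1)) \<xi> = symbol j \<xi>"
proof (cases "norm \<xi> \<le> band (j + 1)")
  case True
  then have "dilated_cutoff (2 * band (j + 1)) \<xi> = 1"
    using band_pos[of "j + 1"] by (intro dilated_cutoff_one) auto
  then show ?thesis by simp
next
  case False
  then have "symbol j \<xi> = 0"
    unfolding lp_symbol_eq using band_less[of j] band_pos[of j] band_pos[of "j + 1"]
    by (auto simp: dilated_cutoff_zero)
  then show ?thesis by simp
qed

text \<open>Below \<open>3/4 band j\<close> both cutoffs in the symbol equal one; above this frequency the cutoff at half the band vanishes, as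
\<open>1/2 < 3/4\<close>. The block \<open>j = -1\<close> contains the low frequencies and has to be excluded.\<close>

lemma symbol_low: "j \<noteq> -1 \<Longrightarrow> symbol j \<xi> * dilated_cutoff (band j / 2) \<xi> = 0"
proof (cases "norm \<xi> \<le> 3 / 4 * band j")
  case True
  then have "norm \<xi> \<le> 3 / 4 * band (j + 1)" using band_less[of j] by simp
  moreover assume "j \<noteq> -1"
  ultimately have "symbol j \<xi> = 0"
    unfolding lp_symbol_eq using True band_pos by (simp add: dilated_cutoff_one)
  then show ?thesis by simp
next
  case False
  then have "dilated_cutoff (band j / 2) \<xi> = 0" using band_pos[of j] by (intro dilated_cutoff_zero) auto
  then show ?thesis by simp
qed

lemma dconv_block:
  assumes A: "valid_orlicz A" and fin: "luxemburg_norm_distr A (lp_block \<nu> \<theta> j u) < \<infinity>"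
    and m: "test_fun m" and \<phi>: "\<phi> \<in> schwartz"
  shows "dconv (lp_block \<nu> \<theta> j u) (multiplier_kernel m) \<phi> = u (multiplier (\<lambda>\<xi>. symbol j \<xi> * m \<xi>) \<phi>)"
  unfolding dconv_multiplier_kernel[OF A fin m \<phi>]
  by (simp add: lp_block_eq_multiplier multiplier_multiplier[OF m \<phi>])

lemma dconv_block_high:
  assumes A: "valid_orlicz A" and fin: "luxemburg_norm_distr A (lp_block \<nu> \<theta> j u) < \<infinity>" and \<phi>: "\<phi> \<in> schwartz"
  shows "dconv (lp_block \<nu> \<theta> j u) (multiplier_kernel (dilated_cutoff (2 * band (j + 1)))) \<phi> = lp_block \<nu> \<theta> j u \<phi>"
proof -
  have "test_fun (dilated_cutoff (2 * band (j + 1)))" by (rule dilated_cutoff_test_fun) (simp add: band_pos)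
  from dconv_block[OF A fin this \<phi>] show ?thesis
    unfolding symbol_high by (simp add: lp_block_eq_multiplier)
qed

lemma dconv_block_low:
  assumes A: "valid_orlicz A" and fin: "luxemburg_norm_distr A (lp_block \<nu> \<theta> j u) < \<infinity>" and \<phi>: "\<phi> \<in> schwartz"
    and u: "tempered u" and j: "j \<noteq> -1"
  shows "dconv (lp_block \<nu> \<theta> j u) (multiplier_kernel (dilated_cutoff (band j / 2))) \<phi> = 0"
proof -
  have "test_fun (dilated_cutoff (band j / 2))" by (rule dilated_cutoff_test_fun) (simp add: band_pos)
  then show ?thesis
  proof -
    have "fourier (\<lambda>_::'a. 0) = (\<lambda>_. 0)" by (simp add: fourier_def fun_eq_iff)
    then show ?thesis
      using dconv_block[OF A fin \<open>test_fun (dilated_cutoff (band j / 2))\<close> \<phi>]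
      unfolding symbol_low[OF j] by (simp add: multiplier_def tempered_zero[OF u])
  qed
qed

text \<open>The block of a distribution, evaluated at \<open>\<phi>\<close>, is the distribution evaluated at a Schwartz function, so that existence of the
principal value for \<open>u\<close> implies existence for its blocks.\<close>

lemma nonlocal_op_defined_block:
  assumes "nonlocal_op_defined \<nu> a u"
  shows "(\<integral>\<^sup>+z. ennreal (min 1 (norm z) * (a z * jump_kernel \<nu> z)) \<partial>lborel) < \<infinity> \<or>
    (\<forall>\<phi>\<in>schwartz. \<exists>l. ((\<lambda>\<epsilon>. truncated_generator (\<lambda>z. a z * jump_kernel \<nu> z) \<epsilon> (lp_block \<nu> \<theta> j u) \<phi>) \<longlongrightarrow> l) (at_right 0))"
  using assms unfolding nonlocal_op_defined_def
proof
  assume "\<forall>\<phi>\<in>schwartz. \<exists>l. ((\<lambda>\<epsilon>. nonlocal_trunc \<nu> a \<epsilon> u \<phi>) \<longlongrightarrow> l) (at_right 0)"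
  then have "\<exists>l. ((\<lambda>\<epsilon>. nonlocal_trunc \<nu> a \<epsilon> u (multiplier (symbol j) \<phi>)) \<longlongrightarrow> l) (at_right 0)" if "\<phi> \<in> schwartz" for \<phi>
    using multiplier_schwartz[OF symbol_test_fun that] by blast
  then show ?thesis unfolding nonlocal_trunc_multiplier lp_block_eq_multiplier by blast
qed simp

text \<open>The estimate with the correction \<open>M = 0\<close>, valid for all blocks.\<close>

lemma block_dissipative_estimate:
  fixes a :: "'a \<Rightarrow> real"
  assumes A: "valid_orlicz A" and fin: "luxemburg_norm_distr A (lp_block \<nu> \<theta> j u) < \<infinity>" and lam: "0 < lam"
    and am: "a \<in> borel_measurable borel" and a0: "\<And>z. 0 \<le> a z"
    and a2: "(\<integral>\<^sup>+z. ennreal (min 1 ((norm z)\<^sup>2) * (a z * jump_kernel \<nu> z)) \<partial>lborel) < \<infinity>"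
    and def: "nonlocal_op_defined \<nu> a u"
  shows "ennreal lam * luxemburg_norm_distr A (lp_block \<nu> \<theta> j u) \<le>
    luxemburg_norm_distr A (lp_block \<nu> \<theta> j (\<lambda>\<phi>. complex_of_real lam * u \<phi> - nonlocal_op \<nu> a u \<phi>))"
proof -
  have [measurable]: "a \<in> borel_measurable borel" "(jump_kernel \<nu> :: 'a \<Rightarrow> real) \<in> borel_measurable borel"
    by (rule am jump_kernel_measurable[OF levy])+
  have m: "(\<lambda>z. a z * jump_kernel \<nu> z) \<in> borel_measurable borel" by measurable
  have nn: "0 \<le> a z * jump_kernel \<nu> z" for z by (simp add: a0 jump_kernel_nonneg)
  have hi: "test_fun (dilated_cutoff (2 * band (j + 1)))" by (rule dilated_cutoff_test_fun) (simp add: band_pos)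
  have "ennreal (lam + 0) * luxemburg_norm_distr A (lp_block \<nu> \<theta> j u) \<le>
    luxemburg_norm_distr A (\<lambda>\<phi>. complex_of_real lam * lp_block \<nu> \<theta> j u \<phi> -
      Lim (at_right 0) (\<lambda>\<epsilon>. truncated_generator (\<lambda>z. a z * jump_kernel \<nu> z) \<epsilon> (lp_block \<nu> \<theta> j u) \<phi>))"
  proof (rule spectral_gap_estimate[OF A fin lam multiplier_kernel_schwartz[OF hi] dconv_block_high[OF A fin] m nn a2
      nonlocal_op_defined_block[OF def], where M="\<lambda>_. 0" and G="\<lambda>_. 0"])
    fix \<epsilon> :: real
    show "0 + (\<integral>z. norm (complex_of_real (indicator {z. \<epsilon> < norm z} z * (a z * jump_kernel \<nu> z)) - 0) \<partial>lborel)
      \<le> (\<integral>z. indicator {z. \<epsilon> < norm z} z * (a z * jump_kernel \<nu> z) \<partial>lborel)"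
    proof -
      have "norm (complex_of_real (indicator {z. \<epsilon> < norm z} z * (a z * jump_kernel \<nu> z)) - 0) = indicator {z. \<epsilon> < norm z} z * (a z * jump_kernel \<nu> z)" for z
        unfolding diff_0_right norm_of_real using nn[of z] by (intro abs_of_nonneg) simp
      then show ?thesis by (simp only:)
    qed
  qed (simp_all add: dconv_def)
  then show ?thesis by (simp add: lp_block_resolvent)
qed

text \<open>The correction is \<open>P * k\<close>, with \<open>P\<close> a multiple of the truncated jump kernel and \<open>k\<close> the low-pass kernel. The mass \<open>c \<mu>\<close> of \<open>P\<close> is
the gain; the losses are at most \<open>2 \<cdot> c \<mu> / 8\<close> from the jumps beyond \<open>\<rho>\<close>, at most \<open>c \<mu> / 4\<close> from replacing
\<open>P\<close> by \<open>P * k\<close>, and a term that vanishes with \<open>\<epsilon>\<close>. One half of the gain remains.\<close>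

lemma block_coercive_estimate:
  fixes a :: "'a \<Rightarrow> real" and s \<tau> :: real
  defines "C\<^sub>\<theta> \<equiv> \<integral>y. norm y * norm (multiplier_kernel (dilated_cutoff 1) y) \<partial>lborel"
  assumes A: "valid_orlicz A" and fin: "luxemburg_norm_distr A (lp_block \<nu> \<theta> j u) < \<infinity>" and lam: "0 < lam"
    and am: "a \<in> borel_measurable borel" and a0: "\<And>z. 0 \<le> a z"
    and a2: "(\<integral>\<^sup>+z. ennreal (min 1 ((norm z)\<^sup>2) * (a z * jump_kernel \<nu> z)) \<partial>lborel) < \<infinity>"
    and def: "nonlocal_op_defined \<nu> a u"
    and \<rho>: "0 < \<rho>" and c: "0 < c" and ac: "\<And>z. norm z < \<rho> \<Longrightarrow> c \<le> a z"
    and u: "tempered u" and j: "j \<noteq> -1" and s: "0 < s" and \<tau>: "0 < \<tau>"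
    and tail: "2 powr (real DIM('a) / 2) * exp (- (\<rho>\<^sup>2 / (8 * \<tau>))) \<le> 1 / 8"
    and moment: "6 * C\<^sub>\<theta> / (band j * sqrt s) \<le> 1 / 4"
  shows "ennreal (lam + c * measure \<nu> {s<..\<tau>} / 2) * luxemburg_norm_distr A (lp_block \<nu> \<theta> j u) \<le>
    luxemburg_norm_distr A (lp_block \<nu> \<theta> j (\<lambda>\<phi>. complex_of_real lam * u \<phi> - nonlocal_op \<nu> a u \<phi>))"
proof -
  have [measurable]: "a \<in> borel_measurable borel" "(jump_kernel \<nu> :: 'a \<Rightarrow> real) \<in> borel_measurable borel"
    by (rule am jump_kernel_measurable[OF levy])+
  define K where "K = (\<lambda>z. a z * jump_kernel \<nu> z)"
  have m: "K \<in> borel_measurable borel" unfolding K_def by measurable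
  have nn: "0 \<le> K z" for z by (simp add: K_def a0 jump_kernel_nonneg)
  have K2: "(\<integral>\<^sup>+z. ennreal (min 1 ((norm z)\<^sup>2) * K z) \<partial>lborel) < \<infinity>" using a2 by (simp add: K_def)
  have hi: "test_fun (dilated_cutoff (2 * band (j + 1)))" by (rule dilated_cutoff_test_fun) (simp add: band_pos)
  have lim: "(\<integral>\<^sup>+z. ennreal (min 1 (norm z) * K z) \<partial>lborel) < \<infinity> \<or>
    (\<forall>\<phi>\<in>schwartz. \<exists>l. ((\<lambda>\<epsilon>. truncated_generator K \<epsilon> (lp_block \<nu> \<theta> j u) \<phi>) \<longlongrightarrow> l) (at_right 0))"
    unfolding K_def by (rule nonlocal_op_defined_block[OF def])
  define r where "r = band j / 2"
  have r: "0 < r" by (simp add: r_def band_pos)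
  have lo: "test_fun (dilated_cutoff r)" by (rule dilated_cutoff_test_fun[OF r])
  define k where "k = multiplier_kernel (dilated_cutoff r)"
  have kS: "k \<in> schwartz" unfolding k_def by (rule multiplier_kernel_schwartz[OF lo])
  have ik: "integrable lborel k" by (rule schwartz_integrable[OF kS])
  have k1: "(\<integral>y. k y \<partial>lborel) = 1"
    unfolding k_def multiplier_kernel_integral[OF lo] using r by (intro dilated_cutoff_one) auto
  have kmom: "(\<integral>y. norm y * norm (k y) \<partial>lborel) = C\<^sub>\<theta> / r"
  proof -
    have "dilated_cutoff r = (\<lambda>\<xi>. dilated_cutoff 1 (\<xi> /\<^sub>R r))" by (simp add: dilated_cutoff_def fun_eq_iff)
    then show ?thesis unfolding k_def C\<^sub>\<theta>_def using multiplier_kernel_first_moment_scale[OF r, of "dilated_cutoff 1"] by simp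
  qed
  define \<mu> where "\<mu> = measure \<nu> {s<..\<tau>}"
  have \<mu>0: "0 \<le> \<mu>" by (simp add: \<mu>_def)
  define P where "P = (\<lambda>z::'a. c * truncated_kernel \<nu> s \<tau> z)"
  have iP: "integrable lborel P" unfolding P_def by (intro integrable_mult_right truncated_kernel_integrable[OF levy s])
  have P0: "0 \<le> P z" for z using c by (simp add: P_def truncated_kernel_nonneg)
  have [measurable]: "P \<in> borel_measurable borel" using borel_measurable_integrable[OF iP] by simp
  have intP: "(\<integral>z. P z \<partial>lborel) = c * \<mu>"
    by (simp add: P_def truncated_kernel_integral[OF levy s] \<mu>_def)
  have PK: "P z \<le> K z" if "z \<noteq> 0" "norm z < \<rho>" for z
    unfolding P_def K_def using that c ac[of z] truncated_kernel_le_jump_kernel[OF levy s that(1)] a0[of z]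
    by (intro mult_mono) (auto simp: truncated_kernel_nonneg)
  define t where "t = (\<integral>z. indicator {z. \<rho> \<le> norm z} z * P z \<partial>lborel)"
  have t: "t \<le> c * \<mu> / 8"
  proof -
    note [measurable] = truncated_kernel_measurable[OF levy]
    have iT: "integrable lborel (\<lambda>z::'a. indicator {z. \<rho> \<le> norm z} z * truncated_kernel \<nu> s \<tau> z)"
      by (rule Bochner_Integration.integrable_bound[OF truncated_kernel_integrable[OF levy s]])
        (auto split: split_indicator)
    have "ennreal (\<integral>z. indicator {z::'a. \<rho> \<le> norm z} z * truncated_kernel \<nu> s \<tau> z \<partial>lborel) =
        (\<integral>\<^sup>+z. ennreal (indicator {z::'a. \<rho> \<le> norm z} z * truncated_kernel \<nu> s \<tau> z) \<partial>lborel)"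
      by (intro nn_integral_eq_integral[symmetric] iT) (simp add: truncated_kernel_nonneg)
    also have "\<dots> \<le> ennreal (2 powr (real DIM('a) / 2) * exp (- (\<rho>\<^sup>2 / (8 * \<tau>))) * \<mu>)"
      unfolding \<mu>_def by (rule truncated_kernel_tail[OF levy s \<rho> \<tau>])
    also have "\<dots> \<le> ennreal (1 / 8 * \<mu>)" by (intro ennreal_leI mult_right_mono tail \<mu>0)
    finally have "(\<integral>z. indicator {z::'a. \<rho> \<le> norm z} z * truncated_kernel \<nu> s \<tau> z \<partial>lborel) \<le> 1 / 8 * \<mu>"
      using \<mu>0 by (subst (asm) ennreal_le_iff) auto
    then have "c * (\<integral>z. indicator {z::'a. \<rho> \<le> norm z} z * truncated_kernel \<nu> s \<tau> z \<partial>lborel) \<le> c * (1 / 8 * \<mu>)"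
      using c by (intro mult_left_mono) auto
    then show ?thesis unfolding t_def P_def by (simp add: mult.left_commute)
  qed
  define N where "N = (\<lambda>x. \<integral>y. k y * complex_of_real (P (x - y)) \<partial>lborel)"
  have iPc: "integrable lborel (\<lambda>x. complex_of_real (P x))" using iP by simp
  have iN: "integrable lborel N"
    unfolding N_def by (rule lborel_pair.integrable_snd[OF integrable_convolution_pair[OF ik iPc]])
  define h where "h = (\<integral>x. norm (complex_of_real (P x) - N x) \<partial>lborel)"
  have h: "h \<le> c * \<mu> / 4"
  proof -
    have "h \<le> (c * (3 / sqrt s * \<mu>)) * (\<integral>y. norm y * norm (k y) \<partial>lborel)"
      unfolding h_def N_def
    proof (rule convolution_approximate_identity[OF ik k1 schwartz_first_moment[OF kS] iP])
      fix y :: 'a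
      have "(\<integral>x. \<bar>P x - P (x - y)\<bar> \<partial>lborel) = c * (\<integral>x. \<bar>truncated_kernel \<nu> s \<tau> x - truncated_kernel \<nu> s \<tau> (x - y)\<bar> \<partial>lborel)"
        unfolding P_def right_diff_distrib[symmetric] abs_mult using c by simp
      also have "\<dots> \<le> c * (3 * norm y / sqrt s * \<mu>)"
        unfolding \<mu>_def using c by (intro mult_left_mono truncated_kernel_translation[OF levy s]) auto
      finally show "(\<integral>x. \<bar>P x - P (x - y)\<bar> \<partial>lborel) \<le> c * (3 / sqrt s * \<mu>) * norm y"
        by (simp add: mult_ac)
    qed
    also have "\<dots> = c * \<mu> * (6 * C\<^sub>\<theta> / (band j * sqrt s))" unfolding kmom by (simp add: r_def mult_ac)
    also have "\<dots> \<le> c * \<mu> * (1 / 4)" using c \<mu>0 by (intro mult_left_mono moment) auto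
    finally show ?thesis by simp
  qed
  define G where "G = (\<lambda>\<epsilon>. c * \<mu> - 2 * t - h - 2 * (c * \<mu> - (\<integral>z. indicator {z. \<epsilon> < norm z} z *\<^sub>R P z \<partial>lborel)))"
  have "ennreal (lam + (c * \<mu> - 2 * t - h - 2 * (c * \<mu> - (\<integral>z. P z \<partial>lborel)))) * luxemburg_norm_distr A (lp_block \<nu> \<theta> j u) \<le>
    luxemburg_norm_distr A (\<lambda>\<phi>. complex_of_real lam * lp_block \<nu> \<theta> j u \<phi> -
      Lim (at_right 0) (\<lambda>\<epsilon>. truncated_generator K \<epsilon> (lp_block \<nu> \<theta> j u) \<phi>))"
  proof (rule spectral_gap_estimate[OF A fin lam multiplier_kernel_schwartz[OF hi] dconv_block_high[OF A fin] m nn K2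
      lim iN, where G=G])
    show "dconv (lp_block \<nu> \<theta> j u) N \<phi> = 0" if "\<phi> \<in> schwartz" for \<phi>
      unfolding N_def using dconv_block_low[OF A fin _ u j] that
      by (intro dconv_convolution_zero[OF finite_norm_bounded_orbits[OF A fin] ik iPc]) (simp_all add: k_def r_def)
    show "(G \<longlongrightarrow> c * \<mu> - 2 * t - h - 2 * (c * \<mu> - (\<integral>z. P z \<partial>lborel))) (at_right 0)"
      unfolding G_def by (intro tendsto_intros truncated_integral_tendsto[OF iP])
    fix \<epsilon> :: real assume \<epsilon>: "0 < \<epsilon>"
    let ?K = "\<lambda>z. indicator {z. \<epsilon> < norm z} z * K z"
    have iK: "integrable lborel ?K" by (rule truncated_levy_integrable[OF m nn K2 \<epsilon>])
    have iKP: "integrable lborel (\<lambda>z. \<bar>?K z - P z\<bar>)"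
      by (intro integrable_abs Bochner_Integration.integrable_diff iK iP)
    have iPN: "integrable lborel (\<lambda>z. norm (complex_of_real (P z) - N z))"
      by (intro integrable_norm Bochner_Integration.integrable_diff iPc iN)
    have "(\<integral>z. norm (complex_of_real (?K z) - N z) \<partial>lborel) \<le> (\<integral>z. \<bar>?K z - P z\<bar> + norm (complex_of_real (P z) - N z) \<partial>lborel)"
    proof (rule integral_mono)
      show "integrable lborel (\<lambda>z. norm (complex_of_real (?K z) - N z))"
        using iK by (intro integrable_norm Bochner_Integration.integrable_diff iN) (simp only: complex_of_real_integrable_eq)
      show "norm (complex_of_real (?K z) - N z) \<le> \<bar>?K z - P z\<bar> + norm (complex_of_real (P z) - N z)" for z
        using norm_triangle_ineq[of "complex_of_real (?K z - P z)" "complex_of_real (P z) - N z"]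
        unfolding norm_of_real by simp
    qed (intro Bochner_Integration.integrable_add iKP iPN)
    also have "\<dots> = (\<integral>z. \<bar>?K z - P z\<bar> \<partial>lborel) + h"
      unfolding h_def by (rule Bochner_Integration.integral_add[OF iKP iPN])
    also have "(\<integral>z. \<bar>?K z - P z\<bar> \<partial>lborel) \<le> (\<integral>z. ?K z \<partial>lborel) - (\<integral>z. P z \<partial>lborel) + 2 * t
        + 2 * ((\<integral>z. P z \<partial>lborel) - (\<integral>z. indicator {z. \<epsilon> < norm z} z * P z \<partial>lborel))"
      unfolding t_def by (rule kernel_comparison[OF iK nn iP P0 PK \<epsilon>])
    finally show "G \<epsilon> + (\<integral>z. norm (complex_of_real (?K z) - N z) \<partial>lborel) \<le> (\<integral>z. ?K z \<partial>lborel)"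
      unfolding G_def intP by simp
  qed
  moreover have "ennreal (lam + c * \<mu> / 2) \<le> ennreal (lam + (c * \<mu> - 2 * t - h - 2 * (c * \<mu> - (\<integral>z. P z \<partial>lborel))))"
    unfolding intP using t h by (intro ennreal_leI) argo
  ultimately have "ennreal (lam + c * \<mu> / 2) * luxemburg_norm_distr A (lp_block \<nu> \<theta> j u) \<le>
    luxemburg_norm_distr A (\<lambda>\<phi>. complex_of_real lam * lp_block \<nu> \<theta> j u \<phi> -
      Lim (at_right 0) (\<lambda>\<epsilon>. truncated_generator K \<epsilon> (lp_block \<nu> \<theta> j u) \<phi>))"
    by (meson mult_right_mono order_trans zero_le)
  then show ?thesis by (simp add: lp_block_resolvent \<mu>_def K_def)
qed

end

section \<open>The a priori estimate\<close>

text \<open>The choice \<open>\<tau> = \<rho>\<^sup>2 / (8 ln b)\<close> turns the exponential into \<open>1 / b\<close>.\<close>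

lemma exists_small_heat_tail:
  assumes \<rho>: "(0::real) < \<rho>"
  shows "\<exists>\<tau>>0. 2 powr (real d / 2) * exp (- (\<rho>\<^sup>2 / (8 * \<tau>))) \<le> 1 / 8"
proof -
  define b where "b = 8 * 2 powr (real d / 2)"
  have "1 \<le> 2 powr (real d / 2)" by (simp add: ge_one_powr_ge_zero)
  then have b: "1 < b" by (simp add: b_def)
  have "\<rho>\<^sup>2 / (8 * (\<rho>\<^sup>2 / (8 * ln b))) = ln b" using \<rho> b by simp
  then have "2 powr (real d / 2) * exp (- (\<rho>\<^sup>2 / (8 * (\<rho>\<^sup>2 / (8 * ln b))))) = 2 powr (real d / 2) * inverse b"
    using b by (simp add: exp_minus)
  also have "\<dots> = 1 / 8" by (simp add: b_def inverse_eq_divide)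
  finally show ?thesis using \<rho> b by (intro exI[of _ "\<rho>\<^sup>2 / (8 * ln b)"]) auto
qed

context littlewood_paley
begin

text \<open>The constant is quantified before the N-function, the coefficient, the distribution, the index and \<open>lam\<close>, since it may depend
on none of them.\<close>

definition block_bound :: "real \<Rightarrow> real \<Rightarrow> real \<Rightarrow> bool" where
  "block_bound \<rho> c C \<longleftrightarrow> (\<forall>A (a :: 'a \<Rightarrow> real) j u (lam :: real). valid_orlicz A \<longrightarrow>
     a \<in> borel_measurable borel \<longrightarrow> (\<forall>z. 0 \<le> a z) \<longrightarrow>
     (\<integral>\<^sup>+z. ennreal (min 1 ((norm z)\<^sup>2) * (a z * jump_kernel \<nu> z)) \<partial>lborel) < \<infinity> \<longrightarrow>
     (\<forall>z. norm z < \<rho> \<longrightarrow> c \<le> a z) \<longrightarrow> tempered u \<longrightarrow> nonlocal_op_defined \<nu> a u \<longrightarrow> 1 \<le> lam \<longrightarrow> -1 \<le> j \<longrightarrow>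
     luxemburg_norm_distr A (lp_block \<nu> \<theta> j u) < \<infinity> \<longrightarrow>
     ennreal lam * luxemburg_norm_distr A (lp_block \<nu> \<theta> j u)
       \<le> luxemburg_norm_distr A (lp_block \<nu> \<theta> j (\<lambda>\<phi>. complex_of_real lam * u \<phi> - nonlocal_op \<nu> a u \<phi>)) \<and>
     ennreal (2 powr real_of_int j) * luxemburg_norm_distr A (lp_block \<nu> \<theta> j u)
       \<le> ennreal C * luxemburg_norm_distr A (lp_block \<nu> \<theta> j (\<lambda>\<phi>. complex_of_real lam * u \<phi> - nonlocal_op \<nu> a u \<phi>)))"

text \<open>The parameters are chosen in this order: \<open>\<tau>\<close> from \<open>\<rho>\<close>, \<open>M\<close> from the cutoff, and then the threshold for \<open>j\<close>, which
depends on both, from the growth of the Laplace exponent.\<close>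

lemma uniform_block_estimate:
  fixes \<rho> c :: real
  assumes sv: "slowly_varying (laplace_exponent \<nu>)" and \<rho>: "0 < \<rho>" and c: "0 < c"
  shows "\<exists>C>0. block_bound \<rho> c C"
proof -
  define C\<^sub>\<theta> where "C\<^sub>\<theta> = (\<integral>y. norm y * norm (multiplier_kernel (dilated_cutoff 1) (y::'a)) \<partial>lborel)"
  have C\<theta>: "0 \<le> C\<^sub>\<theta>" by (simp add: C\<^sub>\<theta>_def)
  \<comment> \<open>With \<open>s = M / (band j)\<^sup>2\<close> the hypothesis \<open>moment\<close> of \<open>block_coercive_estimate\<close> reads \<open>6 C\<^sub>\<theta> / sqrt M \<le> 1/4\<close>.\<close>
  define M where "M = (24 * C\<^sub>\<theta> + 1)\<^sup>2"
  have M: "0 < M" using C\<theta> by (simp add: M_def)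
  obtain \<tau> where \<tau>: "0 < \<tau>" "2 powr (real DIM('a) / 2) * exp (- (\<rho>\<^sup>2 / (8 * \<tau>))) \<le> 1 / 8"
    using exists_small_heat_tail[OF \<rho>] by blast
  obtain s\<^sub>0 where s0: "0 < s\<^sub>0" "\<And>s. s\<^sub>0 \<le> s \<Longrightarrow> laplace_exponent \<nu> s / 2 \<le> measure \<nu> {M / s<..\<tau>}"
    using laplace_exponent_mass[OF levy sv unbounded M \<tau>(1)] by blast
  define Y where "Y = max 1 (laplace_exponent \<nu> s\<^sub>0)"
  define C where "C = max (4 / c) Y"
  have C: "0 < C" "4 / c \<le> C" "Y \<le> C" using c by (auto simp: C_def Y_def)
  show ?thesis
    unfolding block_bound_def
  proof (intro exI[of _ C] conjI allI impI)
    show "0 < C" by (rule C(1))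
    fix A and a :: "'a \<Rightarrow> real" and j and u :: "'a distr" and lam :: real
    assume A: "valid_orlicz A" and am: "a \<in> borel_measurable borel" and a0: "\<forall>z. 0 \<le> a z"
      and a2: "(\<integral>\<^sup>+z. ennreal (min 1 ((norm z)\<^sup>2) * (a z * jump_kernel \<nu> z)) \<partial>lborel) < \<infinity>"
      and ac: "\<forall>z. norm z < \<rho> \<longrightarrow> c \<le> a z" and u: "tempered u" and def: "nonlocal_op_defined \<nu> a u"
      and lam: "1 \<le> lam" and j: "-1 \<le> j" and fin: "luxemburg_norm_distr A (lp_block \<nu> \<theta> j u) < \<infinity>"
    let ?N = "luxemburg_norm_distr A (lp_block \<nu> \<theta> j u)"
    let ?W = "luxemburg_norm_distr A (lp_block \<nu> \<theta> j (\<lambda>\<phi>. complex_of_real lam * u \<phi> - nonlocal_op \<nu> a u \<phi>))"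
    have lam0: "0 < lam" using lam by simp
    show diss: "ennreal lam * ?N \<le> ?W"
      by (rule block_dissipative_estimate[OF A fin lam0 am a0[rule_format] a2 def])
    show "ennreal (2 powr real_of_int j) * ?N \<le> ennreal C * ?W"
    \<comment> \<open>In the first case \<open>2\<^sup>j\<close> is bounded and absorbed by \<open>lam \<ge> 1\<close>; in the second \<open>(band j)\<^sup>2 \<ge> s\<^sub>0\<close>.\<close>
    proof (cases "2 powr real_of_int j \<le> Y")
      case True
      have "ennreal (2 powr real_of_int j) * ?N \<le> ennreal (Y * lam) * ?N"
      proof (intro mult_right_mono ennreal_leI)
        have "Y * 1 \<le> Y * lam" using lam by (intro mult_left_mono) (auto simp: Y_def)
        then show "2 powr real_of_int j \<le> Y * lam" using True by simp
      qed simp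
      also have "\<dots> = ennreal Y * (ennreal lam * ?N)"
        using lam0 by (simp add: Y_def ennreal_mult mult.assoc)
      also have "\<dots> \<le> ennreal C * ?W" using C by (intro mult_mono ennreal_leI diss) auto
      finally show ?thesis .
    next
      case False
      have j1: "j \<noteq> -1"
      proof
        assume "j = -1"
        then have "2 powr real_of_int j \<le> 1" by (simp add: powr_minus)
        then show False using False by (simp add: Y_def)
      qed
      have "s\<^sub>0 < (band j)\<^sup>2"
        unfolding band_def using False s0(1) by (intro psi_inv_greater[OF levy unbounded]) (auto simp: Y_def)
      then have "laplace_exponent \<nu> ((band j)\<^sup>2) / 2 \<le> measure \<nu> {M / (band j)\<^sup>2<..\<tau>}" by (intro s0(2)) simp
      moreover have "laplace_exponent \<nu> ((band j)\<^sup>2) = 2 powr real_of_int j"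
        using psi_inv(2)[OF levy unbounded, of "2 powr real_of_int j"] by (simp add: band_def psi_def)
      ultimately have mass: "2 powr real_of_int j / 2 \<le> measure \<nu> {M / (band j)\<^sup>2<..\<tau>}" by simp
      have s: "0 < M / (band j)\<^sup>2" using M band_pos[of j] by simp
      have "band j * sqrt (M / (band j)\<^sup>2) = 24 * C\<^sub>\<theta> + 1"
        using band_pos[of j] C\<theta> by (simp add: M_def real_sqrt_divide)
      then have moment: "6 * C\<^sub>\<theta> / (band j * sqrt (M / (band j)\<^sup>2)) \<le> 1 / 4"
        using C\<theta> by (simp add: divide_simps)
      have "ennreal (2 powr real_of_int j) * ?N \<le> ennreal (4 / c * (lam + c * measure \<nu> {M / (band j)\<^sup>2<..\<tau>} / 2)) * ?N"
      proof (intro mult_right_mono ennreal_leI)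
        have "2 powr real_of_int j = 4 / c * (c * (2 powr real_of_int j / 2) / 2)" using c by simp
        also have "\<dots> \<le> 4 / c * (c * measure \<nu> {M / (band j)\<^sup>2<..\<tau>} / 2)"
          using c mass by (intro mult_left_mono divide_right_mono) auto
        also have "\<dots> \<le> 4 / c * (lam + c * measure \<nu> {M / (band j)\<^sup>2<..\<tau>} / 2)"
          using c lam0 by (intro mult_left_mono) auto
        finally show "2 powr real_of_int j \<le> 4 / c * (lam + c * measure \<nu> {M / (band j)\<^sup>2<..\<tau>} / 2)" .
      qed simp
      also have "\<dots> = ennreal (4 / c) * (ennreal (lam + c * measure \<nu> {M / (band j)\<^sup>2<..\<tau>} / 2) * ?N)"
        using c lam0 by (subst ennreal_mult) (auto simp: mult.assoc intro!: add_nonneg_nonneg)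
      also have "\<dots> \<le> ennreal C * ?W"
        using C block_coercive_estimate[OF A fin lam0 am a0[rule_format] a2 def \<rho> c ac[rule_format] u j1 s \<tau>(1,2) moment[unfolded C\<^sub>\<theta>_def]]
        by (intro mult_mono ennreal_leI) auto
      finally show ?thesis .
    qed
  qed
qed

end

text \<open>The block estimates are multiplied by \<open>2 powr (j \<alpha>)\<close> before the supremum over \<open>j\<close> is taken. This weight is the same on
both sides, so the constant is the same for all \<open>\<alpha>\<close>, and one is a threshold for \<open>lam\<close>.\<close>

theorem theorem4p1:
  fixes \<nu> :: "real measure" and \<theta> :: "'a::euclidean_space \<Rightarrow> real" and \<rho>\<^sub>0 c\<^sub>0 :: real
  assumes "levy_measure \<nu>"
    and "slowly_varying (laplace_exponent \<nu>)"
    and "filterlim (laplace_exponent \<nu>) at_top at_top"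
    and "lp_cutoff \<theta>"
    and "0 < \<rho>\<^sub>0" "\<rho>\<^sub>0 < 1" "0 < c\<^sub>0" "c\<^sub>0 < 1"
  shows "\<exists>C :: real \<Rightarrow> real. (\<forall>\<alpha>. 0 < C \<alpha>) \<and>
    (\<forall>(A :: orlicz) (a :: 'a \<Rightarrow> real).
      valid_orlicz A \<longrightarrow>
      a \<in> borel_measurable borel \<longrightarrow>
      (\<forall>z. 0 \<le> a z) \<longrightarrow>
      (\<integral>\<^sup>+z. ennreal (min 1 ((norm z)\<^sup>2) * (a z * jump_kernel \<nu> z)) \<partial>lborel) < \<infinity> \<longrightarrow>
      (\<forall>z. norm z < \<rho>\<^sub>0 \<longrightarrow> c\<^sub>0 \<le> a z) \<longrightarrow>
      (\<exists>lam\<^sub>0>0. \<forall>lam\<ge>lam\<^sub>0. \<forall>\<alpha>. \<forall>u \<in> besov_space \<nu> \<theta> A (1 + \<alpha>).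
         nonlocal_op_defined \<nu> a u \<longrightarrow>
         ennreal lam * besov_norm \<nu> \<theta> A \<alpha> u + besov_norm \<nu> \<theta> A (1 + \<alpha>) u
           \<le> ennreal (C \<alpha>) *
              besov_norm \<nu> \<theta> A \<alpha> (\<lambda>\<phi>. complex_of_real lam * u \<phi> - nonlocal_op \<nu> a u \<phi>)))"
proof -
  interpret littlewood_paley \<nu> \<theta> by unfold_locales fact+
  obtain C where C: "0 < C" and est: "block_bound \<rho>\<^sub>0 c\<^sub>0 C"
    using uniform_block_estimate[OF assms(2,5,7)] by blast
  show ?thesis
  proof (intro exI[of _ "\<lambda>_. 1 + C"] conjI allI impI)
    show "0 < 1 + C" using C by simp
    fix A and a :: "'a \<Rightarrow> real"
    assume A: "valid_orlicz A" and am: "a \<in> borel_measurable borel" and a0: "\<forall>z. 0 \<le> a z"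
      and a2: "(\<integral>\<^sup>+z. ennreal (min 1 ((norm z)\<^sup>2) * (a z * jump_kernel \<nu> z)) \<partial>lborel) < \<infinity>"
      and ac: "\<forall>z. norm z < \<rho>\<^sub>0 \<longrightarrow> c\<^sub>0 \<le> a z"
    show "\<exists>lam\<^sub>0>0. \<forall>lam\<ge>lam\<^sub>0. \<forall>\<alpha>. \<forall>u \<in> besov_space \<nu> \<theta> A (1 + \<alpha>).
         nonlocal_op_defined \<nu> a u \<longrightarrow>
         ennreal lam * besov_norm \<nu> \<theta> A \<alpha> u + besov_norm \<nu> \<theta> A (1 + \<alpha>) u
           \<le> ennreal (1 + C) *
              besov_norm \<nu> \<theta> A \<alpha> (\<lambda>\<phi>. complex_of_real lam * u \<phi> - nonlocal_op \<nu> a u \<phi>)"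
    proof (intro exI[of _ 1] conjI allI ballI impI)
      fix lam \<alpha> :: real and u
      assume lam: "1 \<le> lam" and u: "u \<in> besov_space \<nu> \<theta> A (1 + \<alpha>)" and def: "nonlocal_op_defined \<nu> a u"
      let ?w = "\<lambda>\<phi>. complex_of_real lam * u \<phi> - nonlocal_op \<nu> a u \<phi>"
      let ?N = "\<lambda>j. luxemburg_norm_distr A (lp_block \<nu> \<theta> j u)"
      let ?W = "\<lambda>j. luxemburg_norm_distr A (lp_block \<nu> \<theta> j ?w)"
      have temp: "tempered u" and besov: "besov_norm \<nu> \<theta> A (1 + \<alpha>) u < \<infinity>" using u by (auto simp: besov_space_def)
      have fin: "?N j < \<infinity>" if "-1 \<le> j" for j
      proof -
        have "ennreal (2 powr (real_of_int j * (1 + \<alpha>))) * ?N j \<le> besov_norm \<nu> \<theta> A (1 + \<alpha>) u"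
          unfolding besov_norm_def using that by (intro SUP_upper) simp
        then have "ennreal (2 powr (real_of_int j * (1 + \<alpha>))) * ?N j < \<infinity>" using besov by (rule le_less_trans)
        then show ?thesis by (auto simp: ennreal_mult_less_top)
      qed
      have est1: "ennreal lam * ?N j \<le> ?W j" and est2: "ennreal (2 powr real_of_int j) * ?N j \<le> ennreal C * ?W j" if "-1 \<le> j" for j
        using est[unfolded block_bound_def, rule_format, OF A am a0[rule_format] a2 ac[rule_format] temp def lam that fin[OF that]] by auto
      have weight: "ennreal (2 powr (real_of_int j * \<alpha>)) * ?W j \<le> besov_norm \<nu> \<theta> A \<alpha> ?w" if "-1 \<le> j" for j
        unfolding besov_norm_def using that by (intro SUP_upper) simp
      have "ennreal lam * besov_norm \<nu> \<theta> A \<alpha> u = (SUP j \<in> {-1..}. ennreal lam * (ennreal (2 powr (real_of_int j * \<alpha>)) * ?N j))"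
        unfolding besov_norm_def by (rule SUP_mult_left_ennreal)
      also have "\<dots> \<le> besov_norm \<nu> \<theta> A \<alpha> ?w"
      proof (intro SUP_least)
        fix j :: int assume "j \<in> {-1..}"
        then have j: "-1 \<le> j" by simp
        have "ennreal lam * (ennreal (2 powr (real_of_int j * \<alpha>)) * ?N j) = ennreal (2 powr (real_of_int j * \<alpha>)) * (ennreal lam * ?N j)"
          by (simp only: mult.left_commute)
        also have "\<dots> \<le> ennreal (2 powr (real_of_int j * \<alpha>)) * ?W j" by (intro mult_left_mono est1 j) simp
        also have "\<dots> \<le> besov_norm \<nu> \<theta> A \<alpha> ?w" by (rule weight[OF j])
        finally show "ennreal lam * (ennreal (2 powr (real_of_int j * \<alpha>)) * ?N j) \<le> besov_norm \<nu> \<theta> A \<alpha> ?w" .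
      qed
      finally have 1: "ennreal lam * besov_norm \<nu> \<theta> A \<alpha> u \<le> besov_norm \<nu> \<theta> A \<alpha> ?w" .
      have 2: "besov_norm \<nu> \<theta> A (1 + \<alpha>) u \<le> ennreal C * besov_norm \<nu> \<theta> A \<alpha> ?w"
        unfolding besov_norm_def[of _ _ _ "1 + \<alpha>"]
      proof (intro SUP_least)
        fix j :: int assume "j \<in> {-1..}"
        then have j: "-1 \<le> j" by simp
        have "2 powr (real_of_int j * (1 + \<alpha>)) = 2 powr (real_of_int j * \<alpha>) * 2 powr real_of_int j"
          by (simp add: powr_add[symmetric] algebra_simps)
        then have "ennreal (2 powr (real_of_int j * (1 + \<alpha>))) * ?N j = ennreal (2 powr (real_of_int j * \<alpha>)) * (ennreal (2 powr real_of_int j) * ?N j)"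
          by (simp add: ennreal_mult mult.assoc)
        also have "\<dots> \<le> ennreal (2 powr (real_of_int j * \<alpha>)) * (ennreal C * ?W j)" by (intro mult_left_mono est2 j) simp
        also have "\<dots> = ennreal C * (ennreal (2 powr (real_of_int j * \<alpha>)) * ?W j)" by (simp only: mult.left_commute)
        also have "\<dots> \<le> ennreal C * besov_norm \<nu> \<theta> A \<alpha> ?w" by (intro mult_left_mono weight j) simp
        finally show "ennreal (2 powr (real_of_int j * (1 + \<alpha>))) * ?N j \<le> ennreal C * besov_norm \<nu> \<theta> A \<alpha> ?w" .
      qed
      have "ennreal lam * besov_norm \<nu> \<theta> A \<alpha> u + besov_norm \<nu> \<theta> A (1 + \<alpha>) u \<le> 1 * besov_norm \<nu> \<theta> A \<alpha> ?w + ennreal C * besov_norm \<nu> \<theta> A \<alpha> ?w"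
        using add_mono[OF 1 2] by simp
      also have "\<dots> = ennreal (1 + C) * besov_norm \<nu> \<theta> A \<alpha> ?w"
        using C by (simp add: distrib_right ennreal_plus)
      finally show "ennreal lam * besov_norm \<nu> \<theta> A \<alpha> u + besov_norm \<nu> \<theta> A (1 + \<alpha>) u \<le> ennreal (1 + C) * besov_norm \<nu> \<theta> A \<alpha> ?w" .
    qed simp
  qed
qed

end
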